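(* Let $d\ge 1$ and let $\mu$ be a stochastic measure on the Borel $\sigma$-algebra $\mathcal{B}([0,1]^d)$. Assume that there exists a real-valued finite measure $\mathsf{m}$ on $([0,1]^d,\mathcal{B}([0,1]^d))$ with the following property: if a measurable function $g:[0,1]^d\to\mathbb{R}$ is such that $\int_{[0,1]^d}2^{\lambda|g|}\,d\mathsf{m}<+\infty$ for all real $\lambda>0$, then $g$ is integrable with respect to $\mu$ on $[0,1]^d$. For $x=(x_1,\dots,x_d)\in[0,1]^d$ set $\mu(x)=\mu\bigl(\prod_{i=1}^d[0,x_i]\bigr)$, and assume that the random function $\mu(x)$, $x\in[0,1]^d$, has continuous realizations. Then for any $1\le p<+\infty$ and $0<\alpha<\min\{1/p,1/2\}$, the realization $\mu(x)$, $x\in[0,1]^d$, belongs with probability $1$ to the Besov space $B^\alpha_{p,p}([0,1]^d)$.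
   Context: Let $(\Omega,\mathcal{F},\mathsf{P})$ be a complete probability space and $\mathsf{L}_0=\mathsf{L}_0(\Omega,\mathcal{F},\mathsf{P})$ the set of all real-valued random variables on it, with convergence in probability. For a measurable space $(\mathsf{X},\mathcal{B})$, a stochastic measure (SM) is a $\sigma$-additive mapping $\mu:\mathcal{B}\to\mathsf{L}_0$ (i.e. for pairwise disjoint $A_n\in\mathcal{B}$, $\mu(\bigcup_n A_n)=\sum_n\mu(A_n)$ with the series converging in probability). No moment existence or martingale property is assumed. Integral of deterministic functions: for a simple measurable function $f=\sum_i c_i\mathbf{1}_{A_i}$ and $A\in\mathcal{B}$ set $\int_A f\,d\mu=\sum_i c_i\,\mu(A\cap A_i)$. A measurable $g:\mathsf{X}\to\mathbb{R}$ is integrable with respect to $\mu$ on $\mathsf{X}$ if there are simple functions $g_n\to g$ pointwise such that for every $A\in\mathcal{B}$ the sequence $\int_A g_n\,d\mu$ converges in probability; the limit is denoted $\int_A g\,d\mu$ (it does not depend on the choice of the sequence). Besov spaces: for $f\in \mathsf{L}_p([0,1]^d)$ (with respect to Lebesgue measure) set $$\|f\|_{B^\alpha_{p,q}([0,1]^d)}=\|f\|_{\mathsf{L}_p([0,1]^d)}+\Bigl(\int_0^1(\omega_p(f,r))^q r^{-\alpha q-1}\,dr\Bigr)^{1/q},$$ where $$\omega_p(f,r)=\sup_{|h|\le r}\Bigl(\int_{I_h}|f(x+h)-f(x)|^p\,dx\Bigr)^{1/p},\qquad I_h=\{x\in[0,1]^d:\ x+h\in[0,1]^d\},$$ and $|h|$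 is the Euclidean norm of $h\in\mathbb{R}^d$. Then $B^\alpha_{p,q}([0,1]^d)=\{f\in \mathsf{L}_p([0,1]^d):\ \|f\|_{B^\alpha_{p,q}([0,1]^d)}<+\infty\}$. *)

theory Defs
  imports "HOL-Probability.Probability"
begin

definition converges_in_prob ::
  "'w measure \<Rightarrow> (nat \<Rightarrow> 'w \<Rightarrow> real) \<Rightarrow> ('w \<Rightarrow> real) \<Rightarrow> bool" where
  "converges_in_prob M X Y \<longleftrightarrow>
     (\<forall>e>0. (\<lambda>n. measure M {w \<in> space M. \<bar>X n w - Y w\<bar> > e}) \<longlonglongrightarrow> 0)"

text \<open>
  Elements of \<open>L\<^sub>0\<close> are represented by measurable functions; since limits in probability are
  unique only up to null sets, equalities in \<open>L\<^sub>0\<close> are almost sure equalities. Only the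
  sigma-algebra of \<open>N\<close> is used, not its measure.
\<close>

definition stochastic_measure ::
  "'w measure \<Rightarrow> 'x measure \<Rightarrow> ('x set \<Rightarrow> 'w \<Rightarrow> real) \<Rightarrow> bool" where
  "stochastic_measure M N \<mu> \<longleftrightarrow>
     (\<forall>A\<in>sets N. \<mu> A \<in> borel_measurable M) \<and>
     (\<forall>A :: nat \<Rightarrow> 'x set. range A \<subseteq> sets N \<longrightarrow> disjoint_family A \<longrightarrow>
        converges_in_prob M (\<lambda>n w. \<Sum>i<n. \<mu> (A i) w) (\<mu> (\<Union>i. A i)))"

text \<open>As for \<^const>\<open>simple_integral\<close>, the representation of the simple function by its level sets
  is used; by additivity of \<open>\<mu>\<close> any other representation gives the same result almost surely.\<close>

definition sm_simple_integral ::
  "'x measure \<Rightarrow> ('x set \<Rightarrow> 'w \<Rightarrow> real) \<Rightarrow> 'x set \<Rightarrow> ('x \<Rightarrow> real) \<Rightarrow> 'w \<Rightarrow> real" where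
  "sm_simple_integral N \<mu> A f w = (\<Sum>c\<in>f ` space N. c * \<mu> (A \<inter> (f -` {c} \<inter> space N)) w)"

definition sm_integrable ::
  "'w measure \<Rightarrow> 'x measure \<Rightarrow> ('x set \<Rightarrow> 'w \<Rightarrow> real) \<Rightarrow> ('x \<Rightarrow> real) \<Rightarrow> bool" where
  "sm_integrable M N \<mu> g \<longleftrightarrow>
     g \<in> borel_measurable N \<and>
     (\<exists>G :: nat \<Rightarrow> 'x \<Rightarrow> real.
        (\<forall>n. simple_function N (G n)) \<and>
        (\<forall>x\<in>space N. (\<lambda>n. G n x) \<longlonglongrightarrow> g x) \<and>
        (\<forall>A\<in>sets N. \<exists>Y\<in>borel_measurable M.
           converges_in_prob M (\<lambda>n. sm_simple_integral N \<mu> A (G n)) Y))"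

text \<open>Extended nonnegative reals are used for all norms, so that divergent integrals and unbounded
  suprema have the value \<open>\<infinity>\<close>. The power below is meant for positive exponents.\<close>

definition epowr :: "ennreal \<Rightarrow> real \<Rightarrow> ennreal" where
  "epowr a s = (if a = \<infinity> then \<infinity> else ennreal (enn2real a powr s))"

abbreviation unit_cube :: "(real^'n) set" where
  "unit_cube \<equiv> cbox 0 1"

definition Lp_norm :: "real \<Rightarrow> (real^'n \<Rightarrow> real) \<Rightarrow> ennreal" where
  "Lp_norm p f = epowr (\<integral>\<^sup>+x. ennreal (\<bar>f x\<bar> powr p) \<partial>lebesgue_on unit_cube) (1 / p)"

definition Lp_space :: "real \<Rightarrow> (real^'n \<Rightarrow> real) set" where
  "Lp_space p = {f \<in> borel_measurable (lebesgue_on unit_cube). Lp_norm p f < \<infinity>}"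

definition Lp_modulus :: "real \<Rightarrow> (real^'n \<Rightarrow> real) \<Rightarrow> real \<Rightarrow> ennreal" where
  "Lp_modulus p f r =
     (SUP h\<in>{h. norm h \<le> r}.
        epowr (\<integral>\<^sup>+x. ennreal (\<bar>f (x + h) - f x\<bar> powr p)
                 \<partial>lebesgue_on {x \<in> unit_cube. x + h \<in> unit_cube}) (1 / p))"

definition besov_norm :: "real \<Rightarrow> real \<Rightarrow> real \<Rightarrow> (real^'n \<Rightarrow> real) \<Rightarrow> ennreal" where
  "besov_norm \<alpha> p q f =
     Lp_norm p f +
     epowr (\<integral>\<^sup>+r. epowr (Lp_modulus p f r) q * ennreal (r powr (- \<alpha> * q - 1))
              \<partial>lebesgue_on {0<..<1}) (1 / q)"

definition besov_space :: "real \<Rightarrow> real \<Rightarrow> real \<Rightarrow> (real^'n \<Rightarrow> real) set" where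
  "besov_space \<alpha> p q = {f \<in> Lp_space p. besov_norm \<alpha> p q f < \<infinity>}"

end

theory Submission
  imports Defs
begin

text \<open>\<^emph>\<open>From slabs to random signs.\<close> The increment of \<open>x \<mapsto> \<mu>[0, x]\<close> along an edge of the dyadic grid of
mesh \<open>2\<^sup>-\<^sup>m\<close> is the value of \<open>\<mu>\<close> on the slab between two boxes. The slabs of one direction overlap, but
a given point lies in at most about \<open>2 ^ (m (d - 1))\<close> of them. Hence a sum of their indicators with
random signs, scaled by \<open>2 ^ (m (\<beta> - d / 2))\<close>, is of order \<open>2 ^ (m (\<beta> - 1 / 2))\<close> at each point, and by
Hoeffding's inequality it exceeds this order by no more than a factor \<open>\<surd>m\<close> at all points
simultaneously, because it takes only about \<open>2 ^ (m d)\<close> different values. For \<open>\<beta> < 1 / 2\<close> these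
bounds are summable in \<open>m\<close>: most choices of signs on all levels up to any given one produce simple
functions bounded by one and the same constant.

\<^emph>\<open>From random signs to square sums.\<close> Integrals of simple functions bounded by a constant are bounded
in probability (\<open>dominated_simple_integrals_bounded\<close>). So the sums of the values of \<open>\<mu>\<close> on slabs,
with random signs, are bounded in probability, and by the Paley-Zygmund inequality the same holds
for the sums of squares. As these grow with the number of levels, they stay
bounded almost surely, that is, \<open>\<Sum>m. 2 ^ (m (2 \<beta> - d)) \<Sum>k. (\<mu> (slab m k))\<^sup>2\<close> is finite almost surely
(\<open>AE_summable_square_values\<close>).

\<^emph>\<open>From square sums to the Besov norm.\<close> This is a statement on a single continuous path. Its
increments are bounded, which for \<open>p > 2\<close> turns squares into \<open>p\<close>-th powers at the price of the
condition \<open>\<alpha> p < 1\<close>; for \<open>p < 2\<close> one truncates. Chaining through the dyadic levels bounds the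
\<open>L\<^sub>p\<close> modulus of continuity by \<open>r powr \<gamma>\<close> with some \<open>\<gamma> > \<alpha>\<close>
(\<open>in_besov_space_if_edge_energy_decays\<close>).

\<^emph>\<open>Boundedness of the range.\<close> The one deep ingredient is that the values of a measure with values
in \<open>L\<^sub>0\<close> are bounded in probability (\<open>range_bounded\<close>, a theorem of Talagrand and of Kalton, Peck
and Roberts). Suppose they are not, at some level \<open>\<eta>\<close> of probability. Choose sets \<open>A\<^sub>1, \<dots>, A\<^sub>K\<close> with
values of rapidly increasing size. A large value on \<open>A\<^sub>k\<close> cannot come from the cells generated by the earlier
sets, as their values are smaller by far; so it needs a new cell with a large value, and
one gets partitions with arbitrarily many arbitrarily large values, with a probability that is a fixed
fraction of \<open>\<eta>\<close> (\<open>unbounded_imp_many_large\<close>). Now colour the cells of such a partition at random with many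
colours. Almost every colour class contains a large cell, hence a subset with a large value. On the
other hand, for each outcome at most one class can carry all but a bounded number of the large
values, so removing a class costs on average only one over the number of colours of the probability
(\<open>some_class_removable\<close>). Thus one can split off a set with a large value while keeping the property of having many large values at
almost the same level of probability, and so on forever (\<open>many_large_step\<close>). The sets
split off are disjoint, and their values do not tend to zero: a contradiction.\<close>

section \<open>Random signs, random selections and random colourings\<close>

text \<open>Signs are encoded by the set \<open>S\<close> of indices that carry a plus. Averages over \<open>Pow I\<close> are then
expectations over independent fair signs.\<close>

definition signed_sum :: "'i set \<Rightarrow> ('i \<Rightarrow> real) \<Rightarrow> 'i set \<Rightarrow> real" where
  "signed_sum I x S = (\<Sum>i\<in>I. if i \<in> S then x i else - x i)"

lemma sum_Pow_insert:
  fixes g :: "'i set \<Rightarrow> real"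
  assumes "finite I" "i \<notin> I"
  shows "(\<Sum>S\<in>Pow (insert i I). g S) = (\<Sum>S\<in>Pow I. g S + g (insert i S))"
proof -
  have "inj_on (insert i) (Pow I)"
    using assms(2) by (auto simp: inj_on_def)
  moreover have "Pow I \<inter> insert i ` Pow I = {}"
    using assms(2) by auto
  ultimately show ?thesis
    using assms(1) by (simp add: Pow_insert sum.union_disjoint sum.reindex sum.distrib)
qed

lemma signed_sum_insert:
  assumes "finite I" "i \<notin> I" "S \<in> Pow I"
  shows "signed_sum (insert i I) x S = signed_sum I x S - x i"
    and "signed_sum (insert i I) x (insert i S) = signed_sum I x S + x i"
proof -
  have "i \<notin> S"
    using assms by auto
  then show "signed_sum (insert i I) x S = signed_sum I x S - x i"
    using assms by (simp add: signed_sum_def)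
  have "(\<Sum>j\<in>I. if j \<in> insert i S then x j else - x j) = (\<Sum>j\<in>I. if j \<in> S then x j else - x j)"
    using assms by (intro sum.cong) auto
  then show "signed_sum (insert i I) x (insert i S) = signed_sum I x S + x i"
    using assms by (simp add: signed_sum_def)
qed

lemma sum_Pow_signed_sum_insert:
  assumes "finite I" "i \<notin> I"
  shows "(\<Sum>S\<in>Pow (insert i I). (g (signed_sum (insert i I) x S) :: real)) =
    (\<Sum>S\<in>Pow I. g (signed_sum I x S - x i) + g (signed_sum I x S + x i))"
  unfolding sum_Pow_insert[OF assms]
  by (intro sum.cong refl) (simp add: signed_sum_insert[OF assms])

lemma signed_sum_second_moment:
  assumes "finite I"
  shows "(\<Sum>S\<in>Pow I. (signed_sum I x S)\<^sup>2) = 2 ^ card I * (\<Sum>i\<in>I. (x i)\<^sup>2)"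
  using assms
proof (induction I rule: finite_induct)
  case empty
  then show ?case by (simp add: signed_sum_def)
next
  case (insert i I)
  have eq: "(y - t)\<^sup>2 + (y + t)\<^sup>2 = 2 * y\<^sup>2 + 2 * t\<^sup>2" for y t :: real
    by (simp add: power2_eq_square algebra_simps)
  show ?case
    unfolding sum_Pow_signed_sum_insert[OF insert(1,2), where g="\<lambda>y. y\<^sup>2"] eq sum.distrib
      sum_distrib_left[symmetric] insert.IH
    using insert(1,2) by (simp add: card_Pow algebra_simps)
qed

text \<open>The constant 3 is that of the Gaussian; it survives the induction because a new term \<open>t\<close> adds
\<open>6 y\<^sup>2 t\<^sup>2 + t ^ 4\<close> to the average of \<open>y ^ 4\<close>.\<close>

lemma signed_sum_fourth_moment:
  assumes "finite I"
  shows "(\<Sum>S\<in>Pow I. (signed_sum I x S) ^ 4) \<le> 3 * 2 ^ card I * (\<Sum>i\<in>I. (x i)\<^sup>2)\<^sup>2"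
  using assms
proof (induction I rule: finite_induct)
  case empty
  then show ?case by (simp add: signed_sum_def)
next
  case (insert i I)
  have eq: "(y - t) ^ 4 + (y + t) ^ 4 = 2 * y ^ 4 + (12 * t\<^sup>2) * y\<^sup>2 + 2 * t ^ 4" for y t :: real
    by algebra
  let ?q = "\<Sum>i\<in>I. (x i)\<^sup>2"
  have "(\<Sum>S\<in>Pow (insert i I). (signed_sum (insert i I) x S) ^ 4) =
      2 * (\<Sum>S\<in>Pow I. (signed_sum I x S) ^ 4) + (12 * (x i)\<^sup>2) * (2 ^ card I * ?q)
        + 2 ^ card I * (2 * x i ^ 4)"
    unfolding sum_Pow_signed_sum_insert[OF insert(1,2), where g="\<lambda>y. y ^ 4"] eq sum.distrib
      sum_distrib_left[symmetric] signed_sum_second_moment[OF insert(1)]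
    using insert(1) by (simp add: card_Pow)
  also have "\<dots> \<le> 2 * (3 * 2 ^ card I * ?q\<^sup>2) + (12 * (x i)\<^sup>2) * (2 ^ card I * ?q)
        + 2 ^ card I * (2 * x i ^ 4)"
    using insert.IH by simp
  also have "\<dots> = 2 ^ card I * (6 * ?q\<^sup>2 + 12 * (x i)\<^sup>2 * ?q + 2 * x i ^ 4)"
    by (simp add: algebra_simps)
  also have "\<dots> \<le> 2 ^ card I * (6 * ((x i)\<^sup>2 + ?q)\<^sup>2)"
  proof (intro mult_left_mono)
    have "6 * ((x i)\<^sup>2 + ?q)\<^sup>2 = 6 * ?q\<^sup>2 + 12 * (x i)\<^sup>2 * ?q + 6 * x i ^ 4"
      by algebra
    then show "6 * ?q\<^sup>2 + 12 * (x i)\<^sup>2 * ?q + 2 * x i ^ 4 \<le> 6 * ((x i)\<^sup>2 + ?q)\<^sup>2"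
      by simp
  qed simp
  finally show ?case
    using insert(1,2) by (simp add: algebra_simps)
qed

text \<open>The power series are compared term by term, since \<open>2 ^ n * n! \<le> (2 n)!\<close>.\<close>

lemma cosh_le_exp_half_square: "cosh x \<le> exp (x\<^sup>2 / 2)" for x :: real
proof -
  have 1: "(\<lambda>n. if even n then x ^ n /\<^sub>R fact n else 0) sums cosh x"
    by (rule cosh_converges)
  have "(\<lambda>n. (if even (2 * n) then x ^ (2 * n) /\<^sub>R fact (2 * n) else 0)) sums cosh x"
  proof (subst sums_mono_reindex[of "\<lambda>n. 2 * n"])
    show "strict_mono (\<lambda>n::nat. 2 * n)" by (auto simp: strict_mono_def)
    show "(if even n then x ^ n /\<^sub>R fact n else 0) = 0" if "n \<notin> range ((*) 2)" for n
      using that by (auto elim!: evenE)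
  qed (use 1 in auto)
  then have cs: "(\<lambda>n. x ^ (2 * n) /\<^sub>R fact (2 * n)) sums cosh x"
    by simp
  have es: "(\<lambda>n. (x\<^sup>2 / 2) ^ n /\<^sub>R fact n) sums exp (x\<^sup>2 / 2)"
    by (rule exp_converges)
  have fact: "2 ^ n * fact n \<le> (fact (2 * n) :: real)" for n
  proof (induction n)
    case (Suc n)
    have "2 ^ Suc n * fact (Suc n) = 2 * real (Suc n) * (2 ^ n * fact n)"
      by (simp add: algebra_simps)
    also have "\<dots> \<le> 2 * real (Suc n) * (real (2 * n + 1) * fact (2 * n))"
    proof (intro mult_left_mono)
      have "2 ^ n * fact n \<le> 1 * (fact (2 * n) :: real)"
        using Suc.IH by simp
      also have "\<dots> \<le> real (2 * n + 1) * fact (2 * n)"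
        by (intro mult_right_mono) auto
      finally show "2 ^ n * fact n \<le> real (2 * n + 1) * fact (2 * n)" .
    qed auto
    also have "\<dots> = fact (2 * Suc n)"
      by (simp add: algebra_simps)
    finally show ?case .
  qed simp
  show ?thesis
  proof (rule sums_le[OF _ cs es])
    fix n
    have "x ^ (2 * n) / fact (2 * n) \<le> x ^ (2 * n) / (2 ^ n * fact n)"
      using fact[of n] by (intro divide_left_mono) (auto simp: power_mult)
    moreover have "(x\<^sup>2 / 2) ^ n /\<^sub>R fact n = x ^ (2 * n) / (2 ^ n * fact n)"
      unfolding power_divide power_mult[symmetric] by (simp add: field_simps)
    moreover have "x ^ (2 * n) /\<^sub>R fact (2 * n) = x ^ (2 * n) / fact (2 * n)"
      by (simp add: divide_inverse mult.commute)
    ultimately show "x ^ (2 * n) /\<^sub>R fact (2 * n) \<le> (x\<^sup>2 / 2) ^ n /\<^sub>R fact n"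
      by (simp only:)
  qed
qed

lemma signed_sum_exp_moment:
  assumes "finite I"
  shows "(\<Sum>S\<in>Pow I. exp (l * signed_sum I x S)) \<le> 2 ^ card I * exp (l\<^sup>2 * (\<Sum>i\<in>I. (x i)\<^sup>2) / 2)"
  using assms
proof (induction I rule: finite_induct)
  case empty
  then show ?case by (simp add: signed_sum_def)
next
  case (insert i I)
  have eq: "exp (l * (y - t)) + exp (l * (y + t)) = (2 * cosh (l * t)) * exp (l * y)" for y t :: real
  proof -
    have "exp (l * (y - t)) = exp (l * y) * exp (- (l * t))"
      by (simp add: mult_exp_exp right_diff_distrib)
    moreover have "exp (l * (y + t)) = exp (l * y) * exp (l * t)"
      by (simp add: mult_exp_exp distrib_left)
    moreover have "2 * cosh (l * t) = exp (l * t) + exp (- (l * t))"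
      unfolding cosh_field_def by simp
    ultimately show ?thesis
      by (simp add: distrib_left mult.commute add.commute)
  qed
  let ?q = "\<Sum>i\<in>I. (x i)\<^sup>2"
  have "(\<Sum>S\<in>Pow (insert i I). exp (l * signed_sum (insert i I) x S)) =
      (2 * cosh (l * x i)) * (\<Sum>S\<in>Pow I. exp (l * signed_sum I x S))"
    unfolding sum_Pow_signed_sum_insert[OF insert(1,2), where g="\<lambda>y. exp (l * y)"] eq
      sum_distrib_left[symmetric] by simp
  also have "\<dots> \<le> (2 * exp ((l * x i)\<^sup>2 / 2)) * (2 ^ card I * exp (l\<^sup>2 * ?q / 2))"
  proof (rule mult_mono)
    show "2 * cosh (l * x i) \<le> 2 * exp ((l * x i)\<^sup>2 / 2)"
      using cosh_le_exp_half_square[of "l * x i"] by simp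
  qed (use insert.IH in \<open>simp_all add: sum_nonneg\<close>)
  also have "\<dots> = 2 ^ Suc (card I) * exp (l\<^sup>2 * ((x i)\<^sup>2 + ?q) / 2)"
  proof -
    have "exp (l\<^sup>2 * ((x i)\<^sup>2 + ?q) / 2) = exp ((l * x i)\<^sup>2 / 2) * exp (l\<^sup>2 * ?q / 2)"
      unfolding mult_exp_exp by (simp add: distrib_left add_divide_distrib power_mult_distrib)
    then show ?thesis by simp
  qed
  finally show ?case
    using insert(1,2) by simp
qed

text \<open>The square of the sum has mean \<open>q\<close> and second moment at most \<open>3 q\<^sup>2\<close>, so it is not concentrated
near zero: it reaches \<open>q / 4\<close> for at least 3 out of 16 choices of signs.\<close>

lemma signed_sum_Paley_Zygmund:
  assumes "finite I"
  shows "3 * 2 ^ card I \<le>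
    16 * real (card {S \<in> Pow I. (\<Sum>i\<in>I. (x i)\<^sup>2) / 4 \<le> (signed_sum I x S)\<^sup>2})"
proof (cases "(\<Sum>i\<in>I. (x i)\<^sup>2) = 0")
  case True
  have "{S \<in> Pow I. (\<Sum>i\<in>I. (x i)\<^sup>2) / 4 \<le> (signed_sum I x S)\<^sup>2} = Pow I"
    using True by auto
  then show ?thesis
    using assms by (simp add: card_Pow)
next
  case False
  define q where "q = (\<Sum>i\<in>I. (x i)\<^sup>2)"
  define G where "G = {S \<in> Pow I. q / 4 \<le> (signed_sum I x S)\<^sup>2}"
  have q: "q > 0"
    using False unfolding q_def by (metis less_eq_real_def sum_nonneg zero_le_power2)
  have fin: "finite (Pow I)"
    using assms by simp
  have pt: "(signed_sum I x S)\<^sup>2 \<le> q / 4 + (signed_sum I x S) ^ 4 / (8 * q) + 2 * q * indicator G S"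
    if "S \<in> Pow I" for S
  proof -
    define u where "u = (signed_sum I x S)\<^sup>2"
    \<comment> \<open>The inequality of the means, with weights such that the fourth moment enters with \<open>1 / (8 q)\<close>,
      replaces the Cauchy-Schwarz inequality.\<close>
    have u4: "(signed_sum I x S) ^ 4 = u\<^sup>2"
      unfolding u_def by simp
    have "0 \<le> (u - 4 * q)\<^sup>2 / (8 * q)"
      using q by simp
    also have "\<dots> = u\<^sup>2 / (8 * q) - u + 2 * q"
      using q by (simp add: power2_eq_square field_simps)
    finally have "u \<le> u\<^sup>2 / (8 * q) + 2 * q" by simp
    moreover have small: "u \<le> q / 4" if "S \<notin> G"
      using that \<open>S \<in> Pow I\<close> unfolding G_def u_def by auto
    moreover have "0 \<le> u\<^sup>2 / (8 * q)"
      using q by simp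
    ultimately show ?thesis
      unfolding u4 u_def[symmetric] using q
    proof (cases "S \<in> G")
      case True
      then show "u \<le> q / 4 + u\<^sup>2 / (8 * q) + 2 * q * indicat_real G S"
        using q \<open>u \<le> u\<^sup>2 / (8 * q) + 2 * q\<close> by simp
    next
      case False
      then have "u \<le> q / 4" by (rule small)
      then show "u \<le> q / 4 + u\<^sup>2 / (8 * q) + 2 * q * indicat_real G S"
        using False \<open>0 \<le> u\<^sup>2 / (8 * q)\<close> by simp
    qed
  qed
  have "2 ^ card I * q = (\<Sum>S\<in>Pow I. (signed_sum I x S)\<^sup>2)"
    unfolding q_def signed_sum_second_moment[OF assms] ..
  also have "\<dots> \<le> (\<Sum>S\<in>Pow I. q / 4 + (signed_sum I x S) ^ 4 / (8 * q) + 2 * q * indicator G S)"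
    by (intro sum_mono pt)
  also have "\<dots> = 2 ^ card I * (q / 4) + (\<Sum>S\<in>Pow I. (signed_sum I x S) ^ 4) / (8 * q)
      + 2 * q * (\<Sum>S\<in>Pow I. indicator G S)"
    using assms by (simp add: sum.distrib sum_distrib_left sum_divide_distrib card_Pow)
  also have "(\<Sum>S\<in>Pow I. indicator G S :: real) = real (card G)"
  proof -
    have "(\<Sum>S\<in>Pow I. indicator G S :: real) = (\<Sum>S\<in>Pow I \<inter> G. 1)"
      using fin by (simp add: indicator_def sum.inter_restrict)
    moreover have "Pow I \<inter> G = G" unfolding G_def by auto
    ultimately show ?thesis by simp
  qed
  also have "2 ^ card I * (q / 4) + (\<Sum>S\<in>Pow I. (signed_sum I x S) ^ 4) / (8 * q) + 2 * q * real (card G)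
      \<le> 2 ^ card I * (q / 4) + (3 * 2 ^ card I * q\<^sup>2) / (8 * q) + 2 * q * real (card G)"
    using signed_sum_fourth_moment[OF assms, of x] q unfolding q_def[symmetric]
    by (intro add_mono divide_right_mono) auto
  also have "\<dots> = q * (2 ^ card I * (5 / 8) + 2 * real (card G))"
    using q by (simp add: power2_eq_square field_simps)
  finally have "q * 2 ^ card I \<le> q * (2 ^ card I * (5 / 8) + 2 * real (card G))"
    by (simp add: mult.commute)
  then have "2 ^ card I \<le> 2 ^ card I * (5 / 8) + 2 * real (card G)"
    using q by (metis mult_le_cancel_left_pos)
  then show ?thesis
    unfolding G_def q_def by simp
qed

text \<open>Chernoff's bound: Markov's inequality for \<open>exp (l * _)\<close> with the optimal \<open>l = s / v\<close>.\<close>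

lemma signed_sum_one_sided_tail:
  assumes "finite I" "(\<Sum>i\<in>I. (x i)\<^sup>2) \<le> v" "0 < v" "0 \<le> s"
  shows "real (card {S \<in> Pow I. s < signed_sum I x S}) \<le> exp (- s\<^sup>2 / (2 * v)) * 2 ^ card I"
proof -
  define l where "l = s / v"
  define G where "G = {S \<in> Pow I. s < signed_sum I x S}"
  have l: "l \<ge> 0" using assms unfolding l_def by simp
  have fin: "finite (Pow I)" "G \<subseteq> Pow I"
    using assms unfolding G_def by auto
  have "real (card G) * exp (l * s) = (\<Sum>S\<in>G. exp (l * s))"
    by simp
  also have "\<dots> \<le> (\<Sum>S\<in>G. exp (l * signed_sum I x S))"
    unfolding G_def using l by (intro sum_mono) (auto intro: mult_left_mono)
  also have "\<dots> \<le> (\<Sum>S\<in>Pow I. exp (l * signed_sum I x S))"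
    using fin by (intro sum_mono2) auto
  also have "\<dots> \<le> 2 ^ card I * exp (l\<^sup>2 * (\<Sum>i\<in>I. (x i)\<^sup>2) / 2)"
    by (rule signed_sum_exp_moment[OF assms(1)])
  also have "\<dots> \<le> 2 ^ card I * exp (l\<^sup>2 * v / 2)"
    using assms(2) by (auto intro!: mult_left_mono)
  finally have "real (card G) \<le> 2 ^ card I * exp (l\<^sup>2 * v / 2) / exp (l * s)"
    by (simp add: field_simps)
  also have "\<dots> = 2 ^ card I * exp (l\<^sup>2 * v / 2 - l * s)"
    by (simp add: exp_diff)
  also have "l\<^sup>2 * v / 2 - l * s = - s\<^sup>2 / (2 * v)"
    using assms(3) unfolding l_def by (simp add: power2_eq_square field_simps)
  finally show ?thesis
    unfolding G_def by (simp add: mult.commute)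
qed

lemma signed_sum_Hoeffding:
  assumes "finite I" "(\<Sum>i\<in>I. (x i)\<^sup>2) \<le> v" "0 < v" "0 \<le> s"
  shows "real (card {S \<in> Pow I. s < \<bar>signed_sum I x S\<bar>}) \<le> 2 * exp (- s\<^sup>2 / (2 * v)) * 2 ^ card I"
proof -
  have neg: "signed_sum I (\<lambda>i. - x i) S = - signed_sum I x S" for S
  proof -
    have "signed_sum I (\<lambda>i. - x i) S = (\<Sum>i\<in>I. - (if i \<in> S then x i else - x i))"
      unfolding signed_sum_def by (intro sum.cong) simp_all
    then show ?thesis
      unfolding signed_sum_def sum_negf .
  qed
  have abs: "s < \<bar>y\<bar> \<longleftrightarrow> s < y \<or> s < - y" for y :: real
    by arith
  have "{S \<in> Pow I. s < \<bar>signed_sum I x S\<bar>} =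
      {S \<in> Pow I. s < signed_sum I x S} \<union> {S \<in> Pow I. s < signed_sum I (\<lambda>i. - x i) S}"
    unfolding neg abs by blast
  then have "card {S \<in> Pow I. s < \<bar>signed_sum I x S\<bar>} \<le>
      card {S \<in> Pow I. s < signed_sum I x S} + card {S \<in> Pow I. s < signed_sum I (\<lambda>i. - x i) S}"
    by (simp only: card_Un_le)
  then have "real (card {S \<in> Pow I. s < \<bar>signed_sum I x S\<bar>}) \<le>
      real (card {S \<in> Pow I. s < signed_sum I x S}) + real (card {S \<in> Pow I. s < signed_sum I (\<lambda>i. - x i) S})"
    by linarith
  then show ?thesis
    using signed_sum_one_sided_tail[OF assms]
      signed_sum_one_sided_tail[of I "\<lambda>i. - x i" v s] assms by simp
qed

text \<open>The probability of \<open>S\<close> as a random subset of \<open>I\<close> that contains each \<open>i\<close> independently with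
probability \<open>a i\<close>.\<close>

definition selection_weight :: "'i set \<Rightarrow> ('i \<Rightarrow> real) \<Rightarrow> 'i set \<Rightarrow> real" where
  "selection_weight I a S = (\<Prod>i\<in>I. if i \<in> S then a i else 1 - a i)"

lemma selection_weight_insert:
  assumes "finite I" "i \<notin> I" "S \<in> Pow I"
  shows "selection_weight (insert i I) a S = (1 - a i) * selection_weight I a S"
    and "selection_weight (insert i I) a (insert i S) = a i * selection_weight I a S"
proof -
  have "i \<notin> S"
    using assms by auto
  then show "selection_weight (insert i I) a S = (1 - a i) * selection_weight I a S"
    using assms by (simp add: selection_weight_def)
  have "(\<Prod>j\<in>I. if j \<in> insert i S then a j else 1 - a j) = (\<Prod>j\<in>I. if j \<in> S then a j else 1 - a j)"
    using assms by (intro prod.cong) auto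
  then show "selection_weight (insert i I) a (insert i S) = a i * selection_weight I a S"
    using assms by (simp add: selection_weight_def)
qed

lemma selection_weight_nonneg:
  assumes "\<And>i. i \<in> I \<Longrightarrow> 0 \<le> a i \<and> a i \<le> 1"
  shows "0 \<le> selection_weight I a S"
  unfolding selection_weight_def using assms by (intro prod_nonneg) auto

lemma sum_selection_weight_insert:
  assumes "finite I" "i \<notin> I"
  shows "(\<Sum>S\<in>Pow (insert i I). selection_weight (insert i I) a S * g (\<Sum>j\<in>S. x j)) =
    (\<Sum>S\<in>Pow I. selection_weight I a S * ((1 - a i) * g (\<Sum>j\<in>S. x j) + a i * g ((\<Sum>j\<in>S. x j) + x i)))"
  unfolding sum_Pow_insert[OF assms]
proof (intro sum.cong refl)
  fix S assume S: "S \<in> Pow I"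
  then have "finite S" "i \<notin> S"
    using assms finite_subset by auto
  then show "selection_weight (insert i I) a S * g (\<Sum>j\<in>S. x j) +
      selection_weight (insert i I) a (insert i S) * g (\<Sum>j\<in>insert i S. x j) =
      selection_weight I a S * ((1 - a i) * g (\<Sum>j\<in>S. x j) + a i * g ((\<Sum>j\<in>S. x j) + x i))"
    by (simp add: selection_weight_insert[OF assms S] algebra_simps)
qed

lemma selection_weight_moments:
  assumes "finite I"
  shows "(\<Sum>S\<in>Pow I. selection_weight I a S) = 1"
    and "(\<Sum>S\<in>Pow I. selection_weight I a S * (\<Sum>j\<in>S. x j)) = (\<Sum>i\<in>I. a i * x i)"
    and "(\<Sum>S\<in>Pow I. selection_weight I a S * (\<Sum>j\<in>S. x j)\<^sup>2) =
      (\<Sum>i\<in>I. a i * x i)\<^sup>2 + (\<Sum>i\<in>I. a i * (1 - a i) * (x i)\<^sup>2)"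
proof -
  have "(\<Sum>S\<in>Pow I. selection_weight I a S) = 1 \<and>
    (\<Sum>S\<in>Pow I. selection_weight I a S * (\<Sum>j\<in>S. x j)) = (\<Sum>i\<in>I. a i * x i) \<and>
    (\<Sum>S\<in>Pow I. selection_weight I a S * (\<Sum>j\<in>S. x j)\<^sup>2) =
      (\<Sum>i\<in>I. a i * x i)\<^sup>2 + (\<Sum>i\<in>I. a i * (1 - a i) * (x i)\<^sup>2)"
    using assms
  proof (induction I rule: finite_induct)
    case empty
    then show ?case by (simp add: selection_weight_def)
  next
    case (insert i I)
    let ?W = "selection_weight I a" and ?m = "\<Sum>i\<in>I. a i * x i"
    note ins = sum_selection_weight_insert[OF insert(1,2), of a]
    have 0: "(\<Sum>S\<in>Pow (insert i I). selection_weight (insert i I) a S) = 1"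
      using ins[of "\<lambda>_. 1" x] insert.IH by simp
    have 1: "?W S * ((1 - a i) * y + a i * (y + x i)) = ?W S * y + (a i * x i) * ?W S" for S y
      by algebra
    have 2: "?W S * ((1 - a i) * y\<^sup>2 + a i * (y + x i)\<^sup>2) =
        ?W S * y\<^sup>2 + (2 * a i * x i) * (?W S * y) + (a i * (x i)\<^sup>2) * ?W S" for S y
      by algebra
    have "(\<Sum>S\<in>Pow (insert i I). selection_weight (insert i I) a S * (\<Sum>j\<in>S. x j)) = ?m + a i * x i"
      using insert.IH unfolding ins[of "\<lambda>y. y" x] 1 sum.distrib sum_distrib_left[symmetric] by simp
    moreover have "(\<Sum>S\<in>Pow (insert i I). selection_weight (insert i I) a S * (\<Sum>j\<in>S. x j)\<^sup>2) =
       (?m\<^sup>2 + (\<Sum>i\<in>I. a i * (1 - a i) * (x i)\<^sup>2)) + 2 * a i * x i * ?m + a i * (x i)\<^sup>2"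
      using insert.IH unfolding ins[of "\<lambda>y. y\<^sup>2" x] 2 sum.distrib sum_distrib_left[symmetric] by simp
    moreover have "\<dots> = (a i * x i + ?m)\<^sup>2 + (a i * (1 - a i) * (x i)\<^sup>2 + (\<Sum>i\<in>I. a i * (1 - a i) * (x i)\<^sup>2))"
      by (simp add: power2_eq_square algebra_simps)
    ultimately show ?case
      using 0 insert(1,2) by simp
  qed
  then show "(\<Sum>S\<in>Pow I. selection_weight I a S) = 1"
    and "(\<Sum>S\<in>Pow I. selection_weight I a S * (\<Sum>j\<in>S. x j)) = (\<Sum>i\<in>I. a i * x i)"
    and "(\<Sum>S\<in>Pow I. selection_weight I a S * (\<Sum>j\<in>S. x j)\<^sup>2) =
      (\<Sum>i\<in>I. a i * x i)\<^sup>2 + (\<Sum>i\<in>I. a i * (1 - a i) * (x i)\<^sup>2)"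
    by blast+
qed

text \<open>Multipliers in the unit interval can be rounded to 0 or 1: the sum of \<open>x\<close> over a random set with
inclusion probabilities \<open>a\<close> has mean \<open>\<Sum>i\<in>I. a i * x i\<close> and variance at most \<open>r\<^sup>2 / 4\<close>, so a large mean forces
most sums over subsets to be large.\<close>

lemma random_selection_Chebyshev:
  assumes fin: "finite I" and a: "\<And>i. i \<in> I \<Longrightarrow> 0 \<le> a i \<and> a i \<le> 1"
    and q: "(\<Sum>i\<in>I. (x i)\<^sup>2) \<le> r\<^sup>2" and r: "0 < r" and m: "R + r < \<bar>\<Sum>i\<in>I. a i * x i\<bar>"
  shows "3 / 4 \<le> (\<Sum>S\<in>{S\<in>Pow I. R < \<bar>\<Sum>i\<in>S. x i\<bar>}. selection_weight I a S)"
proof -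
  let ?W = "selection_weight I a"
  define m' where "m' = (\<Sum>i\<in>I. a i * x i)"
  let ?G = "{S\<in>Pow I. R < \<bar>\<Sum>i\<in>S. x i\<bar>}"
  note W = selection_weight_nonneg[of I a, OF a]
  note mom = selection_weight_moments[OF fin, of a]
  have "(\<Sum>S\<in>Pow I. ?W S * ((\<Sum>i\<in>S. x i) - m')\<^sup>2) =
      (\<Sum>S\<in>Pow I. ?W S * (\<Sum>i\<in>S. x i)\<^sup>2 - (2 * m') * (?W S * (\<Sum>i\<in>S. x i)) + m'\<^sup>2 * ?W S)"
    by (intro sum.cong refl) algebra
  also have "\<dots> = (\<Sum>i\<in>I. a i * (1 - a i) * (x i)\<^sup>2)"
    unfolding sum.distrib sum_subtractf sum_distrib_left[symmetric] mom
    by (simp add: m'_def power2_eq_square)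
  also have "\<dots> \<le> (\<Sum>i\<in>I. 1 / 4 * (x i)\<^sup>2)"
  proof (intro sum_mono mult_right_mono)
    fix i
    have "0 \<le> (a i - 1 / 2)\<^sup>2" by simp
    then show "a i * (1 - a i) \<le> 1 / 4"
      by (simp add: power2_eq_square algebra_simps)
  qed simp
  also have "\<dots> \<le> r\<^sup>2 / 4"
    using q by (simp only: sum_distrib_left[symmetric])
  finally have var: "(\<Sum>S\<in>Pow I. ?W S * ((\<Sum>i\<in>S. x i) - m')\<^sup>2) \<le> r\<^sup>2 / 4" .
  have "r\<^sup>2 * (\<Sum>S\<in>Pow I - ?G. ?W S) = (\<Sum>S\<in>Pow I - ?G. ?W S * r\<^sup>2)"
    by (simp add: sum_distrib_left mult.commute)
  also have "\<dots> \<le> (\<Sum>S\<in>Pow I - ?G. ?W S * ((\<Sum>i\<in>S. x i) - m')\<^sup>2)"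
  proof (intro sum_mono mult_left_mono W)
    fix S assume "S \<in> Pow I - ?G"
    then have "\<bar>\<Sum>i\<in>S. x i\<bar> \<le> R" by auto
    then have "r \<le> \<bar>(\<Sum>i\<in>S. x i) - m'\<bar>"
      using m unfolding m'_def by linarith
    then show "r\<^sup>2 \<le> ((\<Sum>i\<in>S. x i) - m')\<^sup>2"
      using r by (simp add: abs_le_square_iff[symmetric])
  qed
  also have "\<dots> \<le> (\<Sum>S\<in>Pow I. ?W S * ((\<Sum>i\<in>S. x i) - m')\<^sup>2)"
    using fin W by (intro sum_mono2) auto
  finally have "r\<^sup>2 * (\<Sum>S\<in>Pow I - ?G. ?W S) \<le> r\<^sup>2 * (1 / 4)"
    using var by simp
  then have "(\<Sum>S\<in>Pow I - ?G. ?W S) \<le> 1 / 4"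
    using r by (metis mult_le_cancel_left_pos zero_less_power)
  moreover have "(\<Sum>S\<in>Pow I. ?W S) = (\<Sum>S\<in>Pow I - ?G. ?W S) + (\<Sum>S\<in>?G. ?W S)"
    using fin by (intro sum.subset_diff) auto
  ultimately show ?thesis
    using mom(1) by linarith
qed

text \<open>Adding or removing the one large term \<open>b\<close> changes the sum by more than 2. So in each pair of
sets that differ only in \<open>b\<close>, one has a sum outside of \<open>[-1, 1]\<close>.\<close>

lemma half_of_subsums_large:
  fixes x :: "'b \<Rightarrow> real"
  assumes "finite \<rho>" "D \<subseteq> \<rho>" "b \<in> D" "2 < \<bar>x b\<bar>"
  shows "2 ^ card \<rho> \<le> 2 * card {S \<in> Pow \<rho>. 1 < \<bar>\<Sum>a\<in>S \<inter> D. x a\<bar>}"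
proof -
  define G where "G = {S \<in> Pow \<rho>. 1 < \<bar>\<Sum>a\<in>S \<inter> D. x a\<bar>}"
  define flip where "flip S = (if b \<in> S then S - {b} else insert b S)" for S
  have finG: "finite G"
    using assms(1) unfolding G_def by auto
  have "Pow \<rho> \<subseteq> G \<union> flip ` G"
  proof
    fix S assume S: "S \<in> Pow \<rho>"
    have finS: "finite (S \<inter> D)"
      using S assms(1) by (auto intro: finite_subset)
    have ff: "flip (flip S) = S" "flip S \<in> Pow \<rho>"
      using S assms unfolding flip_def by auto
    have "\<bar>(\<Sum>a\<in>flip S \<inter> D. x a) - (\<Sum>a\<in>S \<inter> D. x a)\<bar> = \<bar>x b\<bar>"
    proof (cases "b \<in> S")
      case True
      then have "flip S \<inter> D = S \<inter> D - {b}" unfolding flip_def by auto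
      then show ?thesis using True assms finS by (simp add: sum_diff1)
    next
      case False
      then have "flip S \<inter> D = insert b (S \<inter> D)" using assms unfolding flip_def by auto
      then show ?thesis using False finS by simp
    qed
    then have "1 < \<bar>\<Sum>a\<in>S \<inter> D. x a\<bar> \<or> 1 < \<bar>\<Sum>a\<in>flip S \<inter> D. x a\<bar>"
      using assms(4) by linarith
    then have "S \<in> G \<or> flip S \<in> G"
      using S ff(2) unfolding G_def by blast
    then show "S \<in> G \<union> flip ` G"
    proof
      assume "flip S \<in> G"
      then have "flip (flip S) \<in> flip ` G" by (rule imageI)
      then show ?thesis unfolding ff(1) by simp
    qed simp
  qed
  then have "card (Pow \<rho>) \<le> card (G \<union> flip ` G)"
    using finG by (intro card_mono) auto
  also have "\<dots> \<le> card G + card (flip ` G)"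
    by (rule card_Un_le)
  also have "\<dots> \<le> 2 * card G"
    using card_image_le[OF finG, of flip] by simp
  finally show ?thesis
    unfolding G_def using assms(1) by (simp add: card_Pow)
qed

text \<open>A given colour is missed by a fraction \<open>(1 - 1 / M) ^ card H\<close> of the colourings, which is at most a half
by Bernoulli's inequality.\<close>

lemma colourings_hitting_colour:
  assumes fin: "finite \<rho>" and H: "H \<subseteq> \<rho>" and M: "0 < M" and c: "c < M" and L: "M \<le> card H"
  shows "card (\<rho> \<rightarrow>\<^sub>E {..<M}) \<le> 2 * card {\<phi> \<in> \<rho> \<rightarrow>\<^sub>E {..<M}. c \<in> \<phi> ` H}"
proof -
  let ?All = "\<rho> \<rightarrow>\<^sub>E {..<M}"
  let ?miss = "{\<phi> \<in> ?All. c \<notin> \<phi> ` H}"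
  have finAll: "finite ?All" using fin by (simp add: finite_PiE)
  have "?miss = (\<Pi>\<^sub>E b\<in>\<rho>. if b \<in> H then {..<M} - {c} else {..<M})"
  proof (intro set_eqI iffI)
    fix \<phi> assume "\<phi> \<in> ?miss"
    then have \<phi>: "\<phi> \<in> ?All" and c: "c \<notin> \<phi> ` H" by auto
    show "\<phi> \<in> (\<Pi>\<^sub>E b\<in>\<rho>. if b \<in> H then {..<M} - {c} else {..<M})"
      by (rule PiE_I) (use \<phi> c in \<open>auto dest: PiE_mem PiE_arb\<close>)
  next
    fix \<phi> assume \<phi>: "\<phi> \<in> (\<Pi>\<^sub>E b\<in>\<rho>. if b \<in> H then {..<M} - {c} else {..<M})"
    have mem: "\<phi> b \<in> (if b \<in> H then {..<M} - {c} else {..<M})" if "b \<in> \<rho>" for b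
      using PiE_mem[OF \<phi> that] .
    have "\<phi> \<in> ?All"
    proof (rule PiE_I)
      show "\<phi> b \<in> {..<M}" if "b \<in> \<rho>" for b
        using mem[OF that] by (auto split: if_splits)
      show "\<phi> b = undefined" if "b \<notin> \<rho>" for b
        using PiE_arb[OF \<phi> that] .
    qed
    moreover have "\<phi> b \<noteq> c" if "b \<in> H" for b
      using mem[of b] that H by auto
    ultimately show "\<phi> \<in> ?miss" by auto
  qed
  then have "card ?miss = (\<Prod>b\<in>\<rho>. card (if b \<in> H then {..<M} - {c} else {..<M}))"
    using fin by (simp add: card_PiE)
  also have "\<dots> = (\<Prod>b\<in>\<rho>. if b \<in> H then M - 1 else M)"
    using c by (intro prod.cong) auto
  also have "\<dots> = (M - 1) ^ card H * M ^ card (\<rho> - H)"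
  proof -
    have "\<rho> \<inter> {b. b \<in> H} = H" "\<rho> \<inter> - {b. b \<in> H} = \<rho> - H"
      using H by auto
    then show ?thesis
      using fin by (simp only: prod.If_cases prod_constant)
  qed
  finally have miss: "card ?miss = (M - 1) ^ card H * M ^ card (\<rho> - H)" .
  have tot: "card ?All = M ^ card H * M ^ card (\<rho> - H)"
  proof -
    have "card \<rho> = card H + card (\<rho> - H)"
      using fin H by (metis card_Diff_subset card_mono finite_subset le_add_diff_inverse)
    then show ?thesis
      using fin by (simp add: card_PiE power_add)
  qed
  have "2 * (M - 1) ^ n \<le> M ^ n" if n: "M \<le> n" for n
  proof (cases "M = 1")
    case True
    then show ?thesis using that by (simp add: zero_power)
  next
    case False
    define u where "u = real (M - 1)"
    from False obtain k where k: "M = Suc (Suc k)"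
      using M by (metis One_nat_def gr0_implies_Suc not0_implies_Suc)
    have u: "u > 0" "u \<le> real n"
      using n unfolding u_def k by simp_all
    have "0 \<le> 1 / u"
      using u by simp
    then have "- 1 \<le> 1 / u"
      by (rule order_trans[rotated]) simp
    then have "1 + real n * (1 / u) \<le> (1 + 1 / u) ^ n"
      by (rule Bernoulli_inequality)
    moreover have "1 \<le> real n * (1 / u)"
      using u by simp
    ultimately have "2 \<le> (1 + 1 / u) ^ n"
      by linarith
    then have "2 * u ^ n \<le> ((1 + 1 / u) * u) ^ n"
      unfolding power_mult_distrib using u by (intro mult_right_mono) auto
    also have "(1 + 1 / u) * u = u + 1"
      using u by (simp add: field_simps)
    also have "u + 1 = real M"
      unfolding u_def k by simp
    finally have "2 * real (M - 1) ^ n \<le> real M ^ n"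
      unfolding u_def .
    then have "real (2 * (M - 1) ^ n) \<le> real (M ^ n)"
      by (simp only: of_nat_mult of_nat_power of_nat_numeral)
    then show ?thesis
      by (simp only: of_nat_le_iff)
  qed
  from this[OF L] have "2 * card ?miss \<le> card ?All"
    unfolding miss tot by (simp add: mult.assoc[symmetric])
  moreover have "card ?All = card ?miss + card {\<phi> \<in> ?All. c \<in> \<phi> ` H}"
  proof -
    have "?All = ?miss \<union> {\<phi> \<in> ?All. c \<in> \<phi> ` H}" by blast
    moreover have "card (?miss \<union> {\<phi> \<in> ?All. c \<in> \<phi> ` H}) = card ?miss + card {\<phi> \<in> ?All. c \<in> \<phi> ` H}"
      using finAll by (intro card_Un_disjoint) auto
    ultimately show ?thesis by simp
  qed
  ultimately show ?thesis by linarith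
qed

section \<open>Exhaustive measures with values in random variables\<close>

text \<open>What is kept of a stochastic measure: finite additivity, and that the values on disjoint sets tend
to zero in probability. Both are invariant under changes of the values on null sets.\<close>

locale L0_measure = prob_space M
  for M :: "'w measure" and N :: "'x measure" and \<mu> :: "'x set \<Rightarrow> 'w \<Rightarrow> real" +
  assumes measurable_value: "A \<in> sets N \<Longrightarrow> \<mu> A \<in> borel_measurable M"
    and additive: "A \<in> sets N \<Longrightarrow> B \<in> sets N \<Longrightarrow> A \<inter> B = {} \<Longrightarrow>
      AE w in M. \<mu> (A \<union> B) w = \<mu> A w + \<mu> B w"
    and exhaustive: "\<And>B :: nat \<Rightarrow> 'x set. range B \<subseteq> sets N \<Longrightarrow> disjoint_family B \<Longrightarrow> 0 < e \<Longrightarrow>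
      (\<lambda>n. prob {w \<in> space M. e < \<bar>\<mu> (B n) w\<bar>}) \<longlonglongrightarrow> 0"
begin

lemma prob_mono_AE:
  assumes "{w \<in> space M. P w} \<in> events" "{w \<in> space M. Q w} \<in> events" "AE w in M. P w \<longrightarrow> Q w"
  shows "prob {w \<in> space M. P w} \<le> prob {w \<in> space M. Q w}"
  using assms by (intro finite_measure_mono_AE) auto

lemma value_empty: "AE w in M. \<mu> {} w = 0"
  using additive[of "{}" "{}"] by simp

lemma value_Diff:
  assumes "A \<in> sets N" "B \<in> sets N" "A \<subseteq> B"
  shows "AE w in M. \<mu> (B - A) w = \<mu> B w - \<mu> A w"
proof -
  have "A \<union> (B - A) = B" using assms by auto
  then show ?thesis
    using additive[of A "B - A"] assms by auto
qed

lemma value_finite_Union: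
  assumes "finite I" "\<And>i. i \<in> I \<Longrightarrow> A i \<in> sets N" "disjoint_family_on A I"
  shows "AE w in M. \<mu> (\<Union>i\<in>I. A i) w = (\<Sum>i\<in>I. \<mu> (A i) w)"
  using assms
proof (induction I rule: finite_induct)
  case empty
  then show ?case using value_empty by simp
next
  case (insert i I)
  have "A i \<inter> (\<Union>j\<in>I. A j) = {}"
  proof -
    have "A i \<inter> A j = {}" if "j \<in> I" for j
      using that insert(2) by (intro disjoint_family_onD[OF insert.prems(2)]) auto
    then show ?thesis by blast
  qed
  then have "AE w in M. \<mu> (A i \<union> (\<Union>j\<in>I. A j)) w = \<mu> (A i) w + \<mu> (\<Union>j\<in>I. A j) w"
    using insert(1) insert.prems(1) by (intro additive) auto
  moreover have "AE w in M. \<mu> (\<Union>j\<in>I. A j) w = (\<Sum>j\<in>I. \<mu> (A j) w)"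
  proof (rule insert.IH)
    show "disjoint_family_on A I"
      using insert.prems(2) by (rule disjoint_family_on_mono[rotated]) auto
  qed (use insert.prems(1) in auto)
  ultimately show ?case
    by eventually_elim (use insert(1,2) in simp)
qed

lemma value_Union_disjoint:
  assumes "finite P" "P \<subseteq> sets N" "disjoint P"
  shows "AE w in M. \<mu> (\<Union>P) w = (\<Sum>b\<in>P. \<mu> b w)"
  using value_finite_Union[of P "\<lambda>b. b"] assms by (auto simp: disjoint_family_on_def disjoint_def)

lemma tight:
  fixes X :: "'w \<Rightarrow> real"
  assumes X: "X \<in> borel_measurable M" and e: "0 < e"
  shows "\<exists>R>0. prob {w \<in> space M. R < \<bar>X w\<bar>} < e"
proof -
  let ?A = "\<lambda>n::nat. {w \<in> space M. real n < \<bar>X w\<bar>}"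
  have "(\<lambda>n. prob (?A n)) \<longlonglongrightarrow> prob (\<Inter>n. ?A n)"
    using X by (intro finite_Lim_measure_decseq) (auto simp: decseq_def)
  moreover have "(\<Inter>n. ?A n) = {}"
  proof (rule ccontr)
    assume "(\<Inter>n. ?A n) \<noteq> {}"
    then obtain w where "\<And>n. real n < \<bar>X w\<bar>" by auto
    then show False using reals_Archimedean2 less_asym by metis
  qed
  ultimately have "(\<lambda>n. prob (?A n)) \<longlonglongrightarrow> 0" by simp
  then have "eventually (\<lambda>n. prob (?A n) < e \<and> 0 < n) sequentially"
    using e by (intro eventually_conj order_tendstoD eventually_gt_at_top)
  then obtain n where "prob (?A n) < e" "0 < n"
    by (auto simp: eventually_sequentially)
  then show ?thesis by (intro exI[of _ "real n"]) auto
qed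

text \<open>The members of \<open>P\<close> with a large value at the outcome \<open>w\<close>.\<close>

definition large :: "real \<Rightarrow> 'x set set \<Rightarrow> 'w \<Rightarrow> 'x set set" where
  "large t P w = {b \<in> P. t < \<bar>\<mu> b w\<bar>}"

lemma finite_large: "finite P \<Longrightarrow> finite (large t P w)"
  unfolding large_def by simp

lemma card_large_eq_sum:
  assumes "finite P"
  shows "real (card (large t P w)) = (\<Sum>b\<in>P. indicator {t<..} \<bar>\<mu> b w\<bar>)"
  using assms by (simp add: large_def indicator_def sum.If_cases Int_def)

lemma measurable_card_large [measurable]:
  assumes "finite P" "P \<subseteq> sets N"
  shows "(\<lambda>w. real (card (large t P w))) \<in> borel_measurable M"
  unfolding card_large_eq_sum[OF assms(1)]
proof (intro borel_measurable_sum)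
  fix b assume "b \<in> P"
  then have [measurable]: "\<mu> b \<in> borel_measurable M"
    using assms(2) measurable_value by auto
  show "(\<lambda>w. indicat_real {t<..} \<bar>\<mu> b w\<bar>) \<in> borel_measurable M"
    by measurable
qed

lemma events_card_large:
  assumes "finite P" "P \<subseteq> sets N"
  shows "{w \<in> space M. L \<le> card (large t P w)} \<in> events"
proof -
  have "{w \<in> space M. L \<le> card (large t P w)} = {w \<in> space M. real L \<le> real (card (large t P w))}"
    by simp
  also have "\<dots> \<in> events"
    by (intro borel_measurable_le measurable_card_large assms borel_measurable_const)
  finally show ?thesis .
qed

lemma events_value_gt:
  assumes "A \<in> sets N"
  shows "{w \<in> space M. R < \<bar>\<mu> A w\<bar>} \<in> events"
  using measurable_value[OF assms] by measurable

text \<open>Which members of the family are large may depend on the outcome; the family itself may not.\<close>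

definition has_large_family :: "'x set \<Rightarrow> real \<Rightarrow> nat \<Rightarrow> real \<Rightarrow> bool" where
  "has_large_family E \<theta> L t \<longleftrightarrow> (\<exists>P. finite P \<and> P \<subseteq> sets N \<and> disjoint P \<and> \<Union>P \<subseteq> E \<and>
     \<theta> \<le> prob {w \<in> space M. L \<le> card (large t P w)})"

text \<open>The property that drives the proof of boundedness: at a fixed level \<open>\<theta>\<close> of probability, the number and the
size of large values on disjoint subsets of \<open>E\<close> can both be made as big as desired.\<close>

definition many_large :: "'x set \<Rightarrow> real \<Rightarrow> bool" where
  "many_large E \<theta> \<longleftrightarrow> (\<forall>L t. has_large_family E \<theta> L t)"

definition split_by :: "'x set \<Rightarrow> 'x set set \<Rightarrow> 'x set set" where
  "split_by A P = ((\<lambda>a. a \<inter> A) ` P \<union> (\<lambda>a. a - A) ` P) - {{}}"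

text \<open>The cells of the coarse partition \<open>P\<close> that contain a large cell of the fine partition \<open>Q\<close>.\<close>

definition meets_large :: "real \<Rightarrow> 'x set set \<Rightarrow> 'x set set \<Rightarrow> 'w \<Rightarrow> 'x set set" where
  "meets_large t P Q w = {a \<in> P. \<exists>b\<in>large t Q w. b \<subseteq> a}"

definition fin_partition :: "'x set set \<Rightarrow> bool" where
  "fin_partition P \<longleftrightarrow> finite P \<and> P \<subseteq> sets N \<and> partition_on (space N) P"

lemma fin_partition_split_by:
  assumes P: "fin_partition P" and A: "A \<in> sets N"
  shows "fin_partition (split_by A P)" "refines (space N) (split_by A P) P"
    "card (split_by A P) \<le> 2 * card P"
proof -
  note P = P[unfolded fin_partition_def]
  have disj: "a = a'" if "a \<in> P" "a' \<in> P" "a \<inter> a' \<noteq> {}" for a a'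
    using P that unfolding partition_on_def disjoint_def by metis
  have U: "\<Union>P = space N" using P unfolding partition_on_def by simp
  have part: "partition_on (space N) (split_by A P)"
  proof (rule partition_onI)
    show "\<Union>(split_by A P) = space N"
      unfolding split_by_def U[symmetric] by auto
    show "disjnt p q" if "p \<in> split_by A P" "q \<in> split_by A P" "p \<noteq> q" for p q
    proof (rule ccontr)
      assume "\<not> disjnt p q"
      then obtain x where x: "x \<in> p" "x \<in> q" unfolding disjnt_def by auto
      from that obtain a a' where a: "a \<in> P" "a' \<in> P" "p = a \<inter> A \<or> p = a - A" "q = a' \<inter> A \<or> q = a' - A"
        unfolding split_by_def by blast
      have "x \<in> a \<inter> a'" using a(3,4) x by blast
      then have "a = a'" using disj[OF a(1,2)] by blast
      then show False using a(3,4) x that(3) by blast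
    qed
  qed (auto simp: split_by_def)
  then show "fin_partition (split_by A P)"
  proof -
    have "finite (split_by A P)" "split_by A P \<subseteq> sets N"
      using P A unfolding split_by_def by (simp_all add: image_subset_iff subset_iff, blast)
    then show ?thesis using part unfolding fin_partition_def by blast
  qed
  show "refines (space N) (split_by A P) P"
    unfolding refines_def using part P by (auto simp: split_by_def)
  have "card (split_by A P) \<le> card ((\<lambda>a. a \<inter> A) ` P \<union> (\<lambda>a. a - A) ` P)"
    unfolding split_by_def using P by (intro card_mono) auto
  also have "\<dots> \<le> card ((\<lambda>a. a \<inter> A) ` P) + card ((\<lambda>a. a - A) ` P)"
    by (rule card_Un_le)
  also have "\<dots> \<le> card P + card P"
    using P by (intro add_mono card_image_le) auto
  finally show "card (split_by A P) \<le> 2 * card P" by simp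
qed

lemma value_refinement:
  assumes Q: "fin_partition Q" and s: "s \<in> sets N"
    and sat: "\<And>b. b \<in> Q \<Longrightarrow> b \<subseteq> s \<or> b \<inter> s = {}"
  shows "AE w in M. \<mu> s w = (\<Sum>b\<in>{b\<in>Q. b \<subseteq> s}. \<mu> b w)"
proof -
  note Q = Q[unfolded fin_partition_def partition_on_def]
  have "s \<subseteq> space N" using s by (rule sets.sets_into_space)
  then have "s = \<Union>{b\<in>Q. b \<subseteq> s}"
    using Q sat by blast
  moreover have "AE w in M. \<mu> (\<Union>{b\<in>Q. b \<subseteq> s}) w = (\<Sum>b\<in>{b\<in>Q. b \<subseteq> s}. \<mu> b w)"
    using Q by (intro value_Union_disjoint) (auto simp: disjoint_def)
  ultimately show ?thesis by simp
qed

section \<open>An unbounded range yields many large values on disjoint sets\<close>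

text \<open>Each cell of \<open>P\<close> that contains a large cell of \<open>Q\<close> passes this property on to one of its two
halves. If no cell passes it on to both, then in each cell one of the halves is free of large cells.\<close>

lemma card_meets_large_split_by:
  assumes P: "fin_partition P" and A: "A \<in> sets N" and Q: "fin_partition Q"
    and ref: "refines (space N) Q (split_by A P)"
  shows "card (meets_large t P Q w) \<le> card (meets_large t (split_by A P) Q w)"
    and "card (meets_large t P Q w) = card (meets_large t (split_by A P) Q w) \<Longrightarrow> a \<in> P \<Longrightarrow>
      a \<inter> A \<in> meets_large t (split_by A P) Q w \<Longrightarrow> a - A \<notin> meets_large t (split_by A P) Q w"
proof -
  let ?M0 = "meets_large t P Q w" and ?M1 = "meets_large t (split_by A P) Q w"
  define g where "g a = (if a \<inter> A \<in> ?M1 then a \<inter> A else a - A)" for a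
  have disj: "a = a'" if "a \<in> P" "a' \<in> P" "x \<in> a" "x \<in> a'" for a a' x
    using P that unfolding fin_partition_def partition_on_def disjoint_def by blast
  have fin1: "finite ?M1"
    using fin_partition_split_by(1)[OF P A] unfolding fin_partition_def meets_large_def by simp
  have ne: "s \<noteq> {}" if "s \<in> ?M1" for s
    using that unfolding meets_large_def split_by_def by blast
  have g_mem: "g a \<in> ?M1" if a: "a \<in> ?M0" for a
  proof -
    from a obtain b where b: "a \<in> P" "b \<in> large t Q w" "b \<subseteq> a"
      unfolding meets_large_def by blast
    then have "b \<in> Q" unfolding large_def by simp
    then obtain s where s: "s \<in> split_by A P" "b \<subseteq> s" and "b \<noteq> {}"
      using ref Q unfolding refines_def fin_partition_def partition_on_def by metis
    then obtain x where x: "x \<in> b" by blast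
    from s obtain a' where a': "a' \<in> P" "s = a' \<inter> A \<or> s = a' - A"
      unfolding split_by_def by blast
    have "a' = a" using disj[OF a'(1) b(1), of x] x a'(2) s(2) b(3) by blast
    moreover have "s \<in> ?M1" using s b(2) unfolding meets_large_def by blast
    ultimately show ?thesis
      using a'(2) unfolding g_def by auto
  qed
  have g_sub: "g a \<subseteq> a" for a unfolding g_def by auto
  have inj: "inj_on g ?M0"
  proof (rule inj_onI)
    fix a a' assume a: "a \<in> ?M0" "a' \<in> ?M0" "g a = g a'"
    obtain x where "x \<in> g a" using ne[OF g_mem[OF a(1)]] by blast
    then have "x \<in> a" "x \<in> a'" using g_sub a(3) by blast+
    then show "a = a'" using disj[of a a' x] a unfolding meets_large_def by blast
  qed
  have sub: "g ` ?M0 \<subseteq> ?M1" using g_mem by blast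
  show "card ?M0 \<le> card ?M1"
    using card_inj_on_le[OF inj sub fin1] .
  show "a - A \<notin> ?M1" if eq: "card ?M0 = card ?M1" and a: "a \<in> P" "a \<inter> A \<in> ?M1"
  proof
    assume a2: "a - A \<in> ?M1"
    have "g ` ?M0 = ?M1"
      using sub fin1 eq card_image[OF inj] by (intro card_subset_eq) auto
    then obtain a' where a': "a' \<in> ?M0" "a - A = g a'" using a2 by blast
    obtain x where x: "x \<in> a - A" using ne[OF a2] by blast
    then have "x \<in> a" "x \<in> a'" using g_sub[of a'] a'(2) by blast+
    then have "a' = a" using disj[of a' a x] a a' unfolding meets_large_def by blast
    then have "a - A = a \<inter> A" using a' a(2) unfolding g_def by simp
    then show False using x by blast
  qed
qed

text \<open>If the number of cells containing large ones did not grow, then in each cell of \<open>P\<close> one half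
would be a union of small cells of \<open>Q\<close>, and the value of the other half would be close to that of the whole
cell. The value of \<open>A\<close> would then be bounded in terms of the values of the cells of \<open>P\<close>, although it exceeds
them by far.\<close>

lemma meets_large_split_by_grows:
  assumes P: "fin_partition P" and A: "A \<in> sets N" and Q: "fin_partition Q"
    and ref: "refines (space N) Q (split_by A P)"
    and empty: "\<mu> {} w = 0"
    and split: "\<And>a. a \<in> P \<Longrightarrow> \<mu> a w = \<mu> (a \<inter> A) w + \<mu> (a - A) w"
    and sumQ: "\<And>s. s \<in> split_by A P \<Longrightarrow> \<mu> s w = (\<Sum>b\<in>{b\<in>Q. b \<subseteq> s}. \<mu> b w)"
    and sumA: "\<mu> A w = (\<Sum>a\<in>P. \<mu> (a \<inter> A) w)"
    and big: "R < \<bar>\<mu> A w\<bar>" and smallP: "(\<Sum>a\<in>P. \<bar>\<mu> a w\<bar>) \<le> R / 4"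
    and smallQ: "real (card Q) * t \<le> R / 4" and t: "0 \<le> t"
  shows "card (meets_large t P Q w) < card (meets_large t (split_by A P) Q w)"
proof (rule ccontr)
  let ?M0 = "meets_large t P Q w" and ?M1 = "meets_large t (split_by A P) Q w"
  assume "\<not> ?thesis"
  then have eq: "card ?M0 = card ?M1"
    using card_meets_large_split_by(1)[OF P A Q ref, of t w] by simp
  note both = card_meets_large_split_by(2)[OF P A Q ref eq]
  have finP: "finite P" and finQ: "finite Q"
    using P Q unfolding fin_partition_def by auto
  have few: "\<bar>\<mu> s w\<bar> \<le> t * real (card {b\<in>Q. b \<subseteq> a})"
    if s: "s \<in> split_by A P \<or> s = {}" "s \<notin> ?M1" "s \<subseteq> a" for s a
  proof (cases "s = {}")
    case True
    then show ?thesis using empty t by simp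
  next
    case False
    then have s1: "s \<in> split_by A P" using s by blast
    have "\<bar>\<mu> s w\<bar> \<le> (\<Sum>b\<in>{b\<in>Q. b \<subseteq> s}. \<bar>\<mu> b w\<bar>)"
      unfolding sumQ[OF s1] by (rule sum_abs)
    also have "\<dots> \<le> (\<Sum>b\<in>{b\<in>Q. b \<subseteq> s}. t)"
    proof (rule sum_mono)
      fix b assume b: "b \<in> {b\<in>Q. b \<subseteq> s}"
      then have "b \<notin> large t Q w" using s(2) s1 unfolding meets_large_def by blast
      then show "\<bar>\<mu> b w\<bar> \<le> t" using b unfolding large_def by simp
    qed
    also have "\<dots> \<le> (\<Sum>b\<in>{b\<in>Q. b \<subseteq> a}. t)"
      using finQ t s(3) by (intro sum_mono2) auto
    finally show ?thesis by (simp add: mult.commute)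
  qed
  have child: "\<bar>\<mu> (a \<inter> A) w\<bar> \<le> \<bar>\<mu> a w\<bar> + t * real (card {b\<in>Q. b \<subseteq> a})" if a: "a \<in> P" for a
  proof (cases "a \<inter> A \<in> ?M1")
    case True
    have "a - A \<in> split_by A P \<or> a - A = {}" using a unfolding split_by_def by blast
    then have "\<bar>\<mu> (a - A) w\<bar> \<le> t * real (card {b\<in>Q. b \<subseteq> a})"
      using both[OF a True] by (intro few) auto
    then show ?thesis using split[OF a] by linarith
  next
    case False
    have "a \<inter> A \<in> split_by A P \<or> a \<inter> A = {}" using a unfolding split_by_def by blast
    then have "\<bar>\<mu> (a \<inter> A) w\<bar> \<le> t * real (card {b\<in>Q. b \<subseteq> a})"
      using False by (intro few) auto
    then show ?thesis by linarith
  qed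
  have "(\<Sum>a\<in>P. card {b\<in>Q. b \<subseteq> a}) = card (\<Union>a\<in>P. {b\<in>Q. b \<subseteq> a})"
  proof (rule card_UN_disjoint[symmetric])
    show "\<forall>a\<in>P. \<forall>a'\<in>P. a \<noteq> a' \<longrightarrow> {b\<in>Q. b \<subseteq> a} \<inter> {b\<in>Q. b \<subseteq> a'} = {}"
    proof (intro ballI impI)
      fix a a' assume a: "a \<in> P" "a' \<in> P" "a \<noteq> a'"
      then have "a \<inter> a' = {}"
        using P unfolding fin_partition_def partition_on_def disjoint_def by blast
      moreover have "{} \<notin> Q"
        using Q unfolding fin_partition_def partition_on_def by blast
      ultimately show "{b\<in>Q. b \<subseteq> a} \<inter> {b\<in>Q. b \<subseteq> a'} = {}"
      proof -
        assume aa: "a \<inter> a' = {}" and Q0: "{} \<notin> Q"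
        have "b = {}" if "b \<subseteq> a" "b \<subseteq> a'" for b using aa that by blast
        then show ?thesis using Q0 by blast
      qed
    qed
  qed (use finP finQ in auto)
  also have "\<dots> \<le> card Q"
    using finQ by (intro card_mono) auto
  finally have "(\<Sum>a\<in>P. real (card {b\<in>Q. b \<subseteq> a})) \<le> real (card Q)"
    by (simp only: of_nat_sum[symmetric] of_nat_le_iff)
  then have "t * (\<Sum>a\<in>P. real (card {b\<in>Q. b \<subseteq> a})) \<le> t * real (card Q)"
    using t by (rule mult_left_mono)
  then have cnt: "t * (\<Sum>a\<in>P. real (card {b\<in>Q. b \<subseteq> a})) \<le> R / 4"
    using smallQ by (simp only: mult.commute[of t "real (card Q)"])
  have "\<bar>\<mu> A w\<bar> \<le> (\<Sum>a\<in>P. \<bar>\<mu> (a \<inter> A) w\<bar>)"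
    unfolding sumA by (rule sum_abs)
  also have "\<dots> \<le> (\<Sum>a\<in>P. \<bar>\<mu> a w\<bar> + t * real (card {b\<in>Q. b \<subseteq> a}))"
    by (intro sum_mono child)
  also have "\<dots> = (\<Sum>a\<in>P. \<bar>\<mu> a w\<bar>) + t * (\<Sum>a\<in>P. real (card {b\<in>Q. b \<subseteq> a}))"
    by (simp add: sum.distrib sum_distrib_left)
  also have "\<dots> \<le> R / 2"
    using smallP cnt by linarith
  finally have "\<bar>\<mu> A w\<bar> \<le> R / 2" .
  moreover have "0 \<le> (\<Sum>a\<in>P. \<bar>\<mu> a w\<bar>)" by (rule sum_nonneg) simp
  ultimately show False using big smallP by linarith
qed

text \<open>Iterates the preceding step: \<open>Z\<close> counts the stages at which the new set had a value that dwarfs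
the earlier cells, and each such stage contributes one more large cell. The size of the final
partition is controlled beforehand, so that the threshold of each stage can dominate the total
contribution of the small cells.\<close>

lemma refinement_with_large_atoms:
  assumes \<eta>: "0 < \<eta>" and unb: "\<And>R. \<exists>A\<in>sets N. \<eta> < prob {w \<in> space M. R < \<bar>\<mu> A w\<bar>}"
    and t: "0 \<le> t" and P: "fin_partition P"
  shows "\<exists>Q Z. fin_partition Q \<and> refines (space N) Q P \<and> card Q \<le> 2 ^ K * card P \<and>
    Z \<in> borel_measurable M \<and> (\<forall>w. 0 \<le> Z w \<and> Z w \<le> real K) \<and> real K * \<eta> / 2 \<le> expectation Z \<and>
    (AE w in M. Z w + real (card (meets_large t P Q w)) \<le> real (card (large t Q w)))"
  using P
proof (induction K arbitrary: P)
  case 0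
  have "card (meets_large t P P w) \<le> card (large t P w)" for w
  proof (rule card_mono)
    show "finite (large t P w)"
      using "0" unfolding fin_partition_def by (simp add: finite_large)
    show "meets_large t P P w \<subseteq> large t P w"
    proof
      fix a assume "a \<in> meets_large t P P w"
      then obtain b where b: "a \<in> P" "b \<in> P" "b \<in> large t P w" "b \<subseteq> a"
        unfolding meets_large_def large_def by blast
      have "b \<noteq> {}" "a = b \<or> a \<inter> b = {}"
        using 0 b unfolding fin_partition_def partition_on_def disjoint_def by blast+
      then have "a = b" using b by blast
      then show "a \<in> large t P w" using b by simp
    qed
  qed
  moreover have "refines (space N) P P"
    using 0 unfolding fin_partition_def by (intro refines_refl) auto
  ultimately show ?case
    using 0 by (intro exI[of _ P] exI[of _ "\<lambda>_. 0"]) simp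
next
  case (Suc K)
  note P = Suc.prems
  have finP: "finite P" and Psets: "P \<subseteq> sets N"
    using P unfolding fin_partition_def by auto
  have meas: "\<mu> a \<in> borel_measurable M" if "a \<in> P" for a
    using that Psets by (intro measurable_value) blast
  define T where "T w = (\<Sum>a\<in>P. \<bar>\<mu> a w\<bar>)" for w
  have T [measurable]: "T \<in> borel_measurable M"
    unfolding T_def by (intro borel_measurable_sum borel_measurable_abs meas)
  obtain R1 where R1: "prob {w \<in> space M. R1 < \<bar>T w\<bar>} < \<eta> / 2"
    using tight[OF T, of "\<eta> / 2"] \<eta> by auto
  \<comment> \<open>\<open>R\<close> exceeds both the values of the present cells, up to an event of probability \<open>\<eta> / 2\<close>, and the
    total contribution of small cells of any refinement obtained in \<open>K\<close> further steps.\<close>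
  define R where "R = max (4 * R1) (4 * (2 ^ Suc K * real (card P) * t))"
  obtain A where A: "A \<in> sets N" and bigA: "\<eta> < prob {w \<in> space M. R < \<bar>\<mu> A w\<bar>}"
    using unb[of R] by blast
  note [measurable] = measurable_value[OF A]
  define P1 where "P1 = split_by A P"
  have P1: "fin_partition P1" "refines (space N) P1 P" "card P1 \<le> 2 * card P"
    unfolding P1_def using fin_partition_split_by[OF P A] by auto
  from Suc.IH[OF P1(1)] obtain Q Z where Q: "fin_partition Q" "refines (space N) Q P1"
      "card Q \<le> 2 ^ K * card P1"
    and Z [measurable]: "Z \<in> borel_measurable M" and Zb: "\<And>w. 0 \<le> Z w \<and> Z w \<le> real K"
    and EZ: "real K * \<eta> / 2 \<le> expectation Z"
    and AEZ: "AE w in M. Z w + real (card (meets_large t P1 Q w)) \<le> real (card (large t Q w))"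
    by blast
  define Ev where "Ev = {w \<in> space M. R < \<bar>\<mu> A w\<bar> \<and> T w \<le> R1}"
  have Ev [measurable]: "Ev \<in> events" unfolding Ev_def by measurable
  define Z' where "Z' w = Z w + indicator Ev w" for w
  have "prob {w \<in> space M. R < \<bar>\<mu> A w\<bar>} \<le> prob (Ev \<union> {w \<in> space M. R1 < \<bar>T w\<bar>})"
    by (intro finite_measure_mono) (auto simp: Ev_def)
  also have "\<dots> \<le> prob Ev + prob {w \<in> space M. R1 < \<bar>T w\<bar>}"
    by (intro measure_Un_le) measurable
  finally have pEv: "\<eta> / 2 \<le> prob Ev" using R1 bigA by linarith
  have intZ: "integrable M Z"
    by (rule integrable_const_bound[of _ "real K"]) (use Zb in auto)
  have "expectation Z' = expectation Z + prob Ev"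
  proof -
    have "integrable M (indicat_real Ev)"
      using Ev by (intro integrable_real_indicator) (simp_all add: less_top[symmetric])
    then show ?thesis
      unfolding Z'_def using Ev by (subst Bochner_Integration.integral_add[OF intZ]) auto
  qed
  then have EZ': "real (Suc K) * \<eta> / 2 \<le> expectation Z'"
    using EZ pEv by (simp add: algebra_simps add_divide_distrib)
  have Q_card: "card Q \<le> 2 ^ Suc K * card P"
  proof -
    have "card Q \<le> 2 ^ K * (2 * card P)"
      using Q(3) mult_le_mono2[OF P1(3), of "2 ^ K"] by (rule order_trans)
    then show ?thesis by simp
  qed
  then have "real (card Q) \<le> 2 ^ Suc K * real (card P)"
  proof -
    have "real (card Q) \<le> real (2 ^ Suc K * card P)" using Q_card by (simp only: of_nat_le_iff)
    then show ?thesis by (simp only: of_nat_mult of_nat_power of_nat_numeral)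
  qed
  then have "real (card Q) * t \<le> 2 ^ Suc K * real (card P) * t"
    using t by (intro mult_right_mono)
  then have smallQ: "real (card Q) * t \<le> R / 4"
    unfolding R_def by simp
  have AEsplit: "AE w in M. \<forall>a\<in>P. \<mu> a w = \<mu> (a \<inter> A) w + \<mu> (a - A) w"
  proof (intro AE_finite_allI finP)
    fix a assume "a \<in> P"
    moreover have "(a \<inter> A) \<union> (a - A) = a" by blast
    ultimately show "AE w in M. \<mu> a w = \<mu> (a \<inter> A) w + \<mu> (a - A) w"
      using additive[of "a \<inter> A" "a - A"] A Psets by auto
  qed
  have AEsumQ: "AE w in M. \<forall>s\<in>P1. \<mu> s w = (\<Sum>b\<in>{b\<in>Q. b \<subseteq> s}. \<mu> b w)"
  proof (intro AE_finite_allI value_refinement Q(1))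
    show "finite P1" using P1 unfolding fin_partition_def by blast
    fix s assume s: "s \<in> P1"
    then show "s \<in> sets N" using P1 unfolding fin_partition_def by blast
    fix b assume "b \<in> Q"
    then obtain s' where "s' \<in> P1" "b \<subseteq> s'" using Q(2) unfolding refines_def by blast
    then show "b \<subseteq> s \<or> b \<inter> s = {}"
      using s P1(1) unfolding fin_partition_def partition_on_def disjoint_def by blast
  qed
  have AEsumA: "AE w in M. \<mu> A w = (\<Sum>a\<in>P. \<mu> (a \<inter> A) w)"
  proof -
    have "AE w in M. \<mu> (\<Union>a\<in>P. a \<inter> A) w = (\<Sum>a\<in>P. \<mu> (a \<inter> A) w)"
    proof (intro value_finite_Union finP)
      show "a \<inter> A \<in> sets N" if "a \<in> P" for a using that Psets A by auto
      show "disjoint_family_on (\<lambda>a. a \<inter> A) P"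
        using P unfolding fin_partition_def partition_on_def disjoint_def disjoint_family_on_def
        by blast
    qed
    moreover have "(\<Union>a\<in>P. a \<inter> A) = A"
      using P sets.sets_into_space[OF A] unfolding fin_partition_def partition_on_def by blast
    ultimately show ?thesis by simp
  qed
  have "AE w in M. Z' w + real (card (meets_large t P Q w)) \<le> real (card (large t Q w))"
    using AEZ value_empty AEsplit AEsumQ AEsumA AE_space
  proof eventually_elim
    case (elim w)
    have le: "card (meets_large t P Q w) \<le> card (meets_large t P1 Q w)"
      unfolding P1_def using Q by (intro card_meets_large_split_by P A) (auto simp: P1_def)
    show ?case
    proof (cases "w \<in> Ev")
      case True
      have "card (meets_large t P Q w) < card (meets_large t P1 Q w)"
        unfolding P1_def
      proof (rule meets_large_split_by_grows[OF P A Q(1) _ elim(2)])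
        show "refines (space N) Q (split_by A P)" using Q(2) unfolding P1_def .
        show "R < \<bar>\<mu> A w\<bar>" using True unfolding Ev_def by simp
        show "(\<Sum>a\<in>P. \<bar>\<mu> a w\<bar>) \<le> R / 4" 
        proof -
          have "T w \<le> R1" "4 * R1 \<le> R" using True unfolding Ev_def R_def by simp_all
          then show ?thesis unfolding T_def by linarith
        qed
      qed (use elim smallQ t P1_def in auto)
      then show ?thesis using elim(1) True unfolding Z'_def by simp
    next
      case False
      then show ?thesis using elim(1) le unfolding Z'_def by simp
    qed
  qed
  moreover have "refines (space N) Q P" using Q(2) P1(2) by (rule refines_trans)
  moreover have "Z' \<in> borel_measurable M" unfolding Z'_def by measurable
  moreover have "\<forall>w. 0 \<le> Z' w \<and> Z' w \<le> real (Suc K)"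
  proof
    fix w
    have "0 \<le> indicat_real Ev w" "indicat_real Ev w \<le> 1"
      by (simp_all add: indicator_def)
    then show "0 \<le> Z' w \<and> Z' w \<le> real (Suc K)"
      using Zb[of w, THEN conjunct1] Zb[of w, THEN conjunct2] unfolding Z'_def of_nat_Suc
      by linarith
  qed
  ultimately show ?case
    using Q(1) Q_card EZ' by (intro exI[of _ Q] exI[of _ Z'] conjI) assumption+
qed

text \<open>The counter \<open>Z\<close> is at most \<open>K\<close> and has mean at least \<open>K * \<eta> / 2\<close>; so it is at least \<open>K * \<eta> / 4\<close>
with probability \<open>\<eta> / 4\<close>, whatever \<open>K\<close> is.\<close>

lemma unbounded_imp_many_large:
  assumes \<eta>: "0 < \<eta>" and unb: "\<And>R. \<exists>A\<in>sets N. \<eta> < prob {w \<in> space M. R < \<bar>\<mu> A w\<bar>}"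
  shows "many_large (space N) (\<eta> / 4)"
  unfolding many_large_def has_large_family_def
proof (intro allI)
  fix L :: nat and t :: real
  define s where "s = max t 0"
  obtain K0 where K0: "4 * real L / \<eta> < real K0" using reals_Archimedean2 by blast
  define K where "K = Suc K0"
  have K: "real L \<le> real K * \<eta> / 4" "0 < real K"
  proof -
    have "4 * real L / \<eta> \<le> real K" using K0 unfolding K_def by simp
    then show "real L \<le> real K * \<eta> / 4" using \<eta> by (simp add: field_simps)
  qed (simp add: K_def)
  define P where "P = {space N} - {{}}"
  have P: "fin_partition P"
    unfolding fin_partition_def P_def partition_on_def by (auto simp: disjoint_def)
  obtain Q Z where Q: "fin_partition Q"
    and Z [measurable]: "Z \<in> borel_measurable M" and Zb: "\<And>w. 0 \<le> Z w \<and> Z w \<le> real K"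
    and EZ: "real K * \<eta> / 2 \<le> expectation Z"
    and AEZ: "AE w in M. Z w + real (card (meets_large s P Q w)) \<le> real (card (large s Q w))"
    using refinement_with_large_atoms[OF \<eta> unb _ P, of s K] unfolding s_def by auto
  have Q': "finite Q" "Q \<subseteq> sets N" "disjoint Q" "\<Union>Q \<subseteq> space N"
    using Q unfolding fin_partition_def partition_on_def by auto
  define E where "E = {w \<in> space M. real K * \<eta> / 4 \<le> Z w}"
  have E: "E \<in> events" unfolding E_def by measurable
  have intE: "integrable M (indicat_real E)"
    using E by (intro integrable_real_indicator) (simp_all add: less_top[symmetric])
  have "expectation Z \<le> expectation (\<lambda>w. real K * \<eta> / 4 + real K * indicator E w)"
  proof (rule integral_mono)
    show "integrable M Z"
      by (rule integrable_const_bound[of _ "real K"]) (use Zb in auto)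
    show "integrable M (\<lambda>w. real K * \<eta> / 4 + real K * indicator E w)"
      using intE by (intro Bochner_Integration.integrable_add integrable_mult_right) simp_all
    fix w assume w: "w \<in> space M"
    show "Z w \<le> real K * \<eta> / 4 + real K * indicator E w"
    proof (cases "w \<in> E")
      case True
      then show ?thesis using Zb[of w] \<eta> by (simp add: add_increasing)
    next
      case False
      then show ?thesis using w by (simp add: E_def)
    qed
  qed
  also have "\<dots> = real K * \<eta> / 4 + real K * prob E"
    using E intE by (subst Bochner_Integration.integral_add) (simp_all add: prob_space)
  finally have "real K * (\<eta> / 4) \<le> real K * prob E" using EZ by simp
  then have "\<eta> / 4 \<le> prob E"
    using K(2) by (rule mult_left_le_imp_le)
  also have "\<dots> \<le> prob {w \<in> space M. L \<le> card (large t Q w)}"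
    unfolding E_def
  proof (rule prob_mono_AE[OF E[unfolded E_def] events_card_large[OF Q'(1,2)]])
    show "AE w in M. real K * \<eta> / 4 \<le> Z w \<longrightarrow> L \<le> card (large t Q w)"
      using AEZ
    proof eventually_elim
      case (elim w)
      have "card (large s Q w) \<le> card (large t Q w)"
        using Q'(1) unfolding large_def s_def by (intro card_mono) auto
      then show ?case using elim K(1) by linarith
    qed
  qed
  finally show "\<exists>P. finite P \<and> P \<subseteq> sets N \<and> disjoint P \<and> \<Union>P \<subseteq> space N \<and>
      \<eta> / 4 \<le> prob {w \<in> space M. L \<le> card (large t P w)}"
    using Q' by blast
qed

section \<open>The range is bounded in probability\<close>

text \<open>An averaging argument over all colourings \<open>\<phi>\<close> and all subsets \<open>S\<close> of \<open>P\<close>. If there are at least as many large cells as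
colours, a given colour hits a large cell for half of the colourings, and then half of the subsets
\<open>S\<close> make the value on the class large.\<close>

lemma colouring_with_large_classes:
  assumes P: "finite P" "P \<subseteq> sets N" "disjoint P" and M: "0 < m"
    and \<theta>: "\<theta> \<le> prob {w \<in> space M. m \<le> card (large 2 P w)}"
  shows "\<exists>\<phi> S. \<phi> \<in> P \<rightarrow>\<^sub>E {..<m} \<and> S \<subseteq> P \<and>
    \<theta> * real m / 4 \<le> (\<Sum>c<m. prob {w \<in> space M. 1 < \<bar>\<mu> (\<Union>{b\<in>S. \<phi> b = c}) w\<bar>})"
proof (rule ccontr)
  assume contra: "\<not> ?thesis"
  let ?All = "P \<rightarrow>\<^sub>E {..<m}"
  define Big where "Big \<phi> S c = {w \<in> space M. 1 < \<bar>\<Sum>b\<in>S \<inter> {b\<in>P. \<phi> b = c}. \<mu> b w\<bar>}"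
    for \<phi> :: "'x set \<Rightarrow> nat" and S c
  define G where "G = {w \<in> space M. m \<le> card (large 2 P w)}"
  have finAll: "finite ?All" "finite (Pow P)" using P(1) by (simp_all add: finite_PiE)
  have neAll: "?All \<noteq> {}" using M by (auto simp: PiE_eq_empty_iff lessThan_empty_iff)
  have G: "G \<in> events" unfolding G_def by (rule events_card_large[OF P(1,2)])
  have meas: "\<mu> b \<in> borel_measurable M" if "b \<in> P" for b
    using that P(2) measurable_value by blast
  have Big: "Big \<phi> S c \<in> events" for \<phi> S c
  proof -
    have [measurable]: "(\<lambda>w. \<Sum>b\<in>S \<inter> {b\<in>P. \<phi> b = c}. \<mu> b w) \<in> borel_measurable M"
      by (intro borel_measurable_sum meas) auto
    show ?thesis unfolding Big_def by measurable
  qed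
  have same: "prob {w \<in> space M. 1 < \<bar>\<mu> (\<Union>{b\<in>S. \<phi> b = c}) w\<bar>} = prob (Big \<phi> S c)"
    if S: "S \<subseteq> P" for \<phi> S c
  proof (rule finite_measure_eq_AE)
    have eq: "S \<inter> {b\<in>P. \<phi> b = c} = {b\<in>S. \<phi> b = c}" using S by blast
    have "{b\<in>S. \<phi> b = c} \<subseteq> sets N" "finite {b\<in>S. \<phi> b = c}" using S P by (auto intro: finite_subset)
    then show "{w \<in> space M. 1 < \<bar>\<mu> (\<Union>{b\<in>S. \<phi> b = c}) w\<bar>} \<in> events"
      by (intro events_value_gt sets.finite_Union)
    have "AE w in M. \<mu> (\<Union>{b\<in>S. \<phi> b = c}) w = (\<Sum>b\<in>{b\<in>S. \<phi> b = c}. \<mu> b w)"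
    proof (intro value_Union_disjoint)
      show "disjoint {b\<in>S. \<phi> b = c}"
        using P(3) by (rule pairwise_subset) (use S in blast)
    qed (use S P in \<open>auto intro: finite_subset\<close>)
    then show "AE w in M. w \<in> {w \<in> space M. 1 < \<bar>\<mu> (\<Union>{b\<in>S. \<phi> b = c}) w\<bar>} \<longleftrightarrow> w \<in> Big \<phi> S c"
      unfolding Big_def eq by eventually_elim simp
  qed (rule Big)
  have "(\<Sum>\<phi>\<in>?All. \<Sum>S\<in>Pow P. \<Sum>c<m. prob (Big \<phi> S c)) < (\<Sum>\<phi>\<in>?All. \<Sum>S\<in>Pow P. \<theta> * real m / 4)"
  proof (intro sum_strict_mono finAll neAll)
    fix \<phi> S assume \<phi>S: "\<phi> \<in> ?All" "S \<in> Pow P"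
    then have "(\<Sum>c<m. prob (Big \<phi> S c)) =
        (\<Sum>c<m. prob {w \<in> space M. 1 < \<bar>\<mu> (\<Union>{b\<in>S. \<phi> b = c}) w\<bar>})"
      by (intro sum.cong refl same[symmetric]) simp
    moreover have "\<not> \<theta> * real m / 4 \<le> (\<Sum>c<m. prob {w \<in> space M. 1 < \<bar>\<mu> (\<Union>{b\<in>S. \<phi> b = c}) w\<bar>})"
      using contra \<phi>S by blast
    ultimately show "(\<Sum>c<m. prob (Big \<phi> S c)) < \<theta> * real m / 4"
      by (simp only: not_le)
  next
    show "Pow P \<noteq> {}" by blast
  qed
  also have "\<dots> = real (card ?All) * 2 ^ card P * real m / 4 * \<theta>"
    using P(1) by (simp add: card_Pow)
  also have "\<dots> \<le> real (card ?All) * 2 ^ card P * real m / 4 * prob G"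
    using \<theta> unfolding G_def by (intro mult_left_mono) auto
  also have "\<dots> = expectation (\<lambda>w. real (card ?All) * 2 ^ card P * real m / 4 * indicator G w)"
    using G by simp
  also have "\<dots> \<le> expectation (\<lambda>w. \<Sum>\<phi>\<in>?All. \<Sum>S\<in>Pow P. \<Sum>c<m. indicator (Big \<phi> S c) w)"
  proof (rule integral_mono)
    have ind: "integrable M (indicat_real A)" if "A \<in> events" for A
      using that by (intro integrable_real_indicator) (simp_all add: less_top[symmetric])
    show "integrable M (\<lambda>w. real (card ?All) * 2 ^ card P * real m / 4 * indicator G w)"
      by (intro integrable_mult_right ind G)
    show "integrable M (\<lambda>w. \<Sum>\<phi>\<in>?All. \<Sum>S\<in>Pow P. \<Sum>c<m. indicat_real (Big \<phi> S c) w)"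
      by (intro Bochner_Integration.integrable_sum ind Big)
    fix w assume w: "w \<in> space M"
    show "real (card ?All) * 2 ^ card P * real m / 4 * indicator G w \<le>
      (\<Sum>\<phi>\<in>?All. \<Sum>S\<in>Pow P. \<Sum>c<m. indicat_real (Big \<phi> S c) w)"
    proof (cases "w \<in> G")
      case False
      then show ?thesis by (simp add: sum_nonneg)
    next
      case True
      define H where "H = large 2 P w"
      have H: "H \<subseteq> P" "m \<le> card H" using True unfolding H_def G_def large_def by auto
      have half: "2 ^ card P / 2 * indicator {\<phi>. c \<in> \<phi> ` H} \<phi> \<le>
          (\<Sum>S\<in>Pow P. indicat_real (Big \<phi> S c) w)" for \<phi> c
      proof (cases "c \<in> \<phi> ` H")
        case True
        then obtain b where b: "b \<in> H" "\<phi> b = c" by blast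
        have "2 ^ card P \<le> 2 * card {S \<in> Pow P. 1 < \<bar>\<Sum>a\<in>S \<inter> {b\<in>P. \<phi> b = c}. \<mu> a w\<bar>}"
          using b H(1) unfolding H_def large_def
          by (intro half_of_subsums_large[OF P(1), where b=b]) auto
        then have "real (2 ^ card P) \<le> real (2 * card {S \<in> Pow P. w \<in> Big \<phi> S c})"
          using w unfolding Big_def by (simp only: of_nat_le_iff) simp
        moreover have "(\<Sum>S\<in>Pow P. indicat_real (Big \<phi> S c) w) = real (card {S \<in> Pow P. w \<in> Big \<phi> S c})"
          using P(1) by (simp add: indicator_def sum.If_cases Int_def)
        ultimately show ?thesis using True by simp
      next
        case False
        then show ?thesis by (simp add: sum_nonneg)
      qed
      have "real (card ?All) * 2 ^ card P * real m / 4 * indicator G w =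
          (\<Sum>c<m. 2 ^ card P / 2 * (real (card ?All) / 2))"
        using True by simp
      also have "\<dots> \<le> (\<Sum>c<m. 2 ^ card P / 2 * real (card {\<phi> \<in> ?All. c \<in> \<phi> ` H}))"
      proof (intro sum_mono mult_left_mono)
        fix c assume "c \<in> {..<m}"
        then have "card ?All \<le> 2 * card {\<phi> \<in> ?All. c \<in> \<phi> ` H}"
          using colourings_hitting_colour[OF P(1) H(1) M _ H(2)] by simp
        then show "real (card ?All) / 2 \<le> real (card {\<phi> \<in> ?All. c \<in> \<phi> ` H})"
          by linarith
      qed simp
      also have "\<dots> = (\<Sum>c<m. \<Sum>\<phi>\<in>?All. 2 ^ card P / 2 * indicator {\<phi>. c \<in> \<phi> ` H} \<phi>)"
      proof (intro sum.cong refl)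
        fix c
        have "real (card {\<phi> \<in> ?All. c \<in> \<phi> ` H}) = (\<Sum>\<phi>\<in>?All. indicator {\<phi>. c \<in> \<phi> ` H} \<phi>)"
          using finAll(1) by (simp add: indicator_def sum.If_cases Int_def)
        then show "2 ^ card P / 2 * real (card {\<phi> \<in> ?All. c \<in> \<phi> ` H}) =
            (\<Sum>\<phi>\<in>?All. 2 ^ card P / 2 * indicator {\<phi>. c \<in> \<phi> ` H} \<phi>)"
          by (simp only: sum_distrib_left)
      qed
      also have "\<dots> \<le> (\<Sum>c<m. \<Sum>\<phi>\<in>?All. \<Sum>S\<in>Pow P. indicat_real (Big \<phi> S c) w)"
        by (intro sum_mono half)
      also have "\<dots> = (\<Sum>\<phi>\<in>?All. \<Sum>c<m. \<Sum>S\<in>Pow P. indicat_real (Big \<phi> S c) w)"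
        by (rule sum.swap)
      also have "\<dots> = (\<Sum>\<phi>\<in>?All. \<Sum>S\<in>Pow P. \<Sum>c<m. indicat_real (Big \<phi> S c) w)"
        by (intro sum.cong refl sum.swap)
      finally show ?thesis .
    qed
  qed
  also have "\<dots> = (\<Sum>\<phi>\<in>?All. \<Sum>S\<in>Pow P. \<Sum>c<m. prob (Big \<phi> S c))"
  proof -
    have ind: "integrable M (indicat_real (Big \<phi> S c))" for \<phi> S c
      using Big by (intro integrable_real_indicator) (simp_all add: less_top[symmetric])
    have "expectation (\<lambda>w. \<Sum>\<phi>\<in>?All. \<Sum>S\<in>Pow P. \<Sum>c<m. indicat_real (Big \<phi> S c) w) =
        (\<Sum>\<phi>\<in>?All. \<Sum>S\<in>Pow P. \<Sum>c<m. expectation (indicat_real (Big \<phi> S c)))"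
      by (simp add: Bochner_Integration.integral_sum Bochner_Integration.integrable_sum ind)
    then show ?thesis using Big by simp
  qed
  finally show False by simp
qed

text \<open>Cutting a cell into \<open>m\<close> pieces leaves at least one piece with at least a fraction \<open>1 / m\<close> of its value.\<close>

lemma card_large_le_refinement:
  assumes P: "finite P" "P \<subseteq> sets N" "disjoint P"
    and D: "\<And>c. c < m \<Longrightarrow> D c \<in> sets N" "disjoint_family_on D {..<m}" "\<Union>P \<subseteq> (\<Union>c<m. D c)"
    and t: "0 \<le> t"
  shows "AE w in M. card (large (real m * t) P w) \<le> card (large t (\<Union>c<m. (\<lambda>b. b \<inter> D c) ` P) w)"
proof -
  have "AE w in M. \<forall>b\<in>P. \<mu> b w = (\<Sum>c<m. \<mu> (b \<inter> D c) w)"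
  proof (intro AE_finite_allI P(1))
    fix b assume b: "b \<in> P"
    have "AE w in M. \<mu> (\<Union>c<m. b \<inter> D c) w = (\<Sum>c<m. \<mu> (b \<inter> D c) w)"
    proof (intro value_finite_Union)
      show "b \<inter> D c \<in> sets N" if "c \<in> {..<m}" for c
        using b P(2) D(1) that by auto
      show "disjoint_family_on (\<lambda>c. b \<inter> D c) {..<m}"
        using D(2) unfolding disjoint_family_on_def by blast
    qed simp
    moreover have "(\<Union>c<m. b \<inter> D c) = b" using b D(3) by blast
    ultimately show "AE w in M. \<mu> b w = (\<Sum>c<m. \<mu> (b \<inter> D c) w)" by simp
  qed
  then show ?thesis
    using value_empty
  proof eventually_elim
    case (elim w)
    let ?F = "\<Union>c<m. (\<lambda>b. b \<inter> D c) ` P"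
    \<comment> \<open>A large cell has a large piece; the map \<open>g\<close> to such a piece is injective as pieces of different
      cells are disjoint, and large pieces are nonempty because \<open>\<mu> {}\<close> vanishes.\<close>
    have ex: "\<exists>c<m. t < \<bar>\<mu> (b \<inter> D c) w\<bar>" if b: "b \<in> large (real m * t) P w" for b
    proof (rule ccontr)
      assume "\<not> ?thesis"
      then have "\<bar>\<mu> (b \<inter> D c) w\<bar> \<le> t" if "c < m" for c using that by force
      then have "(\<Sum>c<m. \<bar>\<mu> (b \<inter> D c) w\<bar>) \<le> real m * t"
        using sum_bounded_above[of "{..<m}" "\<lambda>c. \<bar>\<mu> (b \<inter> D c) w\<bar>" t] by simp
      moreover have "\<bar>\<mu> b w\<bar> \<le> (\<Sum>c<m. \<bar>\<mu> (b \<inter> D c) w\<bar>)"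
        using elim(1) b unfolding large_def by (simp add: sum_abs)
      ultimately show False using b unfolding large_def by simp
    qed
    define g where "g b = b \<inter> D (SOME c. c < m \<and> t < \<bar>\<mu> (b \<inter> D c) w\<bar>)" for b
    have g: "g b \<in> large t ?F w \<and> g b \<subseteq> b \<and> g b \<noteq> {}" if b: "b \<in> large (real m * t) P w" for b
    proof -
      define c where "c = (SOME c. c < m \<and> t < \<bar>\<mu> (b \<inter> D c) w\<bar>)"
      have c: "c < m" "t < \<bar>\<mu> (b \<inter> D c) w\<bar>"
        using someI_ex[OF ex[OF b]] unfolding c_def by auto
      have gb: "g b = b \<inter> D c" unfolding g_def c_def ..
      have "b \<in> P" using b unfolding large_def by simp
      then have "b \<inter> D c \<in> large t ?F w" using c unfolding large_def by blast
      moreover have "b \<inter> D c \<noteq> {}" using c(2) t elim(2) by auto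
      ultimately show ?thesis unfolding gb by blast
    qed
    have "inj_on g (large (real m * t) P w)"
    proof (rule inj_onI)
      fix a b assume ab: "a \<in> large (real m * t) P w" "b \<in> large (real m * t) P w" "g a = g b"
      then have "a \<inter> b \<noteq> {}" using g[OF ab(1)] g[OF ab(2)] by auto
      moreover have "a \<in> P" "b \<in> P" using ab unfolding large_def by simp_all
      ultimately show "a = b" using P(3) unfolding disjoint_def by blast
    qed
    moreover have "g ` large (real m * t) P w \<subseteq> large t ?F w" using g by blast
    moreover have "finite (large t ?F w)" using P(1) by (intro finite_large) auto
    ultimately show ?case by (rule card_inj_on_le)
  qed
qed

text \<open>If the removal of \<open>D c\<close> destroyed the property at level \<open>\<theta> - \<delta>\<close>, then with probability at least \<open>\<delta>\<close> most of the
large values would sit in \<open>D c\<close>. For different \<open>c\<close> these events exclude each other, so there are at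
most \<open>1 / \<delta>\<close> such \<open>c\<close>.\<close>

lemma some_class_removable:
  fixes m :: nat
  assumes E: "E \<in> sets N" and many: "many_large E \<theta>"
    and D: "\<And>c. c < m \<Longrightarrow> D c \<in> sets N" "disjoint_family_on D {..<m}" "(\<Union>c<m. D c) = E"
    and C: "C \<subseteq> {..<m}" "1 < real (card C) * \<delta>"
  shows "\<exists>c\<in>C. many_large (E - D c) (\<theta> - \<delta>)"
proof (rule ccontr)
  assume contra: "\<not> ?thesis"
  have finC: "finite C" by (rule finite_subset[OF C(1)]) simp
  have "\<forall>c\<in>C. \<exists>L t. \<not> has_large_family (E - D c) (\<theta> - \<delta>) L t"
    using contra unfolding many_large_def by blast
  then obtain L t where nL: "\<forall>c\<in>C. \<not> has_large_family (E - D c) (\<theta> - \<delta>) (L c) (t c)"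
    by metis
  have Lt: "prob {w \<in> space M. L c \<le> card (large (t c) P w)} < \<theta> - \<delta>"
    if c: "c \<in> C" and P: "finite P" "P \<subseteq> sets N" "disjoint P" "\<Union>P \<subseteq> E - D c" for c P
  proof (rule ccontr)
    assume "\<not> ?thesis"
    then have "\<theta> - \<delta> \<le> prob {w \<in> space M. L c \<le> card (large (t c) P w)}"
      by (simp only: not_less)
    with P have "has_large_family (E - D c) (\<theta> - \<delta>) (L c) (t c)"
      unfolding has_large_family_def by (intro exI[of _ P] conjI)
    then show False using nL c by blast
  qed
  \<comment> \<open>Sums serve as common upper bounds of the finitely many thresholds.\<close>
  define Lm where "Lm = (\<Sum>c\<in>C. L c)"
  define tm where "tm = (\<Sum>c\<in>C. \<bar>t c\<bar>)"
  have L_le: "L c \<le> Lm" if "c \<in> C" for c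
    unfolding Lm_def using that finC by (intro member_le_sum) simp_all
  have t_le: "t c \<le> tm" if "c \<in> C" for c
  proof -
    have "\<bar>t c\<bar> \<le> tm"
      unfolding tm_def using that finC by (intro member_le_sum) simp_all
    then show ?thesis by linarith
  qed
  have tm: "0 \<le> tm" unfolding tm_def by (simp add: sum_nonneg)
  obtain P where P: "finite P" "P \<subseteq> sets N" "disjoint P" "\<Union>P \<subseteq> E"
      and G: "\<theta> \<le> prob {w \<in> space M. 2 * Lm + 1 \<le> card (large (real m * tm) P w)}"
    using many[unfolded many_large_def, rule_format, of "2 * Lm + 1" "real m * tm"]
    unfolding has_large_family_def by (elim exE conjE)
  define F where "F c = (\<lambda>b. b \<inter> D c) ` P - {{}}" for c
  define R where "R c = (\<Union>d\<in>{..<m} - {c}. F d)" for c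
  have F: "finite (F c)" "\<And>s. s \<in> F c \<Longrightarrow> s \<subseteq> D c" "{} \<notin> F c" for c
    using P(1) unfolding F_def by auto
  have Fsets: "F c \<subseteq> sets N" if "c < m" for c
    using P(2) D(1)[OF that] unfolding F_def by auto
  have R: "finite (R c)" "R c \<subseteq> sets N" "disjoint (R c)" "\<Union>(R c) \<subseteq> E - D c" if c: "c < m" for c
  proof -
    show "finite (R c)" unfolding R_def using F(1) by auto
    show "R c \<subseteq> sets N" unfolding R_def using Fsets by auto
    have disjD: "D d \<inter> D d' = {}" if "d < m" "d' < m" "d \<noteq> d'" for d d'
      using D(2) that unfolding disjoint_family_on_def by simp
    show "disjoint (R c)"
      unfolding disjoint_def
    proof (intro ballI impI)
      fix s s' assume s: "s \<in> R c" "s' \<in> R c" "s \<noteq> s'"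
      then obtain d d' b b' where d: "d < m" "d' < m" "b \<in> P" "b' \<in> P" "s = b \<inter> D d" "s' = b' \<inter> D d'"
        unfolding R_def F_def by blast
      show "s \<inter> s' = {}"
      proof (cases "d = d'")
        case True
        then have "b \<noteq> b'" using d s(3) by blast
        then have "b \<inter> b' = {}" using P(3) d unfolding disjoint_def by blast
        then show ?thesis using d by blast
      next
        case False
        then show ?thesis using disjD[OF d(1,2)] d by blast
      qed
    qed
    show "\<Union>(R c) \<subseteq> E - D c"
    proof
      fix x assume "x \<in> \<Union>(R c)"
      then obtain d s where "d < m" "d \<noteq> c" "s \<in> F d" "x \<in> s" unfolding R_def by blast
      then have "d < m" "d \<noteq> c" "x \<in> D d" using F(2) by blast+
      then show "x \<in> E - D c" using disjD[of d c] c D(3) by blast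
    qed
  qed
  define G' where "G' = {w \<in> space M. 2 * Lm + 1 \<le> card (large (real m * tm) P w)}"
  have G': "G' \<in> events" unfolding G'_def by (rule events_card_large[OF P(1,2)])
  define Bad where "Bad c = G' - {w \<in> space M. Suc Lm \<le> card (large tm (R c) w)}" for c
  have Bad: "Bad c \<in> events" if "c < m" for c
    unfolding Bad_def using G' events_card_large[OF R(1,2)[OF that]] by blast
  have pBad: "\<delta> \<le> prob (Bad c)" if c: "c \<in> C" for c
  proof -
    have cm: "c < m" using c C(1) by auto
    let ?U = "{w \<in> space M. L c \<le> card (large (t c) (R c) w)}"
    have U: "?U \<in> events" by (rule events_card_large[OF R(1,2)[OF cm]])
    have "\<theta> \<le> prob G'" using G unfolding G'_def .
    also have "\<dots> \<le> prob (Bad c \<union> ?U)"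
    proof (rule finite_measure_mono)
      show "G' \<subseteq> Bad c \<union> ?U"
      proof
        fix w assume w: "w \<in> G'"
        have "card (large tm (R c) w) \<le> card (large (t c) (R c) w)"
          using t_le[OF c] R(1)[OF cm] unfolding large_def by (intro card_mono) auto
        then show "w \<in> Bad c \<union> ?U"
          using w L_le[OF c] unfolding Bad_def G'_def by auto
      qed
    qed (use Bad[OF cm] U in blast)
    also have "\<dots> \<le> prob (Bad c) + prob ?U"
      by (intro measure_Un_le Bad[OF cm] U)
    finally show ?thesis
      using Lt[OF c R[OF cm]] by linarith
  qed
  have ref: "AE w in M. card (large (real m * tm) P w) \<le>
      card (large tm (\<Union>c<m. (\<lambda>b. b \<inter> D c) ` P) w)"
    by (rule card_large_le_refinement[OF P(1-3) D(1,2) _ tm]) (use P(4) D(3) in simp_all)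
  have AE1: "AE w in M. (\<Sum>c\<in>C. indicat_real (Bad c) w) \<le> 1"
    using ref value_empty
  proof eventually_elim
    case (elim w)
    let ?F = "\<Union>c<m. (\<lambda>b. b \<inter> D c) ` P"
    have tot: "2 * Lm + 1 \<le> card (large tm (F c) w) + card (large tm (R c) w)"
      if "w \<in> G'" "c < m" for c
    proof -
      have "large tm ?F w \<subseteq> large tm (F c) w \<union> large tm (R c) w"
      proof
        fix s assume "s \<in> large tm ?F w"
        then obtain d b where s: "d < m" "b \<in> P" "s = b \<inter> D d" "tm < \<bar>\<mu> s w\<bar>"
          unfolding large_def by blast
        then have "s \<noteq> {}" using elim(2) tm by auto
        then have "s \<in> F d" using s unfolding F_def by blast
        then have "s \<in> F c \<union> R c" using s(1) unfolding R_def by blast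
        then show "s \<in> large tm (F c) w \<union> large tm (R c) w"
          using s(4) unfolding large_def by blast
      qed
      then have "card (large tm ?F w) \<le> card (large tm (F c) w \<union> large tm (R c) w)"
        using F(1) R(1)[OF that(2)] by (intro card_mono) (auto simp: finite_large)
      also have "\<dots> \<le> card (large tm (F c) w) + card (large tm (R c) w)"
        by (rule card_Un_le)
      finally show ?thesis using elim(1) that(1) unfolding G'_def by simp
    qed
    have uniq: "c = d" if cd: "c \<in> C" "d \<in> C" "w \<in> Bad c" "w \<in> Bad d" for c d
    proof (rule ccontr)
      assume "c \<noteq> d"
      have m: "c < m" "d < m" using cd C(1) by auto
      have w: "w \<in> G'" "w \<in> space M" using cd unfolding Bad_def G'_def by auto
      have "card (large tm (R c) w) \<le> Lm" "card (large tm (R d) w) \<le> Lm"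
        using cd w unfolding Bad_def by auto
      moreover have "card (large tm (F c) w) \<le> card (large tm (R d) w)"
      proof (rule card_mono)
        show "finite (large tm (R d) w)" using R(1)[OF m(2)] by (rule finite_large)
        show "large tm (F c) w \<subseteq> large tm (R d) w"
          using m(1) \<open>c \<noteq> d\<close> unfolding large_def R_def by blast
      qed
      ultimately show False using tot[OF w(1) m(1)] by linarith
    qed
    show "(\<Sum>c\<in>C. indicat_real (Bad c) w) \<le> 1"
    proof (cases "\<exists>c\<in>C. w \<in> Bad c")
      case True
      then obtain c where c: "c \<in> C" "w \<in> Bad c" by blast
      then have "(\<Sum>d\<in>C. indicat_real (Bad d) w) = (\<Sum>d\<in>C. if d = c then 1 else 0)"
        using uniq by (intro sum.cong) (auto simp: indicator_def)
      then show ?thesis using finC by simp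
    next
      case False
      then have "(\<Sum>d\<in>C. indicat_real (Bad d) w) = 0"
        by (intro sum.neutral) (auto simp: indicator_def)
      then show ?thesis by simp
    qed
  qed
  have ind: "integrable M (indicat_real (Bad c))" if "c \<in> C" for c
    using Bad that C(1) by (intro integrable_real_indicator) (auto simp: less_top[symmetric])
  have "real (card C) * \<delta> \<le> (\<Sum>c\<in>C. prob (Bad c))"
    using pBad sum_bounded_below[of C \<delta> "\<lambda>c. prob (Bad c)"] by simp
  also have "\<dots> = (\<Sum>c\<in>C. expectation (indicat_real (Bad c)))"
    using Bad C(1) by (intro sum.cong) auto
  also have "\<dots> = expectation (\<lambda>w. \<Sum>c\<in>C. indicat_real (Bad c) w)"
    using ind by (simp add: Bochner_Integration.integral_sum)
  also have "\<dots> \<le> expectation (\<lambda>w. 1)"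
    using AE1 ind by (intro integral_mono_AE Bochner_Integration.integrable_sum) auto
  finally show False using C(2) by (simp add: prob_space)
qed


text \<open>With sufficiently many colours, a positive fraction of the classes contains a set with a large
value, which is more classes than can be essential for the large values. So one of them can be split off at an arbitrarily
small loss of probability.\<close>

lemma many_large_step:
  assumes E: "E \<in> sets N" and many: "many_large E \<theta>" and \<theta>: "0 < \<theta>\<^sub>0" "\<theta>\<^sub>0 < \<theta>"
  shows "\<exists>E' B \<theta>'. E' \<in> sets N \<and> E' \<subseteq> E \<and> many_large E' \<theta>' \<and> \<theta>\<^sub>0 < \<theta>' \<and>
    B \<in> sets N \<and> B \<subseteq> E - E' \<and> \<theta>\<^sub>0 / 8 \<le> prob {w \<in> space M. 1 < \<bar>\<mu> B w\<bar>}"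
proof -
  define \<delta> where "\<delta> = (\<theta> - \<theta>\<^sub>0) / 2"
  have \<delta>: "0 < \<delta>" "\<theta>\<^sub>0 < \<theta> - \<delta>" using \<theta> unfolding \<delta>_def by (simp_all add: field_simps)
  \<comment> \<open>At least \<open>m * \<theta>\<^sub>0 / 8\<close> of the \<open>m\<close> colours have a large value with probability \<open>\<theta>\<^sub>0 / 8\<close>; this
    number has to exceed \<open>1 / \<delta>\<close>.\<close>
  obtain m0 where m0: "8 / (\<theta>\<^sub>0 * \<delta>) < real m0" using reals_Archimedean2 by blast
  define m where "m = Suc m0"
  have m: "0 < m" "8 < real m * (\<theta>\<^sub>0 * \<delta>)"
  proof -
    have "8 / (\<theta>\<^sub>0 * \<delta>) < real m" using m0 unfolding m_def by simp
    then show "8 < real m * (\<theta>\<^sub>0 * \<delta>)"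
      using \<theta> \<delta> by (simp only: pos_divide_less_eq mult_pos_pos)
  qed (simp add: m_def)
  obtain P where P: "finite P" "P \<subseteq> sets N" "disjoint P" "\<Union>P \<subseteq> E"
      and G: "\<theta> \<le> prob {w \<in> space M. m \<le> card (large 2 P w)}"
    using many[unfolded many_large_def, rule_format, of m 2] unfolding has_large_family_def
    by (elim exE conjE)
  obtain \<phi> S where \<phi>: "\<phi> \<in> P \<rightarrow>\<^sub>E {..<m}" and S: "S \<subseteq> P"
    and sum: "\<theta> * real m / 4 \<le> (\<Sum>c<m. prob {w \<in> space M. 1 < \<bar>\<mu> (\<Union>{b\<in>S. \<phi> b = c}) w\<bar>})"
    using colouring_with_large_classes[OF P(1-3) m(1) G] by (elim exE conjE)
  define B where "B c = \<Union>{b\<in>S. \<phi> b = c}" for c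
  define v where "v c = prob {w \<in> space M. 1 < \<bar>\<mu> (B c) w\<bar>}" for c
  define C where "C = {c\<in>{..<m}. \<theta>\<^sub>0 / 8 \<le> v c}"
  have "(\<Sum>c<m. v c) \<le> (\<Sum>c<m. indicator C c + \<theta>\<^sub>0 / 8)"
  proof (rule sum_mono)
    fix c assume "c \<in> {..<m}"
    moreover have "v c \<le> 1" "0 \<le> \<theta>\<^sub>0 / 8" using \<theta>(1) unfolding v_def by simp_all
    ultimately show "v c \<le> indicator C c + \<theta>\<^sub>0 / 8"
      unfolding C_def by (cases "\<theta>\<^sub>0 / 8 \<le> v c") (simp_all add: indicator_def)
  qed
  also have "\<dots> = real (card C) + real m * (\<theta>\<^sub>0 / 8)"
  proof -
    have "{..<m} \<inter> C = C" unfolding C_def by blast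
    then show ?thesis by (simp add: sum.distrib indicator_def sum.If_cases Int_def)
  qed
  finally have "\<theta> * real m / 4 \<le> real (card C) + \<theta>\<^sub>0 * real m / 8"
    using sum unfolding v_def B_def by (simp add: mult.commute)
  moreover have "\<theta>\<^sub>0 * real m \<le> \<theta> * real m"
    using \<theta> by (intro mult_right_mono) auto
  ultimately have "\<theta>\<^sub>0 * real m / 8 \<le> real (card C)" by linarith
  then have "\<theta>\<^sub>0 * real m / 8 * \<delta> \<le> real (card C) * \<delta>"
    using \<delta> by (intro mult_right_mono) auto
  then have cardC: "1 < real (card C) * \<delta>"
  proof -
    have "\<theta>\<^sub>0 * real m / 8 * \<delta> = real m * (\<theta>\<^sub>0 * \<delta>) / 8" by simp
    with m(2) have "1 < \<theta>\<^sub>0 * real m / 8 * \<delta>" by linarith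
    with \<open>\<theta>\<^sub>0 * real m / 8 * \<delta> \<le> real (card C) * \<delta>\<close> show ?thesis by linarith
  qed
  \<comment> \<open>The classes have to cover \<open>E\<close>, so the part of \<open>E\<close> outside of \<open>\<Union>P\<close> is added to class 0.\<close>
  define D where "D c = (if c = 0 then E - (\<Union>d\<in>{0<..<m}. \<Union>{b\<in>P. \<phi> b = d}) else \<Union>{b\<in>P. \<phi> b = c})"
    for c
  have cls: "\<Union>{b\<in>P. \<phi> b = c} \<in> sets N" for c
    using P(1,2) by (intro sets.finite_Union) auto
  have disj: "\<Union>{b\<in>P. \<phi> b = c} \<inter> \<Union>{b\<in>P. \<phi> b = d} = {}" if "c \<noteq> d" for c d
    using P(3) that unfolding disjoint_def by fast
  have Dsets: "D c \<in> sets N" for c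
    unfolding D_def using E cls by (auto intro!: sets.Diff sets.finite_UN)
  have Ddisj: "disjoint_family_on D {..<m}"
    unfolding disjoint_family_on_def
  proof (intro ballI impI)
    fix c d assume cd: "c \<in> {..<m}" "d \<in> {..<m}" "c \<noteq> d"
    have D0: "D 0 \<inter> D e = {}" if "e \<in> {..<m}" "e \<noteq> 0" for e
      using that unfolding D_def by auto
    show "D c \<inter> D d = {}"
    proof (cases "c = 0 \<or> d = 0")
      case True
      then show ?thesis using D0[of c] D0[of d] cd by (metis Int_commute)
    next
      case False
      then show ?thesis using disj[OF cd(3)] unfolding D_def by simp
    qed
  qed
  have DE: "(\<Union>c<m. D c) = E"
  proof
    show "(\<Union>c<m. D c) \<subseteq> E"
      using P(4) unfolding D_def by (auto split: if_splits)
    show "E \<subseteq> (\<Union>c<m. D c)"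
    proof
      fix x assume x: "x \<in> E"
      show "x \<in> (\<Union>c<m. D c)"
      proof (cases "x \<in> D 0")
        case True
        then show ?thesis using m(1) by blast
      next
        case False
        then have "x \<in> (\<Union>d\<in>{0<..<m}. \<Union>{b\<in>P. \<phi> b = d})"
          using x unfolding D_def by (simp only: simp_thms if_True Diff_iff)
        then obtain d where d: "d \<in> {0<..<m}" "x \<in> \<Union>{b\<in>P. \<phi> b = d}"
          by (elim UN_E)
        then have "x \<in> D d" "d < m" unfolding D_def by auto
        then show ?thesis by blast
      qed
    qed
  qed
  obtain c where c: "c \<in> C" "many_large (E - D c) (\<theta> - \<delta>)"
    using some_class_removable[OF E many Dsets Ddisj DE _ cardC] unfolding C_def by blast
  have BD: "B c \<subseteq> D c"
  proof
    fix x assume "x \<in> B c"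
    then obtain b where b: "b \<in> P" "\<phi> b = c" "x \<in> b" using S unfolding B_def by blast
    show "x \<in> D c"
    proof (cases "c = 0")
      case True
      have "x \<notin> \<Union>{b\<in>P. \<phi> b = d}" if "d \<in> {0<..<m}" for d
        using disj[of 0 d] b True that by auto
      then show ?thesis using b P(4) True unfolding D_def by auto
    next
      case False
      then show ?thesis using b unfolding D_def by auto
    qed
  qed
  have Bsets: "B c \<in> sets N"
    unfolding B_def using P(1,2) S by (intro sets.finite_Union) (auto intro: finite_subset)
  have cm: "c < m" using c(1) unfolding C_def by simp
  have "D c \<subseteq> E" using DE cm by blast
  then have "B c \<subseteq> E - (E - D c)" using BD by blast
  moreover have "\<theta>\<^sub>0 / 8 \<le> prob {w \<in> space M. 1 < \<bar>\<mu> (B c) w\<bar>}"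
    using c(1) unfolding C_def v_def by simp
  ultimately show ?thesis
    using E Dsets[of c] c(2) \<delta>(2) Bsets
    by (intro exI[of _ "E - D c"] exI[of _ "B c"] exI[of _ "\<theta> - \<delta>"] conjI) auto
qed

text \<open>The sets split off in infinitely many steps are disjoint with values that do not tend to zero. As the losses
of probability may be prescribed, the level never drops below \<open>\<theta> / 2\<close>.\<close>

lemma not_many_large:
  assumes "0 < \<theta>"
  shows "\<not> many_large (space N) \<theta>"
proof
  assume many: "many_large (space N) \<theta>"
  define \<theta>\<^sub>0 where "\<theta>\<^sub>0 = \<theta> / 2"
  have \<theta>\<^sub>0: "0 < \<theta>\<^sub>0" "\<theta>\<^sub>0 < \<theta>" using assms unfolding \<theta>\<^sub>0_def by auto
  let ?P = "\<lambda>(_::nat) x. fst x \<in> sets N \<and> many_large (fst x) (snd x) \<and> \<theta>\<^sub>0 < snd x"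
  let ?Q = "\<lambda>(_::nat) x y. fst y \<subseteq> fst x \<and> (\<exists>B. B \<in> sets N \<and> B \<subseteq> fst x - fst y \<and>
      \<theta>\<^sub>0 / 8 \<le> prob {w \<in> space M. 1 < \<bar>\<mu> B w\<bar>})"
  have "\<exists>f. \<forall>n. ?P n (f n) \<and> ?Q n (f n) (f (Suc n))"
  proof (rule dependent_nat_choice)
    show "\<exists>x. ?P 0 x"
      using many \<theta>\<^sub>0 by (intro exI[of _ "(space N, \<theta>)"]) simp
    fix x n assume x: "?P n x"
    then obtain E' B \<theta>' where "E' \<in> sets N" "E' \<subseteq> fst x" "many_large E' \<theta>'" "\<theta>\<^sub>0 < \<theta>'"
        "B \<in> sets N" "B \<subseteq> fst x - E'" "\<theta>\<^sub>0 / 8 \<le> prob {w \<in> space M. 1 < \<bar>\<mu> B w\<bar>}"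
      using many_large_step[of "fst x" "snd x" \<theta>\<^sub>0] \<theta>\<^sub>0(1) by blast
    then show "\<exists>y. ?P (Suc n) y \<and> ?Q n x y"
      by (intro exI[of _ "(E', \<theta>')"]) auto
  qed
  then obtain f where "\<forall>n. ?P n (f n) \<and> ?Q n (f n) (f (Suc n))" by (elim exE)
  then have f: "?Q n (f n) (f (Suc n))" for n by (elim allE[of _ n] conjE) (intro conjI)
  then have "\<forall>n. \<exists>B. B \<in> sets N \<and> B \<subseteq> fst (f n) - fst (f (Suc n)) \<and>
      \<theta>\<^sub>0 / 8 \<le> prob {w \<in> space M. 1 < \<bar>\<mu> B w\<bar>}" by blast
  then obtain B where B: "\<And>n. B n \<in> sets N" "\<And>n. B n \<subseteq> fst (f n) - fst (f (Suc n))"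
    "\<And>n. \<theta>\<^sub>0 / 8 \<le> prob {w \<in> space M. 1 < \<bar>\<mu> (B n) w\<bar>}" by metis
  have dec: "decseq (\<lambda>n. fst (f n))" using f by (intro decseq_SucI) blast
  have disj: "B i \<inter> B j = {}" if "i < j" for i j
  proof -
    have "fst (f j) \<subseteq> fst (f (Suc i))" using decseqD[OF dec, of "Suc i" j] that by simp
    then show ?thesis using B(2)[of i] B(2)[of j] by blast
  qed
  have "disjoint_family B"
    unfolding disjoint_family_on_def
  proof (intro ballI impI)
    fix i j :: nat assume "i \<noteq> j"
    then show "B i \<inter> B j = {}" using disj[of i j] disj[of j i] by (cases "i < j") auto
  qed
  then have "(\<lambda>n. prob {w \<in> space M. 1 < \<bar>\<mu> (B n) w\<bar>}) \<longlonglongrightarrow> 0"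
    using B(1) by (intro exhaustive) auto
  then have "\<theta>\<^sub>0 / 8 \<le> 0"
    using B(3) by (intro LIMSEQ_le_const) auto
  then show False using \<theta>\<^sub>0 by simp
qed

text \<open>The theorem of Talagrand and of Kalton, Peck and Roberts.\<close>

lemma range_bounded:
  assumes "0 < \<eta>"
  shows "\<exists>R. \<forall>A\<in>sets N. prob {w \<in> space M. R < \<bar>\<mu> A w\<bar>} \<le> \<eta>"
proof (rule ccontr)
  assume "\<not> ?thesis"
  then have "\<exists>A\<in>sets N. \<eta> < prob {w \<in> space M. R < \<bar>\<mu> A w\<bar>}" for R
    by (simp add: not_le)
  then have "many_large (space N) (\<eta> / 4)"
    by (rule unbounded_imp_many_large[OF assms])
  then show False using not_many_large[of "\<eta> / 4"] assms by simp
qed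

text \<open>Fubini for finitely many weighted events: if each outcome in \<open>E\<close> belongs to events of total weight
\<open>q\<close>, and all these events have probability at most \<open>\<eta>\<close>, then \<open>E\<close> is improbable as well.\<close>

lemma prob_le_of_average:
  assumes K: "finite K" and W: "\<And>k. k \<in> K \<Longrightarrow> 0 \<le> W k"
    and A: "\<And>k. k \<in> K \<Longrightarrow> A k \<in> events" "\<And>k. k \<in> K \<Longrightarrow> prob (A k) \<le> \<eta>"
    and E: "E \<in> events" and le: "AE w in M. w \<in> E \<longrightarrow> q \<le> (\<Sum>k\<in>{k\<in>K. w \<in> A k}. W k)"
  shows "q * prob E \<le> (\<Sum>k\<in>K. W k) * \<eta>"
proof -
  have ind: "integrable M (indicat_real B)" if "B \<in> events" for B
    using that by (intro integrable_real_indicator) (simp_all add: less_top[symmetric])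
  have "q * prob E = expectation (\<lambda>w. q * indicator E w)"
    using E by simp
  also have "\<dots> \<le> expectation (\<lambda>w. \<Sum>k\<in>K. W k * indicator (A k) w)"
  proof (rule integral_mono_AE)
    show "integrable M (\<lambda>w. q * indicator E w)" by (intro integrable_mult_right ind E)
    show "integrable M (\<lambda>w. \<Sum>k\<in>K. W k * indicat_real (A k) w)"
      by (intro Bochner_Integration.integrable_sum integrable_mult_right ind A)
    show "AE w in M. q * indicator E w \<le> (\<Sum>k\<in>K. W k * indicator (A k) w)"
      using le
    proof eventually_elim
      case (elim w)
      have "(\<Sum>k\<in>K. W k * indicator (A k) w) = (\<Sum>k\<in>{k\<in>K. w \<in> A k}. W k)"
        using K by (intro sum.mono_neutral_cong_right) auto
      moreover have "0 \<le> (\<Sum>k\<in>{k\<in>K. w \<in> A k}. W k)" using W by (intro sum_nonneg) auto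
      ultimately show ?case using elim by (cases "w \<in> E") simp_all
    qed
  qed
  also have "\<dots> = (\<Sum>k\<in>K. W k * prob (A k))"
    using ind A by (simp add: Bochner_Integration.integral_sum)
  also have "\<dots> \<le> (\<Sum>k\<in>K. W k * \<eta>)"
    using W A(2) by (intro sum_mono mult_left_mono) auto
  finally show ?thesis by (simp add: sum_distrib_right)
qed

section \<open>Integrals of uniformly bounded simple functions\<close>

lemma measurable_value_sum:
  assumes "\<And>b. b \<in> P \<Longrightarrow> f b \<in> sets N"
  shows "(\<lambda>w. \<Sum>b\<in>P. a b * \<mu> (f b) w) \<in> borel_measurable M"
  using assms by (intro borel_measurable_sum borel_measurable_times borel_measurable_const measurable_value)

lemma events_value_sum_gt:
  assumes "\<And>b. b \<in> P \<Longrightarrow> f b \<in> sets N"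
  shows "{w \<in> space M. R < \<bar>\<Sum>b\<in>P. a b * \<mu> (f b) w\<bar>} \<in> events"
  using measurable_value_sum[OF assms] by measurable

lemma range_bounded_pos:
  assumes "0 < \<eta>"
  shows "\<exists>R>0. \<forall>A\<in>sets N. prob {w \<in> space M. R < \<bar>\<mu> A w\<bar>} \<le> \<eta>"
proof -
  obtain R where R: "\<And>A. A \<in> sets N \<Longrightarrow> prob {w \<in> space M. R < \<bar>\<mu> A w\<bar>} \<le> \<eta>"
    using range_bounded[OF assms] by blast
  have "prob {w \<in> space M. max R 1 < \<bar>\<mu> A w\<bar>} \<le> \<eta>" if "A \<in> sets N" for A
  proof (rule order_trans[OF _ R[OF that]])
    show "prob {w \<in> space M. max R 1 < \<bar>\<mu> A w\<bar>} \<le> prob {w \<in> space M. R < \<bar>\<mu> A w\<bar>}"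
      using events_value_gt[OF that] by (intro finite_measure_mono) auto
  qed
  then show ?thesis by (intro exI[of _ "max R 1"]) auto
qed

lemma prob_abs_diff_gt:
  fixes X Y :: "'w \<Rightarrow> real"
  assumes [measurable]: "X \<in> borel_measurable M" "Y \<in> borel_measurable M"
  shows "prob {w \<in> space M. 2 * R < \<bar>X w - Y w\<bar>} \<le>
    prob {w \<in> space M. R < \<bar>X w\<bar>} + prob {w \<in> space M. R < \<bar>Y w\<bar>}"
proof -
  have "prob {w \<in> space M. 2 * R < \<bar>X w - Y w\<bar>} \<le>
      prob ({w \<in> space M. R < \<bar>X w\<bar>} \<union> {w \<in> space M. R < \<bar>Y w\<bar>})"
    by (intro finite_measure_mono) auto
  also have "\<dots> \<le> prob {w \<in> space M. R < \<bar>X w\<bar>} + prob {w \<in> space M. R < \<bar>Y w\<bar>}"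
    by (intro measure_Un_le) measurable
  finally show ?thesis .
qed

text \<open>Sums of the values with signs are differences of two values of \<open>\<mu>\<close>, hence bounded in probability, uniformly in the signs. By
the Paley-Zygmund inequality, they are comparable to the square function for a fixed fraction of
the signs.\<close>

lemma square_function_bounded:
  assumes \<eta>: "0 < \<eta>"
  shows "\<exists>R>0. \<forall>P. finite P \<longrightarrow> P \<subseteq> sets N \<longrightarrow> disjoint P \<longrightarrow>
    prob {w \<in> space M. R\<^sup>2 < (\<Sum>b\<in>P. (\<mu> b w)\<^sup>2)} \<le> \<eta>"
proof -
  obtain R where R: "0 < R" and
    bnd: "\<And>A. A \<in> sets N \<Longrightarrow> prob {w \<in> space M. R < \<bar>\<mu> A w\<bar>} \<le> 3 / 32 * \<eta>"
    using range_bounded_pos[of "3 / 32 * \<eta>"] \<eta> by auto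
  have "prob {w \<in> space M. (4 * R)\<^sup>2 < (\<Sum>b\<in>P. (\<mu> b w)\<^sup>2)} \<le> \<eta>"
    if P: "finite P" "P \<subseteq> sets N" "disjoint P" for P
  proof -
    define x where "x w b = \<mu> b w" for w b
    define A where "A S = {w \<in> space M. 2 * R < \<bar>signed_sum P (x w) S\<bar>}" for S
    define E where "E = {w \<in> space M. (4 * R)\<^sup>2 < (\<Sum>b\<in>P. (x w b)\<^sup>2)}"
    have meas: "\<mu> b \<in> borel_measurable M" if "b \<in> P" for b
      using that P(2) by (intro measurable_value) blast
    have A: "A S \<in> events" for S
    proof -
      have [measurable]: "(\<lambda>w. signed_sum P (x w) S) \<in> borel_measurable M"
        unfolding signed_sum_def x_def
      proof (intro borel_measurable_sum)
        fix b assume "b \<in> P"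
        note [measurable] = meas[OF this]
        show "(\<lambda>w. if b \<in> S then \<mu> b w else - \<mu> b w) \<in> borel_measurable M" by measurable
      qed
      show ?thesis unfolding A_def by measurable
    qed
    have E: "E \<in> events"
    proof -
      have [measurable]: "(\<lambda>w. \<Sum>b\<in>P. (x w b)\<^sup>2) \<in> borel_measurable M"
        unfolding x_def by (intro borel_measurable_sum borel_measurable_power meas)
      show ?thesis unfolding E_def by measurable
    qed
    have pA: "prob (A S) \<le> 3 / 16 * \<eta>" if S: "S \<in> Pow P" for S
    proof -
      have sub: "S \<subseteq> P" "P - S \<subseteq> P" "finite S" "finite (P - S)"
        using S P(1) by (auto intro: finite_subset)
      have sets: "\<Union>S \<in> sets N" "\<Union>(P - S) \<in> sets N"
        using sub P(2) by (auto intro!: sets.finite_Union)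
      note [measurable] = measurable_value[OF sets(1)] measurable_value[OF sets(2)]
      have "AE w in M. \<mu> (\<Union>S) w = (\<Sum>b\<in>S. \<mu> b w)" "AE w in M. \<mu> (\<Union>(P - S)) w = (\<Sum>b\<in>P - S. \<mu> b w)"
        using sub P(2,3) by (auto intro!: value_Union_disjoint intro: pairwise_subset)
      then have AE: "AE w in M. w \<in> A S \<longleftrightarrow> w \<in> {w \<in> space M. 2 * R < \<bar>\<mu> (\<Union>S) w - \<mu> (\<Union>(P - S)) w\<bar>}"
      proof eventually_elim
        case (elim w)
        have "signed_sum P (x w) S = (\<Sum>b\<in>S. \<mu> b w) - (\<Sum>b\<in>P - S. \<mu> b w)"
        proof -
          have "signed_sum P (x w) S = (\<Sum>b\<in>P \<inter> S. x w b) + (\<Sum>b\<in>P \<inter> - S. - x w b)"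
            unfolding signed_sum_def using P(1) by (simp add: sum.If_cases)
          moreover have "P \<inter> S = S" "P \<inter> - S = P - S" using sub(1) by auto
          ultimately show ?thesis by (simp add: sum_negf x_def)
        qed
        then show ?case using elim unfolding A_def by simp
      qed
      have "prob (A S) = prob {w \<in> space M. 2 * R < \<bar>\<mu> (\<Union>S) w - \<mu> (\<Union>(P - S)) w\<bar>}"
        by (rule finite_measure_eq_AE[OF AE A]) measurable
      also have "\<dots> \<le> prob {w \<in> space M. R < \<bar>\<mu> (\<Union>S) w\<bar>} + prob {w \<in> space M. R < \<bar>\<mu> (\<Union>(P - S)) w\<bar>}"
        by (rule prob_abs_diff_gt) measurable
      finally show ?thesis using bnd[OF sets(1)] bnd[OF sets(2)] by linarith
    qed
    have "3 / 16 * 2 ^ card P * prob E \<le> (\<Sum>S\<in>Pow P. 1) * (3 / 16 * \<eta>)"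
    proof (rule prob_le_of_average)
      show "AE w in M. w \<in> E \<longrightarrow> 3 / 16 * 2 ^ card P \<le> (\<Sum>S\<in>{S\<in>Pow P. w \<in> A S}. 1::real)"
      proof (rule AE_I2, rule impI)
        fix w assume w: "w \<in> E"
        let ?q = "\<Sum>b\<in>P. (x w b)\<^sup>2"
        have "{S \<in> Pow P. ?q / 4 \<le> (signed_sum P (x w) S)\<^sup>2} \<subseteq> {S\<in>Pow P. w \<in> A S}"
        proof
          fix S assume S: "S \<in> {S \<in> Pow P. ?q / 4 \<le> (signed_sum P (x w) S)\<^sup>2}"
          then have "(2 * R)\<^sup>2 < (signed_sum P (x w) S)\<^sup>2"
            using w unfolding E_def by (simp add: power_mult_distrib)
          then have "\<bar>2 * R\<bar> < \<bar>signed_sum P (x w) S\<bar>"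
            by (simp only: not_le[symmetric] abs_le_square_iff not_False_eq_True)
          then show "S \<in> {S\<in>Pow P. w \<in> A S}"
            using S w R unfolding A_def E_def by auto
        qed
        then have "card {S \<in> Pow P. ?q / 4 \<le> (signed_sum P (x w) S)\<^sup>2} \<le> card {S\<in>Pow P. w \<in> A S}"
          using P(1) by (intro card_mono) auto
        then show "3 / 16 * 2 ^ card P \<le> (\<Sum>S\<in>{S\<in>Pow P. w \<in> A S}. 1::real)"
          using signed_sum_Paley_Zygmund[OF P(1), of "x w"] by simp
      qed
    qed (use P(1) A E pA in auto)
    then have "2 ^ card P * prob E \<le> 2 ^ card P * \<eta>"
      using P(1) by (simp add: card_Pow)
    then show ?thesis unfolding E_def x_def by simp
  qed
  then show ?thesis using R by (intro exI[of _ "4 * R"]) simp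
qed

text \<open>Where the square function is bounded, a large weighted sum entails that most of the values on
randomly selected unions are large.\<close>

lemma unit_interval_multipliers_bounded:
  assumes \<eta>: "0 < \<eta>"
  shows "\<exists>R>0. \<forall>P a. finite P \<longrightarrow> P \<subseteq> sets N \<longrightarrow> disjoint P \<longrightarrow> (\<forall>b\<in>P. 0 \<le> a b \<and> a b \<le> 1) \<longrightarrow>
    prob {w \<in> space M. R < \<bar>\<Sum>b\<in>P. a b * \<mu> b w\<bar>} \<le> \<eta>"
proof -
  obtain R where R: "0 < R" and
    bnd: "\<And>A. A \<in> sets N \<Longrightarrow> prob {w \<in> space M. R < \<bar>\<mu> A w\<bar>} \<le> 3 / 8 * \<eta>"
    using range_bounded_pos[of "3 / 8 * \<eta>"] \<eta> by auto
  obtain r where r: "0 < r" and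
    sq: "\<And>P. finite P \<Longrightarrow> P \<subseteq> sets N \<Longrightarrow> disjoint P \<Longrightarrow>
      prob {w \<in> space M. r\<^sup>2 < (\<Sum>b\<in>P. (\<mu> b w)\<^sup>2)} \<le> \<eta> / 2"
    using square_function_bounded[of "\<eta> / 2"] \<eta> by auto
  have "prob {w \<in> space M. R + r < \<bar>\<Sum>b\<in>P. a b * \<mu> b w\<bar>} \<le> \<eta>"
    if P: "finite P" "P \<subseteq> sets N" "disjoint P" and a: "\<forall>b\<in>P. 0 \<le> a b \<and> a b \<le> 1" for P a
  proof -
    have meas: "\<mu> b \<in> borel_measurable M" if "b \<in> P" for b
      using that P(2) by (intro measurable_value) blast
    have [measurable]: "(\<lambda>w. \<Sum>b\<in>P. (\<mu> b w)\<^sup>2) \<in> borel_measurable M"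
      "(\<lambda>w. \<Sum>b\<in>P. a b * \<mu> b w) \<in> borel_measurable M"
      by (intro borel_measurable_sum borel_measurable_power borel_measurable_times
          borel_measurable_const meas; assumption)+
    define E where "E = {w \<in> space M. (\<Sum>b\<in>P. (\<mu> b w)\<^sup>2) \<le> r\<^sup>2 \<and> R + r < \<bar>\<Sum>b\<in>P. a b * \<mu> b w\<bar>}"
    have E: "E \<in> events" unfolding E_def by measurable
    have F: "{w \<in> space M. r\<^sup>2 < (\<Sum>b\<in>P. (\<mu> b w)\<^sup>2)} \<in> events" by measurable
    define A where "A S = {w \<in> space M. R < \<bar>\<mu> (\<Union>S) w\<bar>}" for S
    have sets: "\<Union>S \<in> sets N" "finite S" if "S \<in> Pow P" for S
      using that P(1,2) by (auto intro!: sets.finite_Union intro: finite_subset)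
    have "3 / 4 * prob E \<le> (\<Sum>S\<in>Pow P. selection_weight P a S) * (3 / 8 * \<eta>)"
    proof (rule prob_le_of_average)
      show "finite (Pow P)" using P(1) by simp
      show "0 \<le> selection_weight P a S" for S using a by (intro selection_weight_nonneg) auto
      show "A S \<in> events" "prob (A S) \<le> 3 / 8 * \<eta>" if "S \<in> Pow P" for S
        using sets(1)[OF that] bnd events_value_gt unfolding A_def by auto
      show "E \<in> events" by fact
      have "AE w in M. \<forall>S\<in>Pow P. \<mu> (\<Union>S) w = (\<Sum>b\<in>S. \<mu> b w)"
      proof (rule AE_finite_allI)
        fix S assume S: "S \<in> Pow P"
        show "AE w in M. \<mu> (\<Union>S) w = (\<Sum>b\<in>S. \<mu> b w)"
          using S P(2,3) sets(2)[OF S] by (intro value_Union_disjoint) (auto intro: pairwise_subset)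
      qed (use P(1) in simp)
      then show "AE w in M. w \<in> E \<longrightarrow> 3 / 4 \<le> (\<Sum>S\<in>{S\<in>Pow P. w \<in> A S}. selection_weight P a S)"
      proof eventually_elim
        case (elim w)
        show ?case
        proof
          assume w: "w \<in> E"
          have "3 / 4 \<le> (\<Sum>S\<in>{S\<in>Pow P. R < \<bar>\<Sum>b\<in>S. \<mu> b w\<bar>}. selection_weight P a S)"
            using w a r unfolding E_def by (intro random_selection_Chebyshev[OF P(1)]) auto
          also have "{S\<in>Pow P. R < \<bar>\<Sum>b\<in>S. \<mu> b w\<bar>} = {S\<in>Pow P. w \<in> A S}"
            using elim w unfolding A_def E_def by (intro Collect_cong) auto
          finally show "3 / 4 \<le> (\<Sum>S\<in>{S\<in>Pow P. w \<in> A S}. selection_weight P a S)" .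
        qed
      qed
    qed
    then have pE: "prob E \<le> \<eta> / 2"
      using selection_weight_moments(1)[OF P(1), of a] by simp
    have "prob {w \<in> space M. R + r < \<bar>\<Sum>b\<in>P. a b * \<mu> b w\<bar>} \<le>
        prob (E \<union> {w \<in> space M. r\<^sup>2 < (\<Sum>b\<in>P. (\<mu> b w)\<^sup>2)})"
      using E by (intro finite_measure_mono) (auto simp: E_def)
    also have "\<dots> \<le> prob E + prob {w \<in> space M. r\<^sup>2 < (\<Sum>b\<in>P. (\<mu> b w)\<^sup>2)}"
      by (intro measure_Un_le E F)
    finally show ?thesis using pE sq[OF P] by linarith
  qed
  then show ?thesis using R r by (intro exI[of _ "R + r"]) simp
qed

lemma bounded_multipliers_bounded:
  assumes \<eta>: "0 < \<eta>"
  shows "\<exists>R>0. \<forall>P a. finite P \<longrightarrow> P \<subseteq> sets N \<longrightarrow> disjoint P \<longrightarrow> (\<forall>b\<in>P. \<bar>a b\<bar> \<le> 1) \<longrightarrow>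
    prob {w \<in> space M. R < \<bar>\<Sum>b\<in>P. a b * \<mu> b w\<bar>} \<le> \<eta>"
proof -
  obtain R where R: "0 < R" and
    bnd: "\<And>P a. finite P \<Longrightarrow> P \<subseteq> sets N \<Longrightarrow> disjoint P \<Longrightarrow> \<forall>b\<in>P. 0 \<le> a b \<and> a b \<le> 1 \<Longrightarrow>
      prob {w \<in> space M. R < \<bar>\<Sum>b\<in>P. a b * \<mu> b w\<bar>} \<le> \<eta> / 2"
    using unit_interval_multipliers_bounded[of "\<eta> / 2"] \<eta> by auto
  have "prob {w \<in> space M. 2 * R < \<bar>\<Sum>b\<in>P. a b * \<mu> b w\<bar>} \<le> \<eta>"
    if P: "finite P" "P \<subseteq> sets N" "disjoint P" and a: "\<forall>b\<in>P. \<bar>a b\<bar> \<le> 1" for P a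
  proof -
    let ?X = "\<lambda>w. \<Sum>b\<in>P. max (a b) 0 * \<mu> b w" and ?Y = "\<lambda>w. \<Sum>b\<in>P. max (- a b) 0 * \<mu> b w"
    have "(\<Sum>b\<in>P. a b * \<mu> b w) = ?X w - ?Y w" for w
      unfolding sum_subtractf[symmetric] by (intro sum.cong) (auto simp: max_def)
    moreover have "prob {w \<in> space M. 2 * R < \<bar>?X w - ?Y w\<bar>} \<le>
        prob {w \<in> space M. R < \<bar>?X w\<bar>} + prob {w \<in> space M. R < \<bar>?Y w\<bar>}"
      using P(2) by (intro prob_abs_diff_gt measurable_value_sum) auto
    moreover have "prob {w \<in> space M. R < \<bar>?X w\<bar>} \<le> \<eta> / 2"
      using a by (intro bnd P) auto
    moreover have "prob {w \<in> space M. R < \<bar>?Y w\<bar>} \<le> \<eta> / 2"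
      using a by (intro bnd P) auto
    ultimately show ?thesis by simp
  qed
  then show ?thesis using R by (intro exI[of _ "2 * R"]) simp
qed

section \<open>Square sums over families of overlapping sets\<close>

text \<open>The sum is the integral of \<open>\<Sum>j\<in>J. b j * indicator (A j)\<close>. Written over the atoms of the
algebra generated by the \<open>A j\<close>, it is a sum over disjoint sets with multipliers bounded by \<open>s\<close>.\<close>

lemma dominated_simple_integrals_bounded:
  fixes A :: "'j \<Rightarrow> 'x set"
  assumes \<eta>: "0 < \<eta>"
  shows "\<exists>R>0. \<forall>(J::'j set) A b s. finite J \<longrightarrow> (\<forall>j\<in>J. A j \<in> sets N) \<longrightarrow> 0 < s \<longrightarrow>
    (\<forall>x\<in>space N. \<bar>\<Sum>j\<in>{j\<in>J. x \<in> A j}. b j\<bar> \<le> s) \<longrightarrow>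
    prob {w \<in> space M. s * R < \<bar>\<Sum>j\<in>J. b j * \<mu> (A j) w\<bar>} \<le> \<eta>"
proof -
  obtain R where R: "0 < R" and
    bnd: "\<And>P a. finite P \<Longrightarrow> P \<subseteq> sets N \<Longrightarrow> disjoint P \<Longrightarrow> \<forall>b\<in>P. \<bar>a b\<bar> \<le> 1 \<Longrightarrow>
      prob {w \<in> space M. R < \<bar>\<Sum>b\<in>P. a b * \<mu> b w\<bar>} \<le> \<eta>"
    using bounded_multipliers_bounded[OF \<eta>] by blast
  have "prob {w \<in> space M. s * R < \<bar>\<Sum>j\<in>J. b j * \<mu> (A j) w\<bar>} \<le> \<eta>"
    if J: "finite J" and A: "\<forall>j\<in>J. A j \<in> sets N" and s: "0 < s"
      and dom: "\<forall>x\<in>space N. \<bar>\<Sum>j\<in>{j\<in>J. x \<in> A j}. b j\<bar> \<le> s"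
    for J :: "'j set" and A b s
  proof -
    define atom where "atom T = {x \<in> space N. \<forall>j\<in>J. x \<in> A j \<longleftrightarrow> j \<in> T}" for T
    define P where "P = atom ` Pow J - {{}}"
    have in_atom: "x \<in> atom {j\<in>J. x \<in> A j}" if "x \<in> space N" for x
      using that unfolding atom_def by auto
    have atom_sub: "u \<subseteq> A j \<longleftrightarrow> x \<in> A j" if u: "u \<in> P" "x \<in> u" and j: "j \<in> J" for u x j
    proof -
      obtain T where "u = atom T" using u(1) unfolding P_def by blast
      then have "y \<in> A j \<longleftrightarrow> j \<in> T" if "y \<in> u" for y using that j unfolding atom_def by simp
      then show ?thesis using u(2) by blast
    qed
    have atom_sets: "atom T \<in> sets N" for T
    proof -
      have "atom T = space N - ((\<Union>j\<in>J \<inter> T. space N - A j) \<union> (\<Union>j\<in>J - T. A j))"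
        unfolding atom_def by blast
      moreover have "(\<Union>j\<in>J \<inter> T. space N - A j) \<in> sets N" "(\<Union>j\<in>J - T. A j) \<in> sets N"
        using J A by (intro sets.finite_UN; blast)+
      ultimately show ?thesis by (simp only: sets.Diff sets.Un sets.top)
    qed
    have P: "fin_partition P"
      unfolding fin_partition_def
    proof (intro conjI partition_onI)
      show "finite P" using J unfolding P_def by simp
      show "P \<subseteq> sets N" using atom_sets unfolding P_def by blast
      show "\<Union>P = space N"
      proof
        show "\<Union>P \<subseteq> space N" unfolding P_def atom_def by blast
        show "space N \<subseteq> \<Union>P"
        proof
          fix x assume "x \<in> space N"
          then have x: "x \<in> atom {j\<in>J. x \<in> A j}" by (rule in_atom)
          have "atom {j\<in>J. x \<in> A j} \<in> atom ` Pow J" by (rule imageI) simp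
          then have "atom {j\<in>J. x \<in> A j} \<in> P" using x unfolding P_def by auto
          with x show "x \<in> \<Union>P" by (rule UnionI[rotated])
        qed
      qed
      show "disjnt p q" if pq: "p \<in> P" "q \<in> P" "p \<noteq> q" for p q
      proof (rule ccontr)
        assume "\<not> disjnt p q"
        then obtain x where x: "x \<in> p" "x \<in> q" unfolding disjnt_def by blast
        have "u = atom {j\<in>J. x \<in> A j}" if "u \<in> P" "x \<in> u" for u
        proof -
          obtain T where T: "T \<subseteq> J" "u = atom T" using \<open>u \<in> P\<close> unfolding P_def by blast
          then have "T = {j\<in>J. x \<in> A j}" using \<open>x \<in> u\<close> unfolding atom_def by auto
          then show ?thesis using T by simp
        qed
        then show False using pq x by metis
      qed
      show "{} \<notin> P" unfolding P_def by simp
    qed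
    then have P': "finite P" "P \<subseteq> sets N" "disjoint P"
      unfolding fin_partition_def partition_on_def by auto
    define a where "a u = (\<Sum>j\<in>{j\<in>J. u \<subseteq> A j}. b j) / s" for u
    have a1: "\<bar>a u\<bar> \<le> 1" if u: "u \<in> P" for u
    proof -
      obtain x where x: "x \<in> u" using u unfolding P_def by blast
      have "x \<in> space N" using x u P'(2) sets.sets_into_space by blast
      moreover have "{j\<in>J. u \<subseteq> A j} = {j\<in>J. x \<in> A j}" using atom_sub[OF u x] by blast
      ultimately show ?thesis using dom s unfolding a_def by (simp add: abs_divide)
    qed
    have "AE w in M. \<forall>j\<in>J. \<mu> (A j) w = (\<Sum>u\<in>{u\<in>P. u \<subseteq> A j}. \<mu> u w)"
    proof (intro AE_finite_allI J)
      fix j assume j: "j \<in> J"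
      show "AE w in M. \<mu> (A j) w = (\<Sum>u\<in>{u\<in>P. u \<subseteq> A j}. \<mu> u w)"
      proof (rule value_refinement[OF P])
        show "A j \<in> sets N" using A j by blast
        show "u \<subseteq> A j \<or> u \<inter> A j = {}" if u: "u \<in> P" for u
          using atom_sub[OF u _ j] by blast
      qed
    qed
    then have AE: "AE w in M. w \<in> {w \<in> space M. s * R < \<bar>\<Sum>j\<in>J. b j * \<mu> (A j) w\<bar>} \<longleftrightarrow>
        w \<in> {w \<in> space M. R < \<bar>\<Sum>u\<in>P. a u * \<mu> u w\<bar>}"
    proof eventually_elim
      case (elim w)
      have "(\<Sum>j\<in>J. b j * \<mu> (A j) w) = (\<Sum>j\<in>J. \<Sum>u\<in>P. if u \<subseteq> A j then b j * \<mu> u w else 0)"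
      proof (intro sum.cong refl)
        fix j assume "j \<in> J"
        then have "b j * \<mu> (A j) w = (\<Sum>u\<in>{u\<in>P. u \<subseteq> A j}. b j * \<mu> u w)"
          using elim by (simp add: sum_distrib_left)
        also have "\<dots> = (\<Sum>u\<in>P. if u \<subseteq> A j then b j * \<mu> u w else 0)"
          using P'(1) by (intro sum.inter_filter)
        finally show "b j * \<mu> (A j) w = (\<Sum>u\<in>P. if u \<subseteq> A j then b j * \<mu> u w else 0)" .
      qed
      also have "\<dots> = (\<Sum>u\<in>P. \<Sum>j\<in>J. if u \<subseteq> A j then b j * \<mu> u w else 0)"
        by (rule sum.swap)
      also have "\<dots> = (\<Sum>u\<in>P. s * (a u * \<mu> u w))"
      proof (intro sum.cong refl)
        fix u
        have "(\<Sum>j\<in>J. if u \<subseteq> A j then b j * \<mu> u w else 0) = (\<Sum>j\<in>{j\<in>J. u \<subseteq> A j}. b j * \<mu> u w)"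
          using J by (intro sum.inter_filter[symmetric])
        also have "\<dots> = (\<Sum>j\<in>{j\<in>J. u \<subseteq> A j}. b j) * \<mu> u w"
          by (rule sum_distrib_right[symmetric])
        also have "\<dots> = s * (a u * \<mu> u w)"
          using s unfolding a_def by simp
        finally show "(\<Sum>j\<in>J. if u \<subseteq> A j then b j * \<mu> u w else 0) = s * (a u * \<mu> u w)" .
      qed
      also have "\<dots> = s * (\<Sum>u\<in>P. a u * \<mu> u w)"
        by (rule sum_distrib_left[symmetric])
      finally have "\<bar>\<Sum>j\<in>J. b j * \<mu> (A j) w\<bar> = s * \<bar>\<Sum>u\<in>P. a u * \<mu> u w\<bar>"
        using s by (simp add: abs_mult)
      then show ?case using s by simp
    qed
    have "prob {w \<in> space M. s * R < \<bar>\<Sum>j\<in>J. b j * \<mu> (A j) w\<bar>} =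
        prob {w \<in> space M. R < \<bar>\<Sum>u\<in>P. a u * \<mu> u w\<bar>}"
      using A P'(2) by (intro finite_measure_eq_AE[OF AE] events_value_sum_gt) auto
    also have "\<dots> \<le> \<eta>" using a1 by (intro bnd P') auto
    finally show ?thesis .
  qed
  then show ?thesis using R by (intro exI[of _ R]) blast
qed

text \<open>Monotonicity in \<open>n\<close> makes the difference between boundedness in probability of each partial sum
and of their supremum disappear.\<close>

lemma AE_summable_if_partial_sums_bounded:
  fixes T :: "nat \<Rightarrow> 'w \<Rightarrow> real"
  assumes meas: "\<And>m. T m \<in> borel_measurable M" and nonneg: "\<And>m w. 0 \<le> T m w"
    and bnd: "\<And>\<eta>. 0 < \<eta> \<Longrightarrow> \<exists>R. \<forall>n. prob {w \<in> space M. R < (\<Sum>m<n. T m w)} \<le> \<eta>"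
  shows "AE w in M. summable (\<lambda>m. T m w)"
proof -
  define B where "B R n = {w \<in> space M. R < (\<Sum>m<n. T m w)}" for R n
  have B: "B R n \<in> events" for R n
  proof -
    have [measurable]: "(\<lambda>w. \<Sum>m<n. T m w) \<in> borel_measurable M"
      by (intro borel_measurable_sum meas)
    show ?thesis unfolding B_def by measurable
  qed
  have inc: "incseq (B R)" for R
  proof (rule incseq_SucI)
    fix n show "B R n \<le> B R (Suc n)"
      using nonneg unfolding B_def by (auto intro: less_le_trans)
  qed
  define Z where "Z = (\<Inter>k::nat. \<Union>n. B (real k) n)"
  have Z: "Z \<in> events" unfolding Z_def using B by (intro sets.countable_INT sets.countable_UN) auto
  have "prob Z \<le> \<eta>" if \<eta>: "0 < \<eta>" for \<eta>
  proof -
    obtain R where R: "\<And>n. prob (B R n) \<le> \<eta>" using bnd[OF \<eta>] unfolding B_def by blast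
    obtain k where k: "R < real k" using reals_Archimedean2 by blast
    have "prob Z \<le> prob (\<Union>n. B R n)"
    proof (rule finite_measure_mono)
      have "B (real k) n \<subseteq> B R n" for n
        using k unfolding B_def by (intro Collect_mono) auto
      then have "(\<Union>n. B (real k) n) \<subseteq> (\<Union>n. B R n)" by (intro UN_mono) auto
      moreover have "Z \<subseteq> (\<Union>n. B (real k) n)" unfolding Z_def by (rule INT_lower) simp
      ultimately show "Z \<subseteq> (\<Union>n. B R n)" by (rule order_trans[rotated])
    qed (use B in auto)
    moreover have "(\<lambda>n. prob (B R n)) \<longlonglongrightarrow> prob (\<Union>n. B R n)"
      using B inc by (intro finite_Lim_measure_incseq) auto
    then have "prob (\<Union>n. B R n) \<le> \<eta>"
      using R by (intro LIMSEQ_le_const2) auto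
    ultimately show ?thesis by linarith
  qed
  then have "prob Z \<le> 0" by (rule field_le_epsilon[of _ 0, simplified])
  then have "prob Z = 0" using measure_nonneg[of M Z] by linarith
  then have "AE w in M. w \<notin> Z" using prob_eq_0[OF Z] by simp
  then show ?thesis
    using AE_space
  proof eventually_elim
    case (elim w)
    then obtain k where "w \<notin> (\<Union>n. B (real k) n)" unfolding Z_def by blast
    then have "(\<Sum>m<n. T m w) \<le> real k" for n
      using elim(2) unfolding B_def by (simp add: not_less)
    then show ?case using nonneg by (intro summableI_nonneg_bounded)
  qed
qed

text \<open>A trace is the set of those \<open>A m i\<close> of level \<open>m\<close> that contain a given point. A sum of indicators with
signs depends on the point only through its trace, and its variance is the size of the trace. If there
are few traces (\<open>K\<close>), all of them small (\<open>v\<close>), then by Hoeffding's inequality and a union bound most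
signs keep the sum of level \<open>m\<close> below \<open>s m\<close> everywhere. The sum over all levels is then below
\<open>suminf s\<close>, and the boundedness of integrals of bounded functions applies.\<close>

lemma AE_summable_square_values:
  fixes J :: "nat \<Rightarrow> 'j set" and A :: "nat \<Rightarrow> 'j \<Rightarrow> 'x set" and c v s K :: "nat \<Rightarrow> real"
  assumes J: "\<And>m. finite (J m)" and A: "\<And>m i. i \<in> J m \<Longrightarrow> A m i \<in> sets N"
    and traces: "\<And>m. real (card ((\<lambda>x. {i\<in>J m. x \<in> A m i}) ` space N)) \<le> K m"
    and v: "\<And>m. 0 < v m" "\<And>m x. x \<in> space N \<Longrightarrow> (c m)\<^sup>2 * real (card {i\<in>J m. x \<in> A m i}) \<le> v m"
    and s: "\<And>m. 0 < s m" "summable s"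
    and tail: "\<And>m. K m * (2 * exp (- (s m)\<^sup>2 / (2 * v m))) \<le> (1 / 2) ^ (m + 4)"
  shows "AE w in M. summable (\<lambda>m. (c m)\<^sup>2 * (\<Sum>i\<in>J m. (\<mu> (A m i) w)\<^sup>2))"
proof (rule AE_summable_if_partial_sums_bounded)
  show meas: "(\<lambda>w. (c m)\<^sup>2 * (\<Sum>i\<in>J m. (\<mu> (A m i) w)\<^sup>2)) \<in> borel_measurable M" for m
    by (intro borel_measurable_sum borel_measurable_times borel_measurable_power borel_measurable_const
        measurable_value A)
  show "0 \<le> (c m)\<^sup>2 * (\<Sum>i\<in>J m. (\<mu> (A m i) w)\<^sup>2)" for m w
    by (intro mult_nonneg_nonneg sum_nonneg) auto
  fix \<eta> :: real assume \<eta>: "0 < \<eta>"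
  define S0 where "S0 = suminf s"
  have S0: "0 < S0" unfolding S0_def using s by (intro suminf_pos)
  obtain R where R: "0 < R" and
    bnd: "\<And>(I::(nat \<times> 'j) set) F b s. finite I \<Longrightarrow> \<forall>j\<in>I. F j \<in> sets N \<Longrightarrow> 0 < s \<Longrightarrow>
      \<forall>x\<in>space N. \<bar>\<Sum>j\<in>{j\<in>I. x \<in> F j}. b j\<bar> \<le> s \<Longrightarrow>
      prob {w \<in> space M. s * R < \<bar>\<Sum>j\<in>I. b j * \<mu> (F j) w\<bar>} \<le> \<eta> / 16"
    using dominated_simple_integrals_bounded[of "\<eta> / 16", where 'j="nat \<times> 'j"] \<eta> by auto
  have "prob {w \<in> space M. (2 * (S0 * R))\<^sup>2 < (\<Sum>m<n. (c m)\<^sup>2 * (\<Sum>i\<in>J m. (\<mu> (A m i) w)\<^sup>2))} \<le> \<eta>" for n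
  proof -
    define I where "I = (SIGMA m:{..<n}. J m)"
    define F where "F j = A (fst j) (snd j)" for j
    define sg where "sg S j = (if j \<in> S then c (fst j) else - c (fst j))" for S and j :: "nat \<times> 'j"
    define x where "x w j = c (fst j) * \<mu> (F j) w" for w j
    have finI: "finite I" unfolding I_def using J by auto
    have F: "F j \<in> sets N" if "j \<in> I" for j using that A unfolding F_def I_def by auto
    \<comment> \<open>The signs for which all levels stay within their bounds; all but one in eight belong to \<open>G\<close>,
      so \<open>G\<close> retains at least 1 out of the 3 sixteenths given by the Paley-Zygmund inequality.\<close>
    define G where "G = {S \<in> Pow I. \<forall>m<n. \<forall>y\<in>space N. \<bar>\<Sum>i\<in>{i\<in>J m. y \<in> A m i}. sg S (m, i)\<bar> \<le> s m}"
    have bad: "real (card (Pow I - G)) \<le> 2 ^ card I / 8"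
    proof -
      define tr where "tr m = (\<lambda>x. {i\<in>J m. x \<in> A m i}) ` space N" for m
      \<comment> \<open>The coefficients of the sum at a point with trace \<open>t\<close> on level \<open>m\<close>, extended by zero to all of \<open>I\<close>.\<close>
      define z where "z m t j = (if fst j = m \<and> snd j \<in> t then c m else 0)" for m t and j :: "nat \<times> 'j"
      define W where "W m t = {S \<in> Pow I. s m < \<bar>signed_sum I (z m t) S\<bar>}" for m t
      have fintr: "finite (tr m)" for m
        by (rule finite_subset[of _ "Pow (J m)"]) (use J in \<open>auto simp: tr_def\<close>)
      have zsum: "(\<Sum>j\<in>I. f (z m t j)) = real (card t) * f (c m)"
        if m: "m < n" and t: "t \<subseteq> J m" and f: "f 0 = 0" for m t and f :: "real \<Rightarrow> real"
      proof -
        have "(\<Sum>j\<in>I. f (z m t j)) = (\<Sum>j\<in>{m} \<times> t. f (z m t j))"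
          using finI m t f by (intro sum.mono_neutral_right) (auto simp: I_def z_def)
        also have "\<dots> = (\<Sum>j\<in>{m} \<times> t. f (c m))"
          by (intro sum.cong) (auto simp: z_def)
        finally show ?thesis by (simp add: card_cartesian_product_singleton)
      qed
      have sub: "Pow I - G \<subseteq> (\<Union>m<n. \<Union>t\<in>tr m. W m t)"
      proof
        fix S assume S: "S \<in> Pow I - G"
        then obtain m y where my: "m < n" "y \<in> space N" "s m < \<bar>\<Sum>i\<in>{i\<in>J m. y \<in> A m i}. sg S (m, i)\<bar>"
          unfolding G_def by (auto simp: not_le)
        define t where "t = {i\<in>J m. y \<in> A m i}"
        have "signed_sum I (z m t) S = (\<Sum>j\<in>{m} \<times> t. if j \<in> S then z m t j else - z m t j)"
          unfolding signed_sum_def using finI my(1)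
          by (intro sum.mono_neutral_right) (auto simp: I_def z_def t_def)
        also have "\<dots> = (\<Sum>j\<in>{m} \<times> t. sg S j)"
          by (intro sum.cong) (auto simp: z_def sg_def)
        also have "\<dots> = (\<Sum>i\<in>t. sg S (m, i))"
        proof -
          have "{m} \<times> t = Pair m ` t" by auto
          then show ?thesis by (simp add: sum.reindex inj_on_def)
        qed
        finally have "S \<in> W m t" using my(3) S unfolding W_def t_def by simp
        moreover have "t \<in> tr m" using my(2) unfolding tr_def t_def by blast
        ultimately show "S \<in> (\<Union>m<n. \<Union>t\<in>tr m. W m t)" using my(1) by blast
      qed
      have cW: "real (card (W m t)) \<le> 2 * exp (- (s m)\<^sup>2 / (2 * v m)) * 2 ^ card I"
        if m: "m < n" and t: "t \<in> tr m" for m t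
        unfolding W_def
      proof (rule signed_sum_Hoeffding[OF finI _ v(1)])
        show "0 \<le> s m" using s(1) less_imp_le by blast
        obtain y where y: "y \<in> space N" "t = {i\<in>J m. y \<in> A m i}" using t unfolding tr_def by blast
        have "(\<Sum>j\<in>I. (z m t j)\<^sup>2) = real (card t) * (c m)\<^sup>2"
          using zsum[OF m, of t "\<lambda>r. r\<^sup>2"] y(2) by auto
        then show "(\<Sum>j\<in>I. (z m t j)\<^sup>2) \<le> v m"
          using v(2)[OF y(1), of m] y(2) by (simp add: mult.commute)
      qed
      have finW: "finite (W m t)" for m t unfolding W_def using finI by simp
      have "card (Pow I - G) \<le> card (\<Union>m<n. \<Union>t\<in>tr m. W m t)"
        using sub fintr finW by (intro card_mono) auto
      also have "\<dots> \<le> (\<Sum>m<n. card (\<Union>t\<in>tr m. W m t))"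
        by (intro card_UN_le) simp
      also have "\<dots> \<le> (\<Sum>m<n. \<Sum>t\<in>tr m. card (W m t))"
        by (intro sum_mono card_UN_le fintr)
      finally have "real (card (Pow I - G)) \<le> real (\<Sum>m<n. \<Sum>t\<in>tr m. card (W m t))"
        by (simp only: of_nat_le_iff)
      also have "\<dots> = (\<Sum>m<n. \<Sum>t\<in>tr m. real (card (W m t)))"
        by (simp only: of_nat_sum)
      also have "\<dots> \<le> (\<Sum>m<n. \<Sum>t\<in>tr m. 2 * exp (- (s m)\<^sup>2 / (2 * v m)) * 2 ^ card I)"
        by (intro sum_mono cW) auto
      also have "\<dots> \<le> (\<Sum>m<n. (1 / 2) ^ (m + 4) * 2 ^ card I)"
      proof (rule sum_mono)
        fix m
        have "(\<Sum>t\<in>tr m. 2 * exp (- (s m)\<^sup>2 / (2 * v m)) * 2 ^ card I) =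
            (real (card (tr m)) * (2 * exp (- (s m)\<^sup>2 / (2 * v m)))) * 2 ^ card I"
          by simp
        also have "\<dots> \<le> (K m * (2 * exp (- (s m)\<^sup>2 / (2 * v m)))) * 2 ^ card I"
          using traces[of m] unfolding tr_def by (intro mult_right_mono) auto
        also have "\<dots> \<le> (1 / 2) ^ (m + 4) * 2 ^ card I"
          using tail[of m] by (intro mult_right_mono) auto
        finally show "(\<Sum>t\<in>tr m. 2 * exp (- (s m)\<^sup>2 / (2 * v m)) * 2 ^ card I) \<le> (1 / 2) ^ (m + 4) * 2 ^ card I" .
      qed
      also have "\<dots> = (\<Sum>m<n. (1 / 2) ^ m) * (2 ^ card I / 16)"
        unfolding sum_distrib_right by (intro sum.cong refl) (simp add: power_add eval_nat_numeral)
      also have "\<dots> \<le> 2 * (2 ^ card I / 16)"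
      proof (rule mult_right_mono)
        have "(\<Sum>m<n. (1 / 2 :: real) ^ m) = 2 - 2 * (1 / 2) ^ n"
          by (induction n) (simp_all add: field_simps)
        then show "(\<Sum>m<n. (1 / 2 :: real) ^ m) \<le> 2" by simp
      qed simp
      finally show ?thesis by simp
    qed
    define B where "B S = {w \<in> space M. S0 * R < \<bar>\<Sum>j\<in>I. sg S j * \<mu> (F j) w\<bar>}" for S
    define E where "E = {w \<in> space M. (2 * (S0 * R))\<^sup>2 < (\<Sum>m<n. (c m)\<^sup>2 * (\<Sum>i\<in>J m. (\<mu> (A m i) w)\<^sup>2))}"
    have pB: "prob (B S) \<le> \<eta> / 16" if S: "S \<in> G" for S
      unfolding B_def
    proof (rule bnd[OF finI _ S0])
      show "\<forall>j\<in>I. F j \<in> sets N" using F by blast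
      show "\<forall>y\<in>space N. \<bar>\<Sum>j\<in>{j\<in>I. y \<in> F j}. sg S j\<bar> \<le> S0"
      proof
        fix y assume y: "y \<in> space N"
        have "{j\<in>I. y \<in> F j} = (SIGMA m:{..<n}. {i\<in>J m. y \<in> A m i})"
          unfolding I_def F_def by auto
        then have "(\<Sum>j\<in>{j\<in>I. y \<in> F j}. sg S j) = (\<Sum>m<n. \<Sum>i\<in>{i\<in>J m. y \<in> A m i}. sg S (m, i))"
          using J by (simp add: sum.Sigma)
        also have "\<bar>\<dots>\<bar> \<le> (\<Sum>m<n. \<bar>\<Sum>i\<in>{i\<in>J m. y \<in> A m i}. sg S (m, i)\<bar>)"
          by (rule sum_abs)
        also have "\<dots> \<le> (\<Sum>m<n. s m)"
          using S y unfolding G_def by (intro sum_mono) auto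
        also have "\<dots> \<le> S0"
          unfolding S0_def using s less_imp_le by (intro sum_le_suminf) auto
        finally show "\<bar>\<Sum>j\<in>{j\<in>I. y \<in> F j}. sg S j\<bar> \<le> S0" .
      qed
    qed
    have q: "(\<Sum>m<n. (c m)\<^sup>2 * (\<Sum>i\<in>J m. (\<mu> (A m i) w)\<^sup>2)) = (\<Sum>j\<in>I. (x w j)\<^sup>2)" for w
      unfolding I_def x_def F_def using J
      by (simp add: sum.Sigma case_prod_unfold power_mult_distrib sum_distrib_left)
    have ss: "signed_sum I (x w) S = (\<Sum>j\<in>I. sg S j * \<mu> (F j) w)" for w S
      unfolding signed_sum_def x_def sg_def by (intro sum.cong) auto
    have "2 ^ card I / 16 * prob E \<le> (\<Sum>S\<in>G. 1) * (\<eta> / 16)"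
    proof (rule prob_le_of_average)
      show finG: "finite G" unfolding G_def using finI by simp
      show "B S \<in> events" for S unfolding B_def by (rule events_value_sum_gt) (rule F)
      show "E \<in> events"
      proof -
        have [measurable]: "(\<lambda>w. \<Sum>m<n. (c m)\<^sup>2 * (\<Sum>i\<in>J m. (\<mu> (A m i) w)\<^sup>2)) \<in> borel_measurable M"
          by (intro borel_measurable_sum meas)
        show ?thesis unfolding E_def by measurable
      qed
      show "AE w in M. w \<in> E \<longrightarrow> 2 ^ card I / 16 \<le> (\<Sum>S\<in>{S\<in>G. w \<in> B S}. 1::real)"
      proof (rule AE_I2, rule impI)
        fix w assume w: "w \<in> E"
        let ?H = "{S \<in> Pow I. (\<Sum>j\<in>I. (x w j)\<^sup>2) / 4 \<le> (signed_sum I (x w) S)\<^sup>2}"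
        have "?H \<subseteq> {S\<in>G. w \<in> B S} \<union> (Pow I - G)"
        proof
          fix S assume S: "S \<in> ?H"
          then have "(S0 * R)\<^sup>2 < (signed_sum I (x w) S)\<^sup>2"
            using w unfolding E_def q by (simp add: power_mult_distrib)
          then have "\<bar>S0 * R\<bar> < \<bar>signed_sum I (x w) S\<bar>"
            by (simp only: not_le[symmetric] abs_le_square_iff not_False_eq_True)
          then have "w \<in> B S" using w unfolding B_def E_def ss by simp
          then show "S \<in> {S\<in>G. w \<in> B S} \<union> (Pow I - G)" using S by blast
        qed
        then have "card ?H \<le> card ({S\<in>G. w \<in> B S} \<union> (Pow I - G))"
          using finI finG by (intro card_mono) auto
        also have "\<dots> \<le> card {S\<in>G. w \<in> B S} + card (Pow I - G)" by (rule card_Un_le)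
        finally have "real (card ?H) \<le> real (card {S\<in>G. w \<in> B S}) + real (card (Pow I - G))"
          by (simp only: of_nat_add[symmetric] of_nat_le_iff)
        then show "2 ^ card I / 16 \<le> (\<Sum>S\<in>{S\<in>G. w \<in> B S}. 1::real)"
          using signed_sum_Paley_Zygmund[OF finI, of "x w"] bad by simp
      qed
    qed (use pB in auto)
    also have "\<dots> \<le> 2 ^ card I * (\<eta> / 16)"
    proof (rule mult_right_mono)
      have "card G \<le> card (Pow I)" using finI unfolding G_def by (intro card_mono) auto
      then have "real (card G) \<le> real (2 ^ card I)" using finI by (simp only: card_Pow of_nat_le_iff)
      then show "(\<Sum>S\<in>G. 1) \<le> (2 ^ card I :: real)" by simp
    qed (use \<eta> in simp)
    finally have "prob E \<le> \<eta>" by simp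
    then show ?thesis unfolding E_def .
  qed
  then show "\<exists>R. \<forall>n. prob {w \<in> space M. R < (\<Sum>m<n. (c m)\<^sup>2 * (\<Sum>i\<in>J m. (\<mu> (A m i) w)\<^sup>2))} \<le> \<eta>"
    by blast
qed

end

section \<open>Chaining along the dyadic grid\<close>

definition grid :: "nat \<Rightarrow> ('n::finite \<Rightarrow> nat) set" where
  "grid m = {k. \<forall>j. k j \<le> 2 ^ m}"

definition grid_point :: "nat \<Rightarrow> ('n::finite \<Rightarrow> nat) \<Rightarrow> real^'n" where
  "grid_point m k = (\<chi> j. real (k j) / 2 ^ m)"

definition step_up :: "'n \<Rightarrow> ('n \<Rightarrow> nat) \<Rightarrow> 'n \<Rightarrow> nat" where
  "step_up i k = k(i := Suc (k i))"

definition edges :: "nat \<Rightarrow> 'n \<Rightarrow> ('n::finite \<Rightarrow> nat) set" where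
  "edges m i = {k \<in> grid m. k i < 2 ^ m}"

text \<open>The grid points of level \<open>m\<close> are indexed by \<open>k\<close>; an edge is given by its direction \<open>i\<close> and its lower
end \<open>k\<close>.\<close>

definition increment :: "(real^'n \<Rightarrow> real) \<Rightarrow> nat \<Rightarrow> 'n::finite \<Rightarrow> ('n \<Rightarrow> nat) \<Rightarrow> real" where
  "increment f m i k = f (grid_point m (step_up i k)) - f (grid_point m k)"

definition close_to :: "nat \<Rightarrow> real^'n \<Rightarrow> ('n::finite \<Rightarrow> nat) \<Rightarrow> bool" where
  "close_to m x k \<longleftrightarrow> (\<forall>j. \<bar>real (k j) - 2 ^ m * x $ j\<bar> \<le> 2)"

text \<open>Bounds all differences of \<open>f\<close> between grid points in the vicinity of \<open>x\<close>. It is a sum over edges rather than a supremum so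
that its \<open>p\<close>-th power is easy to integrate over \<open>x\<close>. The radius of 2 meshes in \<open>close_to\<close> leaves room for
the rounding of \<open>x\<close> and for one further step.\<close>

definition oscillation :: "(real^'n \<Rightarrow> real) \<Rightarrow> nat \<Rightarrow> real^'n::finite \<Rightarrow> real" where
  "oscillation f m x = (\<Sum>i\<in>UNIV. \<Sum>k\<in>{k\<in>edges m i. close_to m x k}. \<bar>increment f m i k\<bar>)"

definition cell :: "nat \<Rightarrow> real^'n \<Rightarrow> 'n::finite \<Rightarrow> nat" where
  "cell m x = (\<lambda>j. nat \<lfloor>2 ^ m * x $ j\<rfloor>)"

lemma grid_eq_PiE: "(grid m :: ('n::finite \<Rightarrow> nat) set) = (UNIV \<rightarrow>\<^sub>E {..2 ^ m})"
  unfolding grid_def by (auto simp: PiE_iff)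

lemma finite_grid: "finite (grid m :: ('n::finite \<Rightarrow> nat) set)"
  unfolding grid_eq_PiE by (intro finite_PiE) auto

lemma card_grid: "card (grid m :: ('n::finite \<Rightarrow> nat) set) = (2 ^ m + 1) ^ CARD('n)"
  unfolding grid_eq_PiE by (simp add: card_PiE)

lemma finite_edges: "finite (edges m i)"
  unfolding edges_def by (rule finite_subset[OF _ finite_grid]) auto

text \<open>One walks from \<open>k\<close> to \<open>k'\<close> by changing one coordinate after the other; each change is a step along
one edge or none.\<close>

lemma grid_path:
  fixes g :: "('n::finite \<Rightarrow> nat) \<Rightarrow> real"
  assumes k: "k \<in> grid m" "k' \<in> grid m" and near: "\<And>j. k' j \<le> Suc (k j)" "\<And>j. k j \<le> Suc (k' j)"
    and cl: "\<And>l. (\<And>j. l j = k j \<or> l j = k' j) \<Longrightarrow> Q l"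
  shows "\<bar>g k' - g k\<bar> \<le> (\<Sum>i\<in>UNIV. \<Sum>l\<in>{l\<in>edges m i. Q l}. \<bar>g (step_up i l) - g l\<bar>)"
proof -
  \<comment> \<open>The path visits \<open>h S\<close> for growing sets \<open>S\<close> of coordinates that have already been moved.\<close>
  define h where "h S = (\<lambda>j. if j \<in> S then k' j else k j)" for S
  let ?t = "\<lambda>i. \<Sum>l\<in>{l\<in>edges m i. Q l}. \<bar>g (step_up i l) - g l\<bar>"
  have h: "h S \<in> grid m" "Q (h S)" for S
    using k cl unfolding h_def grid_def by auto
  have single: "\<bar>g (step_up i l) - g l\<bar> \<le> ?t i" if "l \<in> edges m i" "Q l" for i l
    using that finite_edges[of m i] by (intro member_le_sum) auto
  have "\<bar>g (h S) - g k\<bar> \<le> (\<Sum>i\<in>S. ?t i)" if "finite S" for S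
    using that
  proof (induction S rule: finite_induct)
    case empty
    then show ?case unfolding h_def by simp
  next
    case (insert i S)
    have hi: "h (insert i S) = (h S)(i := k' i)" "h S i = k i" "h (insert i S) i = k' i"
      using insert(2) unfolding h_def by (auto simp: fun_eq_iff)
    have "\<bar>g (h (insert i S)) - g (h S)\<bar> \<le> ?t i"
    proof -
      consider "k' i = k i" | "k' i = Suc (k i)" | "k i = Suc (k' i)"
        using near[of i] by linarith
      then show ?thesis
      proof cases
        case 1
        then have "h (insert i S) = h S" using hi by auto
        then show ?thesis by (simp add: sum_nonneg)
      next
        case 2
        then have "h (insert i S) = step_up i (h S)" using hi unfolding step_up_def by simp
        moreover have "h S \<in> edges m i"
        proof -
          have "k' i \<le> 2 ^ m" using k(2) unfolding grid_def by simp
          then have "h S i < 2 ^ m" using hi(2) 2 by simp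
          then show ?thesis using h(1) unfolding edges_def by simp
        qed
        ultimately show ?thesis using single[of "h S" i] h(2) by simp
      next
        case 3
        then have "h S = step_up i (h (insert i S))"
          using hi unfolding step_up_def by (auto simp: fun_eq_iff)
        moreover have "h (insert i S) \<in> edges m i"
        proof -
          have "h S i \<le> 2 ^ m" using h(1)[of S] unfolding grid_def by simp
          then have "h (insert i S) i < 2 ^ m" using hi 3 by simp
          then show ?thesis using h(1) unfolding edges_def by simp
        qed
        ultimately have "\<bar>g (h S) - g (h (insert i S))\<bar> \<le> ?t i"
          using single[of "h (insert i S)" i] h(2) by simp
        then show ?thesis by (simp add: abs_minus_commute)
      qed
    qed
    moreover have "(\<Sum>i\<in>insert i S. ?t i) = ?t i + (\<Sum>i\<in>S. ?t i)"
      using insert(1,2) by simp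
    ultimately show ?case using insert.IH by linarith
  qed
  from this[of UNIV] show ?thesis unfolding h_def by simp
qed

lemma cell_bounds:
  assumes "x \<in> (unit_cube :: (real^'n) set)"
  shows "real (cell m x j) \<le> 2 ^ m * x $ j" "2 ^ m * x $ j < real (cell m x j) + 1"
    "cell m x \<in> grid m"
proof -
  have x: "0 \<le> x $ i" "x $ i \<le> 1" for i using assms by (auto simp: mem_box_cart)
  have nn: "0 \<le> 2 ^ m * x $ i" for i using x by simp
  have c: "real (cell m x i) = of_int \<lfloor>2 ^ m * x $ i\<rfloor>" for i
    unfolding cell_def by (rule of_nat_nat) (use nn[of i] in simp)
  have lo: "real (cell m x i) \<le> 2 ^ m * x $ i" for i
    unfolding c by (rule of_int_floor_le)
  then show "real (cell m x j) \<le> 2 ^ m * x $ j" .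
  show "2 ^ m * x $ j < real (cell m x j) + 1"
    unfolding c by (rule real_of_int_floor_add_one_gt)
  have "cell m x i \<le> 2 ^ m" for i
  proof -
    have "2 ^ m * x $ i \<le> 2 ^ m * 1" using x(2)[of i] by (rule mult_left_mono) simp
    moreover have "real (2 ^ m) = 2 ^ m" by simp
    ultimately have "real (cell m x i) \<le> real (2 ^ m)" using lo[of i] by linarith
    then show ?thesis by (simp only: of_nat_le_iff)
  qed
  then show "cell m x \<in> grid m" unfolding grid_def by simp
qed

text \<open>A grid point of level \<open>m\<close> is also one of level \<open>m + 1\<close>, and the two roundings of \<open>x\<close> differ by at
most one step in each coordinate.\<close>

lemma coarse_to_fine_le_oscillation:
  fixes x :: "real^'n"
  assumes x: "x \<in> unit_cube"
  shows "\<bar>f (grid_point (Suc m) (cell (Suc m) x)) - f (grid_point m (cell m x))\<bar> \<le> oscillation f (Suc m) x"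
proof -
  define k where "k j = 2 * cell m x j" for j
  note b = cell_bounds[OF x, of m] and b' = cell_bounds[OF x, of "Suc m"]
  have gp: "grid_point m (cell m x) = grid_point (Suc m) k"
    unfolding grid_point_def k_def by (simp add: vec_eq_iff)
  have kg: "k \<in> grid (Suc m)" using b(3) unfolding grid_def k_def by simp
  have near: "k j \<le> cell (Suc m) x j" "cell (Suc m) x j \<le> Suc (k j)" for j
  proof -
    have "real (k j) < real (cell (Suc m) x j) + 1"
      using b(1)[of j] b'(2)[of j] unfolding k_def by simp
    then show "k j \<le> cell (Suc m) x j" by linarith
    have "real (cell (Suc m) x j) < real (k j) + 2"
      using b(2)[of j] b'(1)[of j] unfolding k_def by simp
    then show "cell (Suc m) x j \<le> Suc (k j)" by linarith
  qed
  show ?thesis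
    unfolding gp oscillation_def increment_def
  proof (rule grid_path[OF kg b'(3), where g="\<lambda>k. f (grid_point (Suc m) k)"])
    fix l assume l: "\<And>j. l j = k j \<or> l j = cell (Suc m) x j"
    show "close_to (Suc m) x l"
      unfolding close_to_def
    proof
      fix j
      have "real (cell (Suc m) x j) \<le> real (l j) + 1" "real (l j) \<le> real (cell (Suc m) x j)"
        using l[of j] near[of j] by auto
      then show "\<bar>real (l j) - 2 ^ Suc m * x $ j\<bar> \<le> 2"
        using b'(1)[of j] b'(2)[of j] by linarith
    qed
  next
    show "cell (Suc m) x j \<le> Suc (k j)" for j by (rule near)
    show "k j \<le> Suc (cell (Suc m) x j)" for j using near(1)[of j] by (rule le_SucI)
  qed
qed

lemma shift_le_oscillation:
  fixes x h :: "real^'n"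
  assumes x: "x \<in> unit_cube" and xh: "x + h \<in> unit_cube" and h: "norm h \<le> 1 / 2 ^ m"
  shows "\<bar>f (grid_point m (cell m (x + h))) - f (grid_point m (cell m x))\<bar> \<le> oscillation f m x"
proof -
  note b = cell_bounds[OF x, of m] and b' = cell_bounds[OF xh, of m]
  have "\<bar>2 ^ m * (x + h) $ j - 2 ^ m * x $ j\<bar> \<le> 1" for j
  proof -
    have "\<bar>h $ j\<bar> \<le> 1 / 2 ^ m" using component_le_norm_cart[of h j] h by linarith
    then have "2 ^ m * \<bar>h $ j\<bar> \<le> 2 ^ m * (1 / 2 ^ m)" by (intro mult_left_mono) auto
    moreover have "2 ^ m * (x + h) $ j - 2 ^ m * x $ j = 2 ^ m * h $ j"
      by (simp add: distrib_left)
    ultimately show ?thesis by (simp add: abs_mult)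
  qed
  note d = this
  have near: "cell m (x + h) j \<le> Suc (cell m x j)" "cell m x j \<le> Suc (cell m (x + h) j)" for j
  proof -
    have "real (cell m (x + h) j) < real (cell m x j) + 2"
      using b(2)[of j] b'(1)[of j] d[of j] by linarith
    then show "cell m (x + h) j \<le> Suc (cell m x j)" by linarith
    have "real (cell m x j) < real (cell m (x + h) j) + 2"
      using b(1)[of j] b'(2)[of j] d[of j] by linarith
    then show "cell m x j \<le> Suc (cell m (x + h) j)" by linarith
  qed
  show ?thesis
    unfolding oscillation_def increment_def
  proof (rule grid_path[OF b(3) b'(3), where g="\<lambda>k. f (grid_point m k)"])
    fix l assume l: "\<And>j. l j = cell m x j \<or> l j = cell m (x + h) j"
    show "close_to m x l"
      unfolding close_to_def
    proof
      fix j
      show "\<bar>real (l j) - 2 ^ m * x $ j\<bar> \<le> 2"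
        using l[of j] b(1)[of j] b(2)[of j] b'(1)[of j] b'(2)[of j] d[of j] by auto
    qed
  qed (rule near)+
qed

lemma grid_point_cell_tendsto:
  fixes x :: "real^'n"
  assumes x: "x \<in> unit_cube" and f: "continuous_on unit_cube f"
  shows "(\<lambda>m. f (grid_point m (cell m x))) \<longlonglongrightarrow> (f x :: real)"
proof -
  have "grid_point m (cell m x) \<in> unit_cube" for m
    using cell_bounds(3)[OF x, of m] unfolding grid_point_def grid_def by (simp add: mem_box_cart)
  moreover have "(\<lambda>m. grid_point m (cell m x)) \<longlonglongrightarrow> x"
  proof (rule vec_tendstoI)
    fix j
    have "(\<lambda>m. 1 / 2 ^ m :: real) \<longlonglongrightarrow> 0"
      using LIMSEQ_realpow_zero[of "1/2::real"] by (simp add: power_divide)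
    then have "(\<lambda>m. x $ j - 1 / 2 ^ m) \<longlonglongrightarrow> x $ j" by (auto intro: tendsto_eq_intros)
    then show "(\<lambda>m. grid_point m (cell m x) $ j) \<longlonglongrightarrow> x $ j"
    proof (rule tendsto_sandwich[rotated 2])
      show "eventually (\<lambda>m. x $ j - 1 / 2 ^ m \<le> grid_point m (cell m x) $ j) sequentially"
      proof (rule always_eventually, rule allI)
        fix m
        have "(2 ^ m * x $ j - 1) / 2 ^ m \<le> real (cell m x j) / 2 ^ m"
          using cell_bounds(2)[OF x, of m j] by (intro divide_right_mono) auto
        then show "x $ j - 1 / 2 ^ m \<le> grid_point m (cell m x) $ j"
          by (simp add: grid_point_def diff_divide_distrib)
      qed
      show "eventually (\<lambda>m. grid_point m (cell m x) $ j \<le> x $ j) sequentially"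
        using cell_bounds(1)[OF x]
        by (intro always_eventually allI) (simp add: grid_point_def field_simps)
    qed simp
  qed
  ultimately show ?thesis
    using f x by (intro continuous_on_tendsto_compose[OF f]) (auto intro: always_eventually)
qed

text \<open>Chaining: the difference on the level of \<open>h\<close> is a single oscillation, and each finer level adds one
oscillation at each of the two points.\<close>

lemma shifted_difference_le_oscillations:
  fixes x h :: "real^'n"
  assumes x: "x \<in> unit_cube" "x + h \<in> unit_cube" and h: "norm h \<le> 1 / 2 ^ n"
  shows "\<bar>f (grid_point (n + j) (cell (n + j) (x + h))) - f (grid_point (n + j) (cell (n + j) x))\<bar> \<le>
    (\<Sum>i\<le>j. oscillation f (n + i) x + oscillation f (n + i) (x + h))"
proof (induction j)
  case 0
  have "0 \<le> oscillation f n (x + h)" unfolding oscillation_def by (intro sum_nonneg) auto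
  then show ?case using shift_le_oscillation[OF x h, of f] by simp
next
  case (Suc j)
  show ?case
    using Suc coarse_to_fine_le_oscillation[OF x(1), of f "n + j"]
      coarse_to_fine_le_oscillation[OF x(2), of f "n + j"] by simp
qed

text \<open>Crude but sufficient, and valid for all \<open>p > 0\<close>: the sum is at most \<open>card A\<close> times its largest term.\<close>

lemma sum_powr_le:
  fixes f :: "'a \<Rightarrow> real"
  assumes A: "finite A" and f: "\<And>a. a \<in> A \<Longrightarrow> 0 \<le> f a" and p: "0 < p"
  shows "(\<Sum>a\<in>A. f a) powr p \<le> real (card A) powr p * (\<Sum>a\<in>A. f a powr p)"
proof (cases "A = {}")
  case False
  define t where "t = Max (f ` A)"
  have t_in: "t \<in> f ` A" unfolding t_def using A False by (intro Max_in) auto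
  then obtain a where a: "a \<in> A" "t = f a" by blast
  have le: "f b \<le> t" if "b \<in> A" for b unfolding t_def using A that by (intro Max_ge) auto
  have t0: "0 \<le> t" using a f by simp
  have "(\<Sum>a\<in>A. f a) powr p \<le> (real (card A) * t) powr p"
    using sum_bounded_above[of A f t, OF le] p f by (intro powr_mono2 sum_nonneg) auto
  also have "\<dots> = real (card A) powr p * (f a powr p)"
    using t0 a(2) by (simp add: powr_mult)
  also have "\<dots> \<le> real (card A) powr p * (\<Sum>a\<in>A. f a powr p)"
    using A a(1) by (intro mult_left_mono member_le_sum) auto
  finally show ?thesis .
qed simp

lemma card_nat_near: "card {n::nat. \<bar>real n - y\<bar> \<le> 2} \<le> 5" "finite {n::nat. \<bar>real n - y\<bar> \<le> 2}"
proof -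
  define a where "a = nat \<lceil>y - 2\<rceil>"
  have "{n::nat. \<bar>real n - y\<bar> \<le> 2} \<subseteq> {a..<a + 5}"
  proof
    fix n :: nat assume "n \<in> {n. \<bar>real n - y\<bar> \<le> 2}"
    then have n: "y - 2 \<le> real n" "real n \<le> y + 2" by (simp_all add: abs_le_iff)
    have "\<lceil>y - 2\<rceil> \<le> int n" by (rule ceiling_le) (use n(1) in simp)
    moreover have "int n \<le> \<lceil>y - 2\<rceil> + 4"
    proof -
      have "real n \<le> of_int \<lceil>y - 2\<rceil> + 4" using n(2) le_of_int_ceiling[of "y - 2"] by linarith
      then have "of_int (int n) \<le> (of_int (\<lceil>y - 2\<rceil> + 4) :: real)" by simp
      then show ?thesis by (simp only: of_int_le_iff)
    qed
    ultimately show "n \<in> {a..<a + 5}" unfolding a_def by auto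
  qed
  then show "card {n::nat. \<bar>real n - y\<bar> \<le> 2} \<le> 5" "finite {n::nat. \<bar>real n - y\<bar> \<le> 2}"
    using card_mono[of "{a..<a + 5}"] finite_subset by (simp, blast)
qed

lemma close_to_bounds:
  "finite {k. close_to m (x :: real^'n::finite) k}" "card {k. close_to m (x :: real^'n::finite) k} \<le> 5 ^ CARD('n)"
proof -
  have eq: "{k. close_to m x k} = (\<Pi>\<^sub>E j\<in>UNIV. {n::nat. \<bar>real n - 2 ^ m * x $ j\<bar> \<le> 2})"
    unfolding close_to_def by (auto simp: PiE_iff)
  show "finite {k. close_to m x k}" unfolding eq by (intro finite_PiE card_nat_near(2)) simp
  have "card {k. close_to m x k} \<le> (\<Prod>j\<in>(UNIV :: 'n set). 5)"
    unfolding eq card_PiE[OF finite_class.finite_UNIV] by (intro prod_mono conjI card_nat_near) simp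
  then show "card {k. close_to m x k} \<le> 5 ^ CARD('n)" by simp
qed

definition edge_energy :: "(real^'n \<Rightarrow> real) \<Rightarrow> real \<Rightarrow> nat \<Rightarrow> real" where
  "edge_energy f p m = (\<Sum>i\<in>(UNIV :: 'n::finite set). \<Sum>k\<in>edges m i. \<bar>increment f m i k\<bar> powr p)"

text \<open>At most \<open>5 ^ d\<close> grid points per direction are close to \<open>x\<close>, so the power of the sum is comparable
to the sum of the powers.\<close>

lemma oscillation_powr_le:
  fixes x :: "real^'n::finite"
  assumes p: "0 < p"
  shows "oscillation f m x powr p \<le> real (CARD('n) * 5 ^ CARD('n)) powr p *
    (\<Sum>i\<in>UNIV. \<Sum>k\<in>edges m i. \<bar>increment f m i k\<bar> powr p * of_bool (close_to m x k))"
proof -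
  let ?B = "\<lambda>i. {k\<in>edges m i. close_to m x k}"
  let ?A = "SIGMA i:UNIV. ?B i"
  have fin: "finite (?B i)" for i by (rule finite_subset[OF _ finite_edges[of m i]]) auto
  have finA: "finite ?A" by (intro finite_SigmaI fin) simp
  have cardB: "card (?B i) \<le> 5 ^ CARD('n)" for i
    by (rule order_trans[OF card_mono close_to_bounds(2)]) (auto intro: close_to_bounds)
  have "card ?A = (\<Sum>i\<in>UNIV. card (?B i))" using fin by (intro card_SigmaI) auto
  also have "\<dots> \<le> (\<Sum>i\<in>(UNIV :: 'n set). 5 ^ CARD('n))" by (intro sum_mono cardB)
  finally have cardA: "card ?A \<le> CARD('n) * 5 ^ CARD('n)" by simp
  have "oscillation f m x = (\<Sum>a\<in>?A. \<bar>increment f m (fst a) (snd a)\<bar>)"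
    unfolding oscillation_def using fin by (subst sum.Sigma) (auto simp: case_prod_unfold)
  also have "\<dots> powr p \<le> real (card ?A) powr p * (\<Sum>a\<in>?A. \<bar>increment f m (fst a) (snd a)\<bar> powr p)"
    using finA p by (intro sum_powr_le) auto
  also have "\<dots> \<le> real (CARD('n) * 5 ^ CARD('n)) powr p * (\<Sum>a\<in>?A. \<bar>increment f m (fst a) (snd a)\<bar> powr p)"
    using cardA p by (intro mult_right_mono powr_mono2 sum_nonneg) (simp_all only: of_nat_le_iff of_nat_0_le_iff powr_ge_zero less_imp_le)
  also have "(\<Sum>a\<in>?A. \<bar>increment f m (fst a) (snd a)\<bar> powr p) =
      (\<Sum>i\<in>UNIV. \<Sum>k\<in>?B i. \<bar>increment f m i k\<bar> powr p)"
    using fin by (subst sum.Sigma) (auto simp: case_prod_unfold)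
  also have "\<dots> = (\<Sum>i\<in>UNIV. \<Sum>k\<in>edges m i. \<bar>increment f m i k\<bar> powr p * of_bool (close_to m x k))"
  proof (rule sum.cong[OF refl])
    fix i :: 'n
    have "(\<Sum>k\<in>?B i. \<bar>increment f m i k\<bar> powr p) =
        (\<Sum>k\<in>edges m i. if close_to m x k then \<bar>increment f m i k\<bar> powr p else 0)"
      by (rule sum.inter_filter[OF finite_edges])
    also have "\<dots> = (\<Sum>k\<in>edges m i. \<bar>increment f m i k\<bar> powr p * of_bool (close_to m x k))"
      by (intro sum.cong refl) simp
    finally show "(\<Sum>k\<in>?B i. \<bar>increment f m i k\<bar> powr p) =
        (\<Sum>k\<in>edges m i. \<bar>increment f m i k\<bar> powr p * of_bool (close_to m x k))" .
  qed
  finally show ?thesis .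
qed

lemma nn_integral_close_to_shift:
  fixes h :: "real^'n::finite"
  shows "(\<integral>\<^sup>+x. ennreal (of_bool (close_to m (x + h) k)) \<partial>lborel) = ennreal ((4 / 2 ^ m) ^ CARD('n))"
    "(\<lambda>x. ennreal (of_bool (close_to m (x + h) k))) \<in> borel_measurable lborel"
proof -
  define a :: "real^'n" where "a = (\<chi> j. (real (k j) - 2) / 2 ^ m - h $ j)"
  define b :: "real^'n" where "b = (\<chi> j. (real (k j) + 2) / 2 ^ m - h $ j)"
  have ab: "b $ j - a $ j = 4 / 2 ^ m" for j unfolding a_def b_def by (simp add: field_simps)
  have eq: "close_to m (x + h) k \<longleftrightarrow> x \<in> cbox a b" for x
  proof -
    have "\<bar>real (k j) - 2 ^ m * (x + h) $ j\<bar> \<le> 2 \<longleftrightarrow> a $ j \<le> x $ j \<and> x $ j \<le> b $ j" for j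
      unfolding a_def b_def by (auto simp: field_simps abs_le_iff)
    then show ?thesis unfolding close_to_def mem_box_cart by simp
  qed
  have f: "(\<lambda>x. ennreal (of_bool (close_to m (x + h) k))) = indicator (cbox a b)"
    unfolding eq by (auto simp: indicator_def fun_eq_iff)
  show "(\<lambda>x. ennreal (of_bool (close_to m (x + h) k))) \<in> borel_measurable lborel"
    unfolding f by simp
  have le: "a $ j \<le> b $ j" for j 
  proof -
    have "0 \<le> (4 / 2 ^ m :: real)" by simp
    then show ?thesis using ab[of j] by linarith
  qed
  have "(\<integral>\<^sup>+x. ennreal (of_bool (close_to m (x + h) k)) \<partial>lborel) = emeasure lborel (cbox a b)"
    unfolding f by simp
  also have "\<dots> = ennreal (measure lborel (cbox a b))"
    by (rule emeasure_eq_ennreal_measure)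
      (use emeasure_lborel_cbox_finite[of a b] in \<open>simp add: less_top\<close>)
  also have "measure lborel (cbox a b) = (\<Prod>i\<in>UNIV. b $ i - a $ i)"
    using le by (intro content_cbox_cart) (auto simp: interval_ne_empty_cart)
  also have "\<dots> = (4 / 2 ^ m) ^ CARD('n)" unfolding ab by simp
  finally show "(\<integral>\<^sup>+x. ennreal (of_bool (close_to m (x + h) k)) \<partial>lborel) = ennreal ((4 / 2 ^ m) ^ CARD('n))" .
qed

text \<open>Each edge contributes on a cube of volume \<open>(4 / 2 ^ m) ^ d\<close>. The majorant \<open>g\<close> provides the measurability, and the
shift \<open>h\<close> is needed because the oscillation is also evaluated at \<open>x + h\<close>.\<close>

lemma nn_integral_oscillation_le:
  fixes h :: "real^'n::finite"
  assumes p: "0 < p" and en: "edge_energy f p m \<le> C * (2 ^ m) ^ CARD('n) * q" and C: "0 \<le> C" "0 \<le> q"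
  defines "D \<equiv> real (CARD('n) * 5 ^ CARD('n)) powr p * 4 ^ CARD('n)"
  shows "\<exists>g. g \<in> borel_measurable lborel \<and> (\<forall>x. ennreal (oscillation f m (x + h) powr p) \<le> g x) \<and>
    (\<integral>\<^sup>+x. g x \<partial>lborel) \<le> ennreal (D * C * q)"
proof -
  define c where "c = real (CARD('n) * 5 ^ CARD('n)) powr p"
  have c: "0 \<le> c" unfolding c_def by simp
  define g where "g x = ennreal c * (\<Sum>i\<in>UNIV. \<Sum>k\<in>edges m i. ennreal (\<bar>increment f m i k\<bar> powr p) *
      ennreal (of_bool (close_to m (x + h) k)))" for x
  have meas: "g \<in> borel_measurable lborel"
    unfolding g_def by (intro borel_measurable_times_ennreal borel_measurable_sum borel_measurable_const
        nn_integral_close_to_shift(2))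
  have "ennreal (oscillation f m (x + h) powr p) \<le> g x" for x
  proof -
    have "g x = ennreal (c * (\<Sum>i\<in>UNIV. \<Sum>k\<in>edges m i. \<bar>increment f m i k\<bar> powr p *
        of_bool (close_to m (x + h) k)))"
    proof -
      have "(\<Sum>i\<in>UNIV. \<Sum>k\<in>edges m i. ennreal (\<bar>increment f m i k\<bar> powr p) *
          ennreal (of_bool (close_to m (x + h) k))) =
        ennreal (\<Sum>i\<in>UNIV. \<Sum>k\<in>edges m i. \<bar>increment f m i k\<bar> powr p *
          of_bool (close_to m (x + h) k))"
        by (simp add: ennreal_mult''[symmetric] sum_nonneg)
      then show ?thesis
        unfolding g_def by (simp only: ennreal_mult'[OF c])
    qed
    then show ?thesis
      using oscillation_powr_le[OF p, of f m "x + h"] unfolding c_def by (simp add: ennreal_leI)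
  qed
  moreover have "(\<integral>\<^sup>+x. g x \<partial>lborel) \<le> ennreal (D * C * q)"
  proof -
    note [measurable] = nn_integral_close_to_shift(2)[of m h]
    have one: "(\<integral>\<^sup>+x. ennreal r * ennreal (of_bool (close_to m (x + h) k)) \<partial>lborel) =
        ennreal r * ennreal ((4 / 2 ^ m) ^ CARD('n))" for r k
      by (subst nn_integral_cmult[OF nn_integral_close_to_shift(2)])
        (simp only: nn_integral_close_to_shift(1))
    have "(\<integral>\<^sup>+x. g x \<partial>lborel) = ennreal c * (\<Sum>i\<in>UNIV. \<Sum>k\<in>edges m i.
        ennreal (\<bar>increment f m i k\<bar> powr p) * ennreal ((4 / 2 ^ m) ^ CARD('n)))"
      unfolding g_def
      by (simp add: nn_integral_cmult nn_integral_sum one)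
    also have "\<dots> = ennreal (c * (edge_energy f p m * (4 / 2 ^ m) ^ CARD('n)))"
      unfolding edge_energy_def using c
      by (simp add: ennreal_mult''[symmetric] sum_nonneg sum_distrib_right)
    also have "\<dots> \<le> ennreal (D * C * q)"
    proof (rule ennreal_leI)
      have "edge_energy f p m * (4 / 2 ^ m) ^ CARD('n) \<le> (C * (2 ^ m) ^ CARD('n) * q) * (4 / 2 ^ m) ^ CARD('n)"
        using en by (intro mult_right_mono) auto
      also have "\<dots> = C * q * 4 ^ CARD('n)"
        by (simp add: power_divide)
      finally have "c * (edge_energy f p m * (4 / 2 ^ m) ^ CARD('n)) \<le> c * (C * q * 4 ^ CARD('n))"
        using c by (rule mult_left_mono)
      then show "c * (edge_energy f p m * (4 / 2 ^ m) ^ CARD('n)) \<le> D * C * q"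
        unfolding D_def c_def by (simp add: ac_simps)
    qed
    finally show ?thesis .
  qed
  ultimately show ?thesis using meas by blast
qed

section \<open>A criterion for Besov regularity\<close>

lemma powr_add_le:
  fixes a b :: real
  assumes "0 \<le> a" "0 \<le> b" "0 < p"
  shows "(a + b) powr p \<le> 2 powr p * (a powr p + b powr p)"
proof -
  have "(a + b) powr p \<le> (2 * max a b) powr p"
    using assms by (intro powr_mono2) (auto simp: max_def)
  also have "\<dots> = 2 powr p * max a b powr p"
    using assms by (simp add: powr_mult)
  also have "\<dots> \<le> 2 powr p * (a powr p + b powr p)"
    by (intro mult_left_mono) (auto simp: max_def)
  finally show ?thesis .
qed

text \<open>The oscillations of the levels from \<open>n\<close> on are added with weights: if all \<open>lam j\<close> are positive with
sum at most 1, then \<open>(\<Sum>j. a j) powr p \<le> (\<Sum>j. (a j / lam j) powr p)\<close>, since every \<open>a j\<close> is at most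
\<open>lam j\<close> times the \<open>p\<close>-th root of the right-hand side. The weights decay half as
fast as the oscillations do, which leaves a convergent geometric series.\<close>

lemma shift_integral_le:
  fixes f :: "real^'n::finite \<Rightarrow> real"
  assumes p: "0 < p" and f: "continuous_on unit_cube f" and \<rho>: "0 < \<rho>" "\<rho> < 1" and C: "0 \<le> C"
    and en: "\<And>m. edge_energy f p m \<le> C * (2 ^ m) ^ CARD('n) * (\<rho> ^ m) powr (2 * p)"
  shows "\<exists>K\<ge>0. \<forall>n h. norm h \<le> 1 / 2 ^ n \<longrightarrow>
    (\<integral>\<^sup>+x. ennreal (\<bar>f (x + h) - f x\<bar> powr p) \<partial>lebesgue_on {x \<in> unit_cube. x + h \<in> unit_cube})
      \<le> ennreal (K * (\<rho> ^ n) powr (2 * p))"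
proof -
  define D where "D = real (CARD('n) * 5 ^ CARD('n)) powr p * 4 ^ CARD('n)"
  \<comment> \<open>Geometric weights of total mass 1.\<close>
  define lam where "lam j = (1 - \<rho>) * \<rho> ^ j" for j :: nat
  have lam: "0 < lam j" for j using \<rho> unfolding lam_def by simp
  have sum_lam: "(\<Sum>j\<le>J. lam j) \<le> 1" for J
  proof -
    have "(\<Sum>j\<le>J. lam j) = 1 - \<rho> ^ Suc J"
      unfolding lam_def sum_distrib_left[symmetric] using sum_gp_basic[of \<rho> J] by simp
    then show ?thesis using \<rho> by simp
  qed
  define c where "c j = lam j powr (- p) * 2 powr p" for j
  have c: "0 \<le> c j" for j unfolding c_def by simp
  define K0 where "K0 = (1 - \<rho>) powr (- p) * 2 powr p * (2 * (D * C))"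
  have D0: "0 \<le> D" unfolding D_def by simp
  have K0: "0 \<le> K0" unfolding K0_def using D0 C by simp
  have rp: "0 < \<rho> powr p" "\<rho> powr p < 1" 
    using \<rho> p powr_less_mono2[of p \<rho> 1] by simp_all
  have int: "(\<integral>\<^sup>+x. ennreal (\<bar>f (x + h) - f x\<bar> powr p) \<partial>lebesgue_on {x \<in> unit_cube. x + h \<in> unit_cube})
      \<le> ennreal (K0 / (1 - \<rho> powr p) * (\<rho> ^ n) powr (2 * p))" if h: "norm h \<le> 1 / 2 ^ n" for n h
  proof -
    let ?S = "{x \<in> unit_cube. x + h \<in> unit_cube}"
    define q where "q m = (\<rho> ^ m) powr (2 * p)" for m :: nat
    have q: "0 \<le> q m" for m unfolding q_def by simp
    have ex: "\<exists>g. g \<in> borel_measurable lborel \<and> (\<forall>x. ennreal (oscillation f m (x + u) powr p) \<le> g x) \<and>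
        (\<integral>\<^sup>+x. g x \<partial>lborel) \<le> ennreal (D * C * q m)" for m and u :: "real^'n"
      unfolding D_def using nn_integral_oscillation_le[OF p en[of m, folded q_def] C q] .
    have "\<forall>m. \<exists>g. g \<in> borel_measurable lborel \<and> (\<forall>x. ennreal (oscillation f m x powr p) \<le> g x) \<and>
        (\<integral>\<^sup>+x. g x \<partial>lborel) \<le> ennreal (D * C * q m)"
      using ex[of _ 0] by simp
    then obtain g0 where g0: "\<And>m. g0 m \<in> borel_measurable lborel"
      "\<And>m x. ennreal (oscillation f m x powr p) \<le> g0 m x"
      "\<And>m. (\<integral>\<^sup>+x. g0 m x \<partial>lborel) \<le> ennreal (D * C * q m)" by metis
    have "\<forall>m. \<exists>g. g \<in> borel_measurable lborel \<and> (\<forall>x. ennreal (oscillation f m (x + h) powr p) \<le> g x) \<and>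
        (\<integral>\<^sup>+x. g x \<partial>lborel) \<le> ennreal (D * C * q m)"
      using ex[of _ h] by blast
    then obtain g1 where g1: "\<And>m. g1 m \<in> borel_measurable lborel"
      "\<And>m x. ennreal (oscillation f m (x + h) powr p) \<le> g1 m x"
      "\<And>m. (\<integral>\<^sup>+x. g1 m x \<partial>lborel) \<le> ennreal (D * C * q m)" by metis
    define T where "T x = (\<Sum>j. ennreal (c j) * (g0 (n + j) x + g1 (n + j) x))" for x
    have Tj: "(\<lambda>x. ennreal (c j) * (g0 (n + j) x + g1 (n + j) x)) \<in> borel_measurable lborel" for j
      using g0(1) g1(1) by measurable
    have point: "ennreal (\<bar>f (x + h) - f x\<bar> powr p) \<le> T x" if x: "x \<in> ?S" for x
    proof (cases "T x")
      case top
      then show ?thesis by simp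
    next
      case (real t)
      have xs: "x \<in> unit_cube" "x + h \<in> unit_cube" using x by auto
      let ?a = "\<lambda>j. oscillation f (n + j) x + oscillation f (n + j) (x + h)"
      have osc0: "0 \<le> oscillation f m y" for m y unfolding oscillation_def by (intro sum_nonneg) auto
      have a_le: "?a j \<le> lam j * t powr (1 / p)" for j
      proof -
        have "ennreal (lam j powr (- p) * ?a j powr p) \<le>
            ennreal (c j * (oscillation f (n + j) x powr p + oscillation f (n + j) (x + h) powr p))"
        proof (rule ennreal_leI)
          have "lam j powr (- p) * ?a j powr p \<le> lam j powr (- p) *
              (2 powr p * (oscillation f (n + j) x powr p + oscillation f (n + j) (x + h) powr p))"
            using osc0 p by (intro mult_left_mono powr_add_le) auto
          then show "lam j powr (- p) * ?a j powr p \<le>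
              c j * (oscillation f (n + j) x powr p + oscillation f (n + j) (x + h) powr p)"
            unfolding c_def by (simp only: mult.assoc)
        qed
        also have "\<dots> = ennreal (c j) * (ennreal (oscillation f (n + j) x powr p) +
            ennreal (oscillation f (n + j) (x + h) powr p))"
          using c by (simp add: ennreal_mult' ennreal_plus)
        also have "\<dots> \<le> ennreal (c j) * (g0 (n + j) x + g1 (n + j) x)"
          by (intro mult_left_mono add_mono g0(2) g1(2)) simp
        also have "\<dots> \<le> T x"
        proof -
          have "(\<Sum>i\<in>{j}. ennreal (c i) * (g0 (n + i) x + g1 (n + i) x)) \<le> T x"
            unfolding T_def by (intro sum_le_suminf summableI) auto
          then show ?thesis by simp
        qed
        finally have "ennreal (lam j powr (- p) * ?a j powr p) \<le> ennreal t" using real by simp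
        then have "lam j powr (- p) * ?a j powr p \<le> t" using real(1) by (simp add: ennreal_le_iff)
        moreover have "lam j powr p * lam j powr (- p) = 1" using lam[of j] by (simp add: powr_minus)
        ultimately have "?a j powr p \<le> lam j powr p * t"
        proof -
          assume a: "lam j powr (- p) * ?a j powr p \<le> t" and b: "lam j powr p * lam j powr (- p) = 1"
          have "?a j powr p = (lam j powr p * lam j powr (- p)) * ?a j powr p" unfolding b by simp
          also have "\<dots> = lam j powr p * (lam j powr (- p) * ?a j powr p)" by (rule mult.assoc)
          also have "\<dots> \<le> lam j powr p * t" using a by (intro mult_left_mono) auto
          finally show ?thesis .
        qed
        then have "(?a j powr p) powr (1 / p) \<le> (lam j powr p * t) powr (1 / p)"
          using p by (intro powr_mono2) auto
        moreover have "(?a j powr p) powr (1 / p) = ?a j"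
          using osc0 p by (simp add: powr_powr)
        moreover have "(lam j powr p * t) powr (1 / p) = lam j * t powr (1 / p)"
          using lam[of j] real(1) p by (simp add: powr_mult powr_powr)
        ultimately show ?thesis by simp
      qed
      have "\<bar>f (grid_point (n + J) (cell (n + J) (x + h))) - f (grid_point (n + J) (cell (n + J) x))\<bar>
          \<le> t powr (1 / p)" for J
      proof -
        have "(\<Sum>j\<le>J. ?a j) \<le> (\<Sum>j\<le>J. lam j * t powr (1 / p))" by (intro sum_mono a_le)
        also have "\<dots> = (\<Sum>j\<le>J. lam j) * t powr (1 / p)" by (rule sum_distrib_right[symmetric])
        also have "\<dots> \<le> 1 * t powr (1 / p)" by (intro mult_right_mono sum_lam) auto
        finally show ?thesis
          using shifted_difference_le_oscillations[OF xs h, of f J] by linarith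
      qed
      moreover have "(\<lambda>J. \<bar>f (grid_point (n + J) (cell (n + J) (x + h))) -
          f (grid_point (n + J) (cell (n + J) x))\<bar>) \<longlonglongrightarrow> \<bar>f (x + h) - f x\<bar>"
      proof (intro tendsto_rabs tendsto_diff)
        show "(\<lambda>J. f (grid_point (n + J) (cell (n + J) (x + h)))) \<longlonglongrightarrow> f (x + h)"
          using LIMSEQ_ignore_initial_segment[OF grid_point_cell_tendsto[OF xs(2) f], of n]
          by (simp add: add.commute)
        show "(\<lambda>J. f (grid_point (n + J) (cell (n + J) x))) \<longlonglongrightarrow> f x"
          using LIMSEQ_ignore_initial_segment[OF grid_point_cell_tendsto[OF xs(1) f], of n]
          by (simp add: add.commute)
      qed
      ultimately have "\<bar>f (x + h) - f x\<bar> \<le> t powr (1 / p)"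
        by (intro LIMSEQ_le_const2) auto
      then have "\<bar>f (x + h) - f x\<bar> powr p \<le> (t powr (1 / p)) powr p"
        using p by (intro powr_mono2) auto
      also have "\<dots> = t" using real(1) p by (simp add: powr_powr)
      finally show ?thesis using real by (simp add: ennreal_leI)
    qed
    have S: "?S \<in> sets lebesgue"
    proof -
      have "x + h \<in> unit_cube \<longleftrightarrow> x \<in> cbox (- h) (1 - h)" for x
      proof -
        have "0 \<le> x $ i + h $ i \<longleftrightarrow> - h $ i \<le> x $ i" "x $ i + h $ i \<le> 1 \<longleftrightarrow> x $ i \<le> 1 - h $ i" for i
          by linarith+
        then show ?thesis by (simp add: mem_box_cart)
      qed
      then have "?S = unit_cube \<inter> cbox (- h) (1 - h)" by blast
      then show ?thesis by simp
    qed
    have "(\<integral>\<^sup>+x. ennreal (\<bar>f (x + h) - f x\<bar> powr p) \<partial>lebesgue_on ?S) =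
        (\<integral>\<^sup>+x. ennreal (\<bar>f (x + h) - f x\<bar> powr p) * indicator ?S x \<partial>lebesgue)"
      using S by (intro nn_integral_restrict_space) simp
    also have "\<dots> \<le> (\<integral>\<^sup>+x. T x \<partial>lebesgue)"
      using point by (intro nn_integral_mono) (auto simp: indicator_def)
    also have "\<dots> = (\<integral>\<^sup>+x. T x \<partial>lborel)" by (rule nn_integral_completion)
    also have "\<dots> = (\<Sum>j. \<integral>\<^sup>+x. ennreal (c j) * (g0 (n + j) x + g1 (n + j) x) \<partial>lborel)"
      unfolding T_def by (rule nn_integral_suminf[OF Tj])
    also have "\<dots> \<le> (\<Sum>j. ennreal (K0 * q n * (\<rho> powr p) ^ j))"
    proof (intro suminf_le summableI)
      fix j
      have "(\<integral>\<^sup>+x. ennreal (c j) * (g0 (n + j) x + g1 (n + j) x) \<partial>lborel) =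
          ennreal (c j) * ((\<integral>\<^sup>+x. g0 (n + j) x \<partial>lborel) + (\<integral>\<^sup>+x. g1 (n + j) x \<partial>lborel))"
        using g0(1) g1(1) by (simp add: nn_integral_cmult nn_integral_add)
      also have "\<dots> \<le> ennreal (c j) * (ennreal (D * C * q (n + j)) + ennreal (D * C * q (n + j)))"
        by (intro mult_left_mono add_mono g0(3) g1(3)) simp
      also have "\<dots> = ennreal (c j * (2 * (D * C * q (n + j))))"
      proof -
        have X: "0 \<le> D * C * q (n + j)" using D0 C q by simp
        show ?thesis
          by (simp only: ennreal_plus[OF X X, symmetric] ennreal_mult'[OF c] mult_2)
      qed
      also have "c j * (2 * (D * C * q (n + j))) = K0 * q n * (\<rho> powr p) ^ j"
      proof -
        have l: "lam j powr (- p) = (1 - \<rho>) powr (- p) * (\<rho> ^ j) powr (- p)"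
          unfolding lam_def using \<rho> by (simp add: powr_mult)
        have "(\<rho> ^ j) powr p = (\<rho> powr p) ^ j"
          using \<rho>(1) by (simp add: powr_realpow[symmetric] powr_powr mult.commute)
        then have e: "(\<rho> powr p) ^ j = (\<rho> ^ j) powr (- p) * (\<rho> ^ j) powr (2 * p)"
          unfolding powr_add[symmetric] by simp
        have qq: "q (n + j) = q n * (\<rho> ^ j) powr (2 * p)"
          unfolding q_def using \<rho> by (simp add: power_add powr_mult)
        show ?thesis
          unfolding c_def K0_def l e qq by (simp only: ac_simps)
      qed
      finally show "(\<integral>\<^sup>+x. ennreal (c j) * (g0 (n + j) x + g1 (n + j) x) \<partial>lborel) \<le>
          ennreal (K0 * q n * (\<rho> powr p) ^ j)" .
    qed
    also have "\<dots> = ennreal (K0 * q n * (1 / (1 - \<rho> powr p)))"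
      using K0 q rp by (intro suminf_ennreal_eq sums_mult geometric_sums) auto
    also have "K0 * q n * (1 / (1 - \<rho> powr p)) = K0 / (1 - \<rho> powr p) * (\<rho> ^ n) powr (2 * p)"
      unfolding q_def by simp
    finally show ?thesis .
  qed
  moreover have "0 \<le> K0 / (1 - \<rho> powr p)" using K0 rp by simp
  ultimately show ?thesis by blast
qed

lemma epowr_ennreal: "0 \<le> x \<Longrightarrow> epowr (ennreal x) s = ennreal (x powr s)"
  unfolding epowr_def by simp

lemma epowr_mono:
  assumes "a \<le> b" "0 \<le> s"
  shows "epowr a s \<le> epowr b s"
proof (cases b)
  case (real y)
  then obtain x where x: "a = ennreal x" "0 \<le> x" "x \<le> y"
    using assms(1) by (cases a) (auto simp: ennreal_le_iff top_unique)
  then show ?thesis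
    using real assms(2) by (simp add: epowr_ennreal ennreal_leI powr_mono2)
qed (simp add: epowr_def)

text \<open>As \<open>\<gamma> > \<alpha>\<close>, the integrand of the Besov seminorm is at most a multiple of a power of \<open>r\<close> with exponent
greater than -1.\<close>

lemma in_besov_space_if_Holder_modulus:
  fixes f :: "real^'n::finite \<Rightarrow> real"
  assumes p: "1 \<le> p" and f: "continuous_on unit_cube f" and \<gamma>: "\<alpha> < \<gamma>" and K: "0 \<le> K"
    and modulus: "\<And>r h. 0 < r \<Longrightarrow> r < 1 \<Longrightarrow> norm h \<le> r \<Longrightarrow>
      (\<integral>\<^sup>+x. ennreal (\<bar>f (x + h) - f x\<bar> powr p) \<partial>lebesgue_on {x \<in> unit_cube. x + h \<in> unit_cube})
      \<le> ennreal (K * r powr (\<gamma> * p))"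
  shows "f \<in> besov_space \<alpha> p p"
proof -
  have cube: "(unit_cube :: (real^'n) set) \<in> sets lebesgue" by simp
  have meas: "f \<in> borel_measurable (lebesgue_on unit_cube)"
    using f cube by (rule continuous_imp_measurable_on_sets_lebesgue)
  have "bounded (f ` unit_cube)"
    using compact_continuous_image[OF f compact_cbox] by (rule compact_imp_bounded)
  then obtain B where B: "\<And>x. x \<in> unit_cube \<Longrightarrow> \<bar>f x\<bar> \<le> B"
    unfolding bounded_iff by auto
  have "(\<integral>\<^sup>+x. ennreal (\<bar>f x\<bar> powr p) \<partial>lebesgue_on unit_cube) \<le>
      (\<integral>\<^sup>+x. ennreal (B powr p) \<partial>lebesgue_on (unit_cube :: (real^'n) set))"
    using B p by (intro nn_integral_mono ennreal_leI powr_mono2) auto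
  also have "\<dots> < \<infinity>"
    using cube emeasure_lborel_cbox_finite[of "0 :: real^'n" 1]
    by (simp add: emeasure_restrict_space ennreal_mult_less_top)
  finally have "Lp_norm p f < \<infinity>"
    unfolding Lp_norm_def epowr_def by auto
  note Lp = this
  have mod: "epowr (Lp_modulus p f r) p \<le> ennreal (K * r powr (\<gamma> * p))" if r: "0 < r" "r < 1" for r
  proof -
    have "Lp_modulus p f r \<le> epowr (ennreal (K * r powr (\<gamma> * p))) (1 / p)"
      unfolding Lp_modulus_def using p modulus[OF r] by (intro SUP_least epowr_mono) auto
    then have "epowr (Lp_modulus p f r) p \<le> epowr (epowr (ennreal (K * r powr (\<gamma> * p))) (1 / p)) p"
      using p by (intro epowr_mono) auto
    also have "\<dots> = ennreal (K * r powr (\<gamma> * p))"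
      using p K by (simp add: epowr_ennreal powr_powr)
    finally show ?thesis .
  qed
  define a where "a = (\<gamma> - \<alpha>) * p - 1"
  have a: "- 1 < a" unfolding a_def using \<gamma> p by simp
  have "(\<integral>\<^sup>+r. epowr (Lp_modulus p f r) p * ennreal (r powr (- \<alpha> * p - 1)) \<partial>lebesgue_on {0<..<1})
      \<le> (\<integral>\<^sup>+r. ennreal (K * r powr a) \<partial>lebesgue_on {0<..<1})"
  proof (rule nn_integral_mono)
    fix r :: real assume "r \<in> space (lebesgue_on {0<..<1})"
    then have r: "0 < r" "r < 1" by auto
    have "epowr (Lp_modulus p f r) p * ennreal (r powr (- \<alpha> * p - 1)) \<le>
        ennreal (K * r powr (\<gamma> * p)) * ennreal (r powr (- \<alpha> * p - 1))"
      by (intro mult_right_mono mod r) simp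
    also have "\<dots> = ennreal (K * r powr (\<gamma> * p) * r powr (- \<alpha> * p - 1))"
      using K by (simp add: ennreal_mult'')
    also have "K * r powr (\<gamma> * p) * r powr (- \<alpha> * p - 1) = K * r powr a"
      unfolding mult.assoc powr_add[symmetric] a_def by (simp add: algebra_simps)
    finally show "epowr (Lp_modulus p f r) p * ennreal (r powr (- \<alpha> * p - 1)) \<le> ennreal (K * r powr a)" .
  qed
  also have "\<dots> = (\<integral>\<^sup>+r. ennreal (K * r powr a) * indicator {0<..<1} r \<partial>lborel)"
    by (simp add: nn_integral_restrict_space nn_integral_completion)
  also have "\<dots> \<le> (\<integral>\<^sup>+r. ennreal (K * r powr a) * indicator {0..1} r \<partial>lborel)"
    by (intro nn_integral_mono) (auto simp: indicator_def)
  also have "\<dots> = ennreal (K * (1 powr (a + 1) / (a + 1)))"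
    using K by (intro nn_integral_has_integral_lebesgue' has_integral_mult_right has_integral_powr_from_0 a) auto
  also have "\<dots> < \<infinity>" by simp
  finally have "epowr (\<integral>\<^sup>+r. epowr (Lp_modulus p f r) p * ennreal (r powr (- \<alpha> * p - 1))
      \<partial>lebesgue_on {0<..<1}) (1 / p) < \<infinity>"
    unfolding epowr_def by auto
  then have "besov_norm \<alpha> p p f < \<infinity>"
    using Lp unfolding besov_norm_def by simp
  then show ?thesis
    using Lp meas unfolding besov_space_def Lp_space_def by simp
qed

lemma dyadic_scale:
  assumes "0 < r" "r < (1::real)"
  shows "\<exists>n. r \<le> 1 / 2 ^ n \<and> 1 / 2 ^ n < 2 * r"
proof -
  \<comment> \<open>The predecessor of the least exponent whose dyadic number is below \<open>r\<close>; it exists since \<open>r < 1\<close>.\<close>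
  obtain n0 where "(1 / 2) ^ n0 < r" using real_arch_pow_inv[OF assms(1), of "1/2"] by auto
  then have ex: "\<exists>n. 1 / 2 ^ n < r" by (auto simp: power_divide)
  define N where "N = (LEAST n. 1 / 2 ^ n < r)"
  have N: "1 / 2 ^ N < r" unfolding N_def using ex by (rule LeastI_ex)
  then have "N \<noteq> 0" using assms by (intro notI) simp
  then obtain n where n: "N = Suc n" using not0_implies_Suc by blast
  have "\<not> 1 / 2 ^ n < r" using not_less_Least[of n "\<lambda>n. 1 / 2 ^ n < r"] n unfolding N_def by simp
  then show ?thesis using N n by (intro exI[of _ n]) simp
qed

text \<open>The exponent is split evenly, \<open>\<rho>\<^sup>2 = (1 / 2) powr \<gamma>\<close>, so that \<open>\<rho>\<close> serves both as the ratio of the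
weights in the chaining and as the remaining rate of decay.\<close>

lemma in_besov_space_if_edge_energy_decays:
  fixes f :: "real^'n::finite \<Rightarrow> real"
  assumes p: "1 \<le> p" and f: "continuous_on unit_cube f" and \<gamma>: "\<alpha> < \<gamma>" "0 < \<gamma>" and C: "0 \<le> C"
    and en: "\<And>m. edge_energy f p m \<le> C * (2 ^ m) ^ CARD('n) * (1 / 2 ^ m) powr (\<gamma> * p)"
  shows "f \<in> besov_space \<alpha> p p"
proof -
  define \<rho> where "\<rho> = (1 / 2 :: real) powr (\<gamma> / 2)"
  have \<rho>: "0 < \<rho>" "\<rho> < 1" 
    unfolding \<rho>_def using \<gamma>(2) powr_less_mono2[of "\<gamma> / 2" "1 / 2" 1] by simp_all
  have \<rho>_pow: "(\<rho> ^ m) powr (2 * p) = (1 / 2 ^ m) powr (\<gamma> * p)" for m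
  proof -
    have "\<rho> ^ m = \<rho> powr real m" using \<rho>(1) by (simp add: powr_realpow)
    moreover have "(1 / 2 ^ m :: real) = (1 / 2) powr real m" by (simp add: powr_realpow power_divide)
    ultimately show ?thesis unfolding \<rho>_def by (simp add: powr_powr mult.commute mult.left_commute)
  qed
  have p0: "0 < p" using p by simp
  obtain K where K: "0 \<le> K" and
    bnd: "\<And>n h. norm h \<le> 1 / 2 ^ n \<Longrightarrow>
      (\<integral>\<^sup>+x. ennreal (\<bar>f (x + h) - f x\<bar> powr p) \<partial>lebesgue_on {x \<in> unit_cube. x + h \<in> unit_cube})
      \<le> ennreal (K * (\<rho> ^ n) powr (2 * p))"
    using shift_integral_le[OF p0 f \<rho> C en[folded \<rho>_pow]] by blast
  show ?thesis
  proof (rule in_besov_space_if_Holder_modulus[OF p f \<gamma>(1)])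
    show "0 \<le> K * 2 powr (\<gamma> * p)" using K by simp
    fix r and h :: "real^'n" assume r: "0 < r" "r < 1" "norm h \<le> r"
    obtain n where n: "r \<le> 1 / 2 ^ n" "1 / 2 ^ n < 2 * r" using dyadic_scale[OF r(1,2)] by blast
    have "(\<integral>\<^sup>+x. ennreal (\<bar>f (x + h) - f x\<bar> powr p) \<partial>lebesgue_on {x \<in> unit_cube. x + h \<in> unit_cube})
      \<le> ennreal (K * (1 / 2 ^ n) powr (\<gamma> * p))"
      using bnd[of h n] r(3) n(1) unfolding \<rho>_pow by simp
    also have "\<dots> \<le> ennreal (K * (2 * r) powr (\<gamma> * p))"
      using n(2) K \<gamma>(2) p0 by (intro ennreal_leI mult_left_mono powr_mono2) auto
    also have "K * (2 * r) powr (\<gamma> * p) = K * 2 powr (\<gamma> * p) * r powr (\<gamma> * p)"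
      using r(1) by (simp add: powr_mult)
    finally show "(\<integral>\<^sup>+x. ennreal (\<bar>f (x + h) - f x\<bar> powr p) \<partial>lebesgue_on {x \<in> unit_cube. x + h \<in> unit_cube})
      \<le> ennreal (K * 2 powr (\<gamma> * p) * r powr (\<gamma> * p))" .
  qed
qed

section \<open>Stochastic measures on the unit cube\<close>

lemma (in prob_space) AE_zero_if_prob_gt_zero:
  fixes Y :: "'a \<Rightarrow> real"
  assumes Y: "Y \<in> borel_measurable M" and z: "\<And>e. 0 < e \<Longrightarrow> prob {w \<in> space M. e < \<bar>Y w\<bar>} = 0"
  shows "AE w in M. Y w = 0"
proof -
  note [measurable] = Y
  have "AE w in M. \<forall>k::nat. \<bar>Y w\<bar> \<le> 1 / real (Suc k)"
    unfolding AE_all_countable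
  proof
    fix k :: nat
    have "{w \<in> space M. 1 / real (Suc k) < \<bar>Y w\<bar>} \<in> events" by measurable
    then have "AE w in M. w \<notin> {w \<in> space M. 1 / real (Suc k) < \<bar>Y w\<bar>}"
      using z[of "1 / real (Suc k)"] by (simp add: prob_eq_0)
    then show "AE w in M. \<bar>Y w\<bar> \<le> 1 / real (Suc k)"
      using AE_space by eventually_elim (simp add: not_less)
  qed
  then show ?thesis
  proof eventually_elim
    case (elim w)
    have "\<not> 0 < \<bar>Y w\<bar>"
    proof
      assume "0 < \<bar>Y w\<bar>"
      then obtain k where "inverse (real (Suc k)) < \<bar>Y w\<bar>" using reals_Archimedean by blast
      then show False using elim[rule_format, of k] by (simp add: inverse_eq_divide)
    qed
    then show ?case by simp
  qed
qed

text \<open>Applied to the constant sequence \<open>{}\<close>, countable additivity forces \<open>n * \<mu> {}\<close> to converge, so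
\<open>\<mu> {}\<close> vanishes almost surely; finite sequences padded by \<open>{}\<close> then give finite additivity. Values on disjoint sets
are differences of consecutive partial sums of a convergent series.\<close>

lemma stochastic_measure_imp_L0_measure:
  assumes "prob_space M" and sm: "stochastic_measure M N \<mu>"
  shows "L0_measure M N \<mu>"
proof -
  interpret prob_space M by fact
  have meas: "\<mu> A \<in> borel_measurable M" if "A \<in> sets N" for A
    using sm that unfolding stochastic_measure_def by blast
  have conv: "(\<lambda>n. prob {w \<in> space M. e < \<bar>(\<Sum>i<n. \<mu> (A i) w) - \<mu> (\<Union>i. A i) w\<bar>}) \<longlonglongrightarrow> 0"
    if "range A \<subseteq> sets N" "disjoint_family A" "0 < e" for A :: "nat \<Rightarrow> 'b set" and e
    using sm that unfolding stochastic_measure_def converges_in_prob_def by blast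
  have empty: "AE w in M. \<mu> {} w = 0"
  proof (rule AE_zero_if_prob_gt_zero)
    show m0: "\<mu> {} \<in> borel_measurable M" by (rule meas) simp
    note [measurable] = m0
    fix e :: real assume e: "0 < e"
    have "(\<lambda>n::nat. prob {w \<in> space M. e < \<bar>(\<Sum>i<n. \<mu> {} w) - \<mu> {} w\<bar>}) \<longlonglongrightarrow> 0"
      using conv[of "\<lambda>_. {}" e] e by (simp add: disjoint_family_on_def)
    moreover have "prob {w \<in> space M. e < \<bar>\<mu> {} w\<bar>} \<le>
        prob {w \<in> space M. e < \<bar>(\<Sum>i<n. \<mu> {} w) - \<mu> {} w\<bar>}" if "2 \<le> n" for n :: nat
    proof (rule finite_measure_mono)
      show "{w \<in> space M. e < \<bar>\<mu> {} w\<bar>} \<subseteq> {w \<in> space M. e < \<bar>(\<Sum>i<n. \<mu> {} w) - \<mu> {} w\<bar>}"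
      proof
        fix w assume w: "w \<in> {w \<in> space M. e < \<bar>\<mu> {} w\<bar>}"
        have "(\<Sum>i<n. \<mu> {} w) - \<mu> {} w = (real n - 1) * \<mu> {} w" by (simp add: algebra_simps)
        then have "\<bar>(\<Sum>i<n. \<mu> {} w) - \<mu> {} w\<bar> = (real n - 1) * \<bar>\<mu> {} w\<bar>"
          using that by (simp add: abs_mult)
        also have "\<dots> \<ge> 1 * \<bar>\<mu> {} w\<bar>" using that by (intro mult_right_mono) auto
        finally show "w \<in> {w \<in> space M. e < \<bar>(\<Sum>i<n. \<mu> {} w) - \<mu> {} w\<bar>}" using w by simp
      qed
    qed measurable
    ultimately have "prob {w \<in> space M. e < \<bar>\<mu> {} w\<bar>} \<le> 0"
      by (intro LIMSEQ_le_const) auto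
    then show "prob {w \<in> space M. e < \<bar>\<mu> {} w\<bar>} = 0" using measure_nonneg by (rule antisym)
  qed
  show ?thesis
  proof
    show "\<mu> A \<in> borel_measurable M" if "A \<in> sets N" for A using meas that .
    show "AE w in M. \<mu> (A \<union> B) w = \<mu> A w + \<mu> B w"
      if A: "A \<in> sets N" and B: "B \<in> sets N" and AB: "A \<inter> B = {}" for A B
    proof -
      define F where "F i = (if i = 0 then A else if i = 1 then B else {})" for i :: nat
      define Y where "Y w = \<mu> A w + \<mu> B w - \<mu> (A \<union> B) w" for w
      have Y: "Y \<in> borel_measurable M"
        unfolding Y_def using A B by (intro borel_measurable_diff borel_measurable_add meas) auto
      note [measurable] = Y
      have UF: "(\<Union>i. F i) = A \<union> B" unfolding F_def by (auto split: if_splits)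
      have F: "range F \<subseteq> sets N" "disjoint_family F"
        using A B AB unfolding F_def disjoint_family_on_def by auto
      have "AE w in M. Y w = 0"
      proof (rule AE_zero_if_prob_gt_zero[OF Y])
        fix e :: real assume e: "0 < e"
        have "prob {w \<in> space M. e < \<bar>(\<Sum>i<n. \<mu> (F i) w) - \<mu> (A \<union> B) w\<bar>} =
            prob {w \<in> space M. e < \<bar>Y w\<bar>}" if n: "2 \<le> n" for n
        proof (rule finite_measure_eq_AE)
          show "AE w in M. w \<in> {w \<in> space M. e < \<bar>(\<Sum>i<n. \<mu> (F i) w) - \<mu> (A \<union> B) w\<bar>} \<longleftrightarrow>
              w \<in> {w \<in> space M. e < \<bar>Y w\<bar>}"
            using empty
          proof eventually_elim
            case (elim w)
            have "(\<Sum>i<n. \<mu> (F i) w) = (\<Sum>i\<in>{0, 1}. \<mu> (F i) w)"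
              using n elim by (intro sum.mono_neutral_right) (auto simp: F_def)
            then show ?case unfolding Y_def F_def by simp
          qed
          have [measurable]: "(\<lambda>w. \<Sum>i<n. \<mu> (F i) w) \<in> borel_measurable M" "\<mu> (A \<union> B) \<in> borel_measurable M"
            using F(1) A B by (auto intro!: borel_measurable_sum meas)
          show "{w \<in> space M. e < \<bar>(\<Sum>i<n. \<mu> (F i) w) - \<mu> (A \<union> B) w\<bar>} \<in> events" by measurable
          show "{w \<in> space M. e < \<bar>Y w\<bar>} \<in> events" by measurable
        qed
        then have "eventually (\<lambda>n. prob {w \<in> space M. e < \<bar>(\<Sum>i<n. \<mu> (F i) w) - \<mu> (A \<union> B) w\<bar>} =
            prob {w \<in> space M. e < \<bar>Y w\<bar>}) sequentially"
          by (auto simp: eventually_sequentially)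
        moreover have "(\<lambda>n. prob {w \<in> space M. e < \<bar>(\<Sum>i<n. \<mu> (F i) w) - \<mu> (A \<union> B) w\<bar>}) \<longlonglongrightarrow> 0"
          using conv[OF F e] unfolding UF .
        ultimately have "(\<lambda>n. prob {w \<in> space M. e < \<bar>Y w\<bar>}) \<longlonglongrightarrow> 0"
          by (rule Lim_transform_eventually[rotated])
        then show "prob {w \<in> space M. e < \<bar>Y w\<bar>} = 0" by (simp add: LIMSEQ_const_iff)
      qed
      then show ?thesis by eventually_elim (simp add: Y_def)
    qed
    fix B :: "nat \<Rightarrow> 'b set" and e :: real
    assume B: "range B \<subseteq> sets N" "disjoint_family B" and e: "0 < e"
    define D where "D n w = (\<Sum>i<n. \<mu> (B i) w) - \<mu> (\<Union>i. B i) w" for n w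
    define F where "F n = {w \<in> space M. e / 2 < \<bar>D n w\<bar>}" for n
    have lim: "(\<lambda>n. prob (F n)) \<longlonglongrightarrow> 0"
      unfolding F_def D_def by (rule conv[OF B]) (use e in simp)
    have F: "F n \<in> events" for n
    proof -
      have [measurable]: "D n \<in> borel_measurable M"
        unfolding D_def using B(1)
        by (intro borel_measurable_diff borel_measurable_sum meas sets.countable_UN) auto
      show ?thesis unfolding F_def by measurable
    qed
    have le: "prob {w \<in> space M. e < \<bar>\<mu> (B n) w\<bar>} \<le> prob (F (Suc n)) + prob (F n)" for n
    proof -
      have step: "\<mu> (B n) w = D (Suc n) w - D n w" for w unfolding D_def by simp
      have half: "e / 2 < \<bar>y\<bar> \<or> e / 2 < \<bar>z\<bar>" if "e < \<bar>y - z\<bar>" for y z :: real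
        using that by arith
      have "{w \<in> space M. e < \<bar>\<mu> (B n) w\<bar>} \<subseteq> F (Suc n) \<union> F n"
        unfolding F_def step using half by blast
      then have "prob {w \<in> space M. e < \<bar>\<mu> (B n) w\<bar>} \<le> prob (F (Suc n) \<union> F n)"
        by (rule finite_measure_mono) (intro sets.Un F)
      also have "\<dots> \<le> prob (F (Suc n)) + prob (F n)" by (intro measure_Un_le F)
      finally show ?thesis .
    qed
    show "(\<lambda>n. prob {w \<in> space M. e < \<bar>\<mu> (B n) w\<bar>}) \<longlonglongrightarrow> 0"
    proof (rule tendsto_sandwich[of "\<lambda>_. 0"])
      show "(\<lambda>n. prob (F (Suc n)) + prob (F n)) \<longlonglongrightarrow> 0"
        using tendsto_add[OF LIMSEQ_Suc[OF lim] lim] by simp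
    qed (use le in \<open>simp_all\<close>)
  qed
qed

text \<open>The difference of the two boxes at the ends of an edge, so that its measure is the increment of the
distribution function along the edge.\<close>

definition slab :: "nat \<Rightarrow> 'n \<Rightarrow> ('n::finite \<Rightarrow> nat) \<Rightarrow> (real^'n) set" where
  "slab m i k = cbox 0 (grid_point m (step_up i k)) - cbox 0 (grid_point m k)"

lemma grid_point_in_cube: "k \<in> grid m \<Longrightarrow> grid_point m k \<in> unit_cube"
  unfolding grid_def grid_point_def by (simp add: mem_box_cart)

lemma step_up_in_grid: "k \<in> edges m i \<Longrightarrow> step_up i k \<in> grid m"
  unfolding edges_def grid_def step_up_def by auto

lemma mem_box_grid_point:
  fixes x :: "real^'n::finite"
  assumes "x \<in> unit_cube"
  shows "x \<in> cbox 0 (grid_point m k) \<longleftrightarrow> (\<forall>j. nat \<lceil>2 ^ m * x $ j\<rceil> \<le> k j)"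
proof -
  have x: "0 \<le> x $ j" for j using assms by (simp add: mem_box_cart)
  have "x $ j \<le> real (k j) / 2 ^ m \<longleftrightarrow> nat \<lceil>2 ^ m * x $ j\<rceil> \<le> k j" for j
  proof -
    have "x $ j \<le> real (k j) / 2 ^ m \<longleftrightarrow> 2 ^ m * x $ j \<le> of_int (int (k j))"
      by (simp add: pos_le_divide_eq mult.commute)
    also have "\<dots> \<longleftrightarrow> \<lceil>2 ^ m * x $ j\<rceil> \<le> int (k j)" by (rule ceiling_le_iff[symmetric])
    also have "\<dots> \<longleftrightarrow> nat \<lceil>2 ^ m * x $ j\<rceil> \<le> k j" by (simp only: nat_le_iff)
    finally show ?thesis .
  qed
  then show ?thesis using x by (simp add: mem_box_cart grid_point_def)
qed

text \<open>Membership depends on \<open>x\<close> only through its coordinates rounded up to the grid, which fix the coordinate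
\<open>k i\<close> in the direction of the edge. So few slabs contain a given point, and few traces
occur.\<close>

lemma mem_slab:
  fixes x :: "real^'n::finite"
  assumes "x \<in> unit_cube"
  shows "x \<in> slab m i k \<longleftrightarrow>
    (\<forall>j. nat \<lceil>2 ^ m * x $ j\<rceil> \<le> step_up i k j) \<and> nat \<lceil>2 ^ m * x $ i\<rceil> = Suc (k i)"
proof -
  define t where "t j = nat \<lceil>2 ^ m * x $ j\<rceil>" for j
  have "(\<forall>j. t j \<le> step_up i k j) \<and> \<not> (\<forall>j. t j \<le> k j) \<longleftrightarrow>
      (\<forall>j. t j \<le> step_up i k j) \<and> t i = Suc (k i)"
  proof (intro conj_cong refl)
    assume a: "\<forall>j. t j \<le> step_up i k j"
    have other: "t j \<le> k j" if "j \<noteq> i" for j using a[rule_format, of j] that unfolding step_up_def by simp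
    have "t i \<le> Suc (k i)" using a[rule_format, of i] unfolding step_up_def by simp
    then show "\<not> (\<forall>j. t j \<le> k j) \<longleftrightarrow> t i = Suc (k i)"
      using other by (metis Suc_n_not_le_n le_SucE)
  qed
  then show ?thesis
    unfolding slab_def Diff_iff mem_box_grid_point[OF assms] t_def .
qed

text \<open>The coordinate \<open>k i\<close> is determined by the point, the other \<open>d - 1\<close> coordinates are arbitrary.\<close>

lemma card_slabs_through_point:
  fixes x :: "real^'n::finite"
  assumes x: "x \<in> unit_cube"
  shows "real (card {k\<in>edges m i. x \<in> slab m i k}) * 2 ^ m \<le> 2 ^ CARD('n) * (2 ^ m) ^ CARD('n)"
proof -
  define t where "t = nat \<lceil>2 ^ m * x $ i\<rceil> - 1"
  let ?B = "\<lambda>j. if j = i then {t} else {..2 ^ m}"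
  have "{k\<in>edges m i. x \<in> slab m i k} \<subseteq> (\<Pi>\<^sub>E j\<in>UNIV. ?B j)"
  proof
    fix k assume k: "k \<in> {k\<in>edges m i. x \<in> slab m i k}"
    then have "k i = t" using mem_slab[OF x, of m i k] unfolding t_def by simp
    then show "k \<in> (\<Pi>\<^sub>E j\<in>UNIV. ?B j)"
      using k unfolding edges_def grid_def by (simp add: PiE_iff)
  qed
  then have "card {k\<in>edges m i. x \<in> slab m i k} \<le> card (\<Pi>\<^sub>E j\<in>UNIV. ?B j)"
    by (intro card_mono finite_PiE) auto
  also have "\<dots> = (\<Prod>j\<in>UNIV. card (?B j))" by (simp add: card_PiE)
  also have "\<dots> = (2 ^ m + 1) ^ (CARD('n) - 1)"
    by (subst prod.remove[of _ i]) (auto simp: card_Diff_singleton)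
  finally have "real (card {k\<in>edges m i. x \<in> slab m i k}) \<le> real ((2 ^ m + 1) ^ (CARD('n) - 1))"
    by (simp only: of_nat_le_iff)
  also have "\<dots> = (2 ^ m + 1) ^ (CARD('n) - 1)" by (simp add: add.commute)
  also have "\<dots> \<le> (2 * 2 ^ m) ^ (CARD('n) - 1)" by (intro power_mono) auto
  finally have "real (card {k\<in>edges m i. x \<in> slab m i k}) * 2 ^ m \<le> (2 * 2 ^ m) ^ (CARD('n) - 1) * (2 * 2 ^ m)"
    by (intro mult_mono) auto
  also have "\<dots> = (2 * 2 ^ m) ^ CARD('n)"
    by (metis finite_UNIV_card_ge_0 finite power_minus_mult)
  also have "\<dots> = 2 ^ CARD('n) * (2 ^ m) ^ CARD('n)" by (rule power_mult_distrib)
  finally show ?thesis .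
qed

lemma card_slab_traces:
  "real (card ((\<lambda>x. {k\<in>edges m i. x \<in> slab m i k}) ` (unit_cube :: (real^'n::finite) set)))
    \<le> 2 ^ CARD('n) * (2 ^ m) ^ CARD('n)"
proof -
  define tr where "tr t = {k\<in>edges m i. (\<forall>j. t j \<le> step_up i k j) \<and> t i = Suc (k i)}" for t :: "'n \<Rightarrow> nat"
  have "(\<lambda>x. {k\<in>edges m i. x \<in> slab m i k}) ` (unit_cube :: (real^'n) set) \<subseteq> tr ` grid m"
  proof
    fix s assume "s \<in> (\<lambda>x. {k\<in>edges m i. x \<in> slab m i k}) ` (unit_cube :: (real^'n) set)"
    then obtain x :: "real^'n" where x: "x \<in> unit_cube" "s = {k\<in>edges m i. x \<in> slab m i k}" by blast
    let ?t = "\<lambda>j. nat \<lceil>2 ^ m * x $ j\<rceil>"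
    have "s = tr ?t" unfolding x(2) tr_def using mem_slab[OF x(1)] by simp
    moreover have "?t \<in> grid m"
    proof -
      have "x \<in> cbox 0 (grid_point m (\<lambda>_. 2 ^ m))" using x(1) by (simp add: mem_box_cart grid_point_def)
      then show ?thesis unfolding mem_box_grid_point[OF x(1)] grid_def by simp
    qed
    ultimately show "s \<in> tr ` grid m" by blast
  qed
  then have "card ((\<lambda>x. {k\<in>edges m i. x \<in> slab m i k}) ` (unit_cube :: (real^'n) set)) \<le>
      card (grid m :: ('n \<Rightarrow> nat) set)"
    by (rule surj_card_le[OF finite_grid])
  then have "real (card ((\<lambda>x. {k\<in>edges m i. x \<in> slab m i k}) ` (unit_cube :: (real^'n) set))) \<le>
      real ((2 ^ m + 1) ^ CARD('n))"
    unfolding card_grid by (simp only: of_nat_le_iff)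
  also have "\<dots> = (2 ^ m + 1) ^ CARD('n)" by (simp add: add.commute)
  also have "\<dots> \<le> (2 * 2 ^ m) ^ CARD('n)" by (intro power_mono) auto
  also have "\<dots> = 2 ^ CARD('n) * (2 ^ m) ^ CARD('n)" by (rule power_mult_distrib)
  finally show ?thesis .
qed

lemma slab_sets:
  assumes "k \<in> edges m i"
  shows "cbox 0 (grid_point m k) \<in> sets (restrict_space borel unit_cube)"
    "cbox 0 (grid_point m (step_up i k)) \<in> sets (restrict_space borel unit_cube)"
    "slab m i k \<in> sets (restrict_space borel unit_cube)"
proof -
  have box: "cbox 0 y \<in> sets (restrict_space borel unit_cube)" if "y \<in> unit_cube" for y :: "real^'n::finite"
  proof -
    have "y $ j \<le> 1" for j using that by (simp add: mem_box_cart)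
    then have "cbox 0 y \<subseteq> unit_cube" using order_trans by (fastforce simp: mem_box_cart)
    then show ?thesis by (simp add: sets_restrict_space_iff)
  qed
  show "cbox 0 (grid_point m k) \<in> sets (restrict_space borel unit_cube)"
    using assms by (intro box grid_point_in_cube) (simp add: edges_def)
  moreover show "cbox 0 (grid_point m (step_up i k)) \<in> sets (restrict_space borel unit_cube)"
    using assms by (intro box grid_point_in_cube step_up_in_grid)
  ultimately show "slab m i k \<in> sets (restrict_space borel unit_cube)"
    unfolding slab_def by (rule sets.Diff[rotated])
qed

lemma eventually_exponential_tail:
  fixes a E :: real
  assumes a: "1 < a"
  shows "eventually (\<lambda>m. E * real (Suc m) \<le> a ^ m) sequentially"
proof -
  have x: "norm (1 / a) < 1" using a by simp
  have "(\<lambda>m. E * (real m * (1 / a) ^ m + (1 / a) ^ m)) \<longlonglongrightarrow> E * (0 + 0)"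
    by (intro tendsto_mult tendsto_const tendsto_add powser_times_n_limit_0 LIMSEQ_power_zero x)
  then have "eventually (\<lambda>m. E * (real m * (1 / a) ^ m + (1 / a) ^ m) < 1) sequentially"
    by (intro order_tendstoD(2)) auto
  then show ?thesis
  proof eventually_elim
    case (elim m)
    have "E * (real m * (1 / a) ^ m + (1 / a) ^ m) = E * real (Suc m) / a ^ m"
      by (simp add: power_divide add_divide_distrib distrib_left)
    then have "E * real (Suc m) / a ^ m \<le> 1" using elim by simp
    then show ?case using a by (simp add: divide_le_eq)
  qed
qed

text \<open>The scaling \<open>q\<close> makes the variances \<open>V * u ^ m\<close> decay geometrically, precisely because \<open>\<beta> < 1 / 2\<close>.
The bounds \<open>\<theta> ^ m\<close> with \<open>\<theta> ^ 4 = u\<close> decay more slowly than the standard deviations, by a geometric factor.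
Hence the Hoeffding tails decay doubly exponentially and beat the number of traces from some level
\<open>m0\<close> on; the finitely many earlier levels do not matter for the order of growth.\<close>

lemma AE_square_increments_decay:
  fixes M :: "'w measure" and \<mu> :: "(real^'n::finite) set \<Rightarrow> 'w \<Rightarrow> real" and i :: 'n
  assumes L0: "L0_measure M (restrict_space borel unit_cube) \<mu>" and \<beta>: "0 < \<beta>" "\<beta> < 1 / 2"
  shows "AE w in M. \<exists>C. \<forall>m. (\<Sum>k\<in>edges m i. (increment (\<lambda>x. \<mu> (cbox 0 x) w) m i k)\<^sup>2) \<le>
    C * (2 ^ m) ^ CARD('n) * (1 / 2 ^ m) powr (2 * \<beta>)"
proof -
  interpret L0_measure M "restrict_space borel unit_cube" \<mu> by (rule L0)
  define V where "V = (2::real) ^ CARD('n)"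
  have V: "1 \<le> V" unfolding V_def by simp
  define u where "u = (2::real) powr (2 * \<beta> - 1)"
  have u: "0 < u" "u < 1"
    unfolding u_def using \<beta> powr_less_mono[of "2 * \<beta> - 1" 0 2] by simp_all
  define \<theta> where "\<theta> = u powr (1 / 4)"
  have \<theta>: "0 < \<theta>" "\<theta> < 1"
    unfolding \<theta>_def using u powr_less_mono2[of "1 / 4" u 1] by simp_all
  have \<theta>u: "\<theta>\<^sup>2 / u = 1 / \<theta>\<^sup>2"
  proof -
    have "\<theta>\<^sup>2 * \<theta>\<^sup>2 = \<theta> powr 4" using \<theta> by (simp add: powr_numeral power_add[symmetric])
    also have "\<dots> = u" unfolding \<theta>_def using u by (simp add: powr_powr)
    finally show ?thesis using \<theta> u by (simp add: field_simps)
  qed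
  define a where "a = 1 / \<theta>\<^sup>2"
  have a: "1 < a" unfolding a_def using \<theta> by (simp add: power_less_one_iff)
  define q where "q m = (2 ^ m) powr (2 * \<beta>) / (2 ^ m) ^ CARD('n)" for m :: nat
  have q: "0 < q m" for m unfolding q_def by simp
  have qu: "q m * (2 ^ m) ^ CARD('n) = u ^ m * 2 ^ m" for m
  proof -
    have "(2 ^ m :: real) powr (2 * \<beta>) = u ^ m * 2 ^ m"
      unfolding u_def by (simp add: powr_realpow[symmetric] powr_powr powr_add[symmetric] algebra_simps)
    then show ?thesis unfolding q_def by simp
  qed
  define K where "K m = V * (2 ^ m) ^ CARD('n)" for m :: nat
  have "eventually (\<lambda>m. (10 * V * real (CARD('n) + 1)) * real (Suc m) \<le> a ^ m) sequentially"
    by (rule eventually_exponential_tail[OF a])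
  then obtain m0 where m0: "\<And>m. m0 \<le> m \<Longrightarrow> (10 * V * real (CARD('n) + 1)) * real (Suc m) \<le> a ^ m"
    by (auto simp: eventually_sequentially)
  have tail: "K (m + m0) * (2 * exp (- (\<theta> ^ (m + m0))\<^sup>2 / (2 * (V * u ^ (m + m0))))) \<le> (1 / 2) ^ (m + 4)" for m
  proof -
    define n where "n = m + m0"
    have "(\<theta> ^ n)\<^sup>2 / u ^ n = a ^ n"
      unfolding a_def \<theta>u[symmetric] by (simp add: power_divide power_mult[symmetric] mult.commute)
    then have ex: "(\<theta> ^ n)\<^sup>2 / (2 * (V * u ^ n)) = a ^ n / (2 * V)"
      using u V by (simp add: field_simps)
    have "real (5 * (CARD('n) + 1) * Suc n) \<le> a ^ n / (2 * V)"
      using m0[of n] V unfolding n_def by (simp add: field_simps)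
    then have "exp (- (a ^ n / (2 * V))) \<le> exp (- real (5 * (CARD('n) + 1) * Suc n))" by simp
    also have "\<dots> = inverse (exp 1 ^ (5 * (CARD('n) + 1) * Suc n))"
      by (simp only: exp_minus exp_of_nat_mult[symmetric] mult_1_right)
    also have "\<dots> \<le> inverse (2 ^ (5 * (CARD('n) + 1) * Suc n))"
    proof (rule le_imp_inverse_le)
      have "(2::real) \<le> exp 1" using exp_ge_add_one_self[of 1] by simp
      then show "(2::real) ^ (5 * (CARD('n) + 1) * Suc n) \<le> exp 1 ^ (5 * (CARD('n) + 1) * Suc n)"
        by (intro power_mono) auto
    qed simp
    finally have e: "exp (- (a ^ n / (2 * V))) \<le> inverse (2 ^ (5 * (CARD('n) + 1) * Suc n))" .
    have Kn: "K n * 2 = 2 ^ (CARD('n) + n * CARD('n) + 1)"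
      unfolding K_def V_def by (simp add: power_add power_mult)
    have "K n * 2 * exp (- (a ^ n / (2 * V))) \<le>
        2 ^ (CARD('n) + n * CARD('n) + 1) * inverse (2 ^ (5 * (CARD('n) + 1) * Suc n))"
      unfolding Kn by (intro mult_left_mono e) simp
    also have "\<dots> \<le> (1 / 2) ^ (m + 4)"
    proof -
      have "CARD('n) + n * CARD('n) + 1 + (m + 4) \<le> 5 * (CARD('n) + 1) * Suc n"
        unfolding n_def by (simp add: algebra_simps)
      then have "(2::real) ^ (CARD('n) + n * CARD('n) + 1 + (m + 4)) \<le> 2 ^ (5 * (CARD('n) + 1) * Suc n)"
        by (intro power_increasing) auto
      then have "(2::real) ^ (CARD('n) + n * CARD('n) + 1) * 2 ^ (m + 4) \<le> 2 ^ (5 * (CARD('n) + 1) * Suc n)"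
        by (simp only: power_add)
      then show ?thesis by (simp add: field_simps power_divide)
    qed
    finally show ?thesis
      unfolding n_def[symmetric] by (simp add: ex mult.assoc)
  qed
  have "AE w in M. summable (\<lambda>m. (sqrt (q (m + m0)))\<^sup>2 * (\<Sum>k\<in>edges (m + m0) i. (\<mu> (slab (m + m0) i k) w)\<^sup>2))"
  proof (rule AE_summable_square_values[where J="\<lambda>m. edges (m + m0) i" and A="\<lambda>m. slab (m + m0) i"
        and c="\<lambda>m. sqrt (q (m + m0))" and v="\<lambda>m. V * u ^ (m + m0)" and s="\<lambda>m. \<theta> ^ (m + m0)"
        and K="\<lambda>m. K (m + m0)"])
    show "finite (edges (m + m0) i)" for m by (rule finite_edges)
    show "slab (m + m0) i k \<in> sets (restrict_space borel unit_cube)" if "k \<in> edges (m + m0) i" for m k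
      using that by (rule slab_sets(3))
    show "real (card ((\<lambda>x. {k \<in> edges (m + m0) i. x \<in> slab (m + m0) i k}) ` space (restrict_space borel unit_cube)))
        \<le> K (m + m0)" for m
      using card_slab_traces[of "m + m0" i] unfolding K_def V_def by (simp add: space_restrict_space)
    show "0 < V * u ^ (m + m0)" for m using V u by simp
    show "(sqrt (q (m + m0)))\<^sup>2 * real (card {k \<in> edges (m + m0) i. x \<in> slab (m + m0) i k}) \<le> V * u ^ (m + m0)"
      if "x \<in> space (restrict_space borel unit_cube)" for m x
    proof -
      define n where "n = m + m0"
      let ?c = "real (card {k \<in> edges n i. x \<in> slab n i k})"
      have x: "x \<in> unit_cube" using that by (simp add: space_restrict_space)
      have "q n * (?c * 2 ^ n) \<le> q n * (V * (2 ^ n) ^ CARD('n))"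
        using card_slabs_through_point[OF x, of n i] q[of n] unfolding V_def
        by (intro mult_left_mono) auto
      also have "\<dots> = V * (u ^ n * 2 ^ n)" unfolding qu[symmetric] by simp
      finally have "(q n * ?c) * 2 ^ n \<le> (V * u ^ n) * 2 ^ n" by (simp only: mult.assoc)
      then have "q n * ?c \<le> V * u ^ n" by (rule mult_right_le_imp_le) simp
      then show ?thesis using q[of n] unfolding n_def[symmetric] by (simp add: less_imp_le)
    qed
    show "0 < \<theta> ^ (m + m0)" for m using \<theta> by simp
    show "summable (\<lambda>m. \<theta> ^ (m + m0))"
      using \<theta> by (simp only: summable_iff_shift summable_geometric real_norm_def abs_of_pos)
  qed (rule tail)
  moreover have "AE w in M. \<forall>m. \<forall>k\<in>edges m i. \<mu> (slab m i k) w = increment (\<lambda>x. \<mu> (cbox 0 x) w) m i k"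
    unfolding AE_all_countable
  proof (intro allI AE_finite_allI finite_edges)
    fix m k assume k: "k \<in> edges m i"
    have "grid_point m k $ j \<le> grid_point m (step_up i k) $ j" for j
      by (auto simp: grid_point_def step_up_def intro: divide_right_mono)
    then have "cbox 0 (grid_point m k) \<subseteq> cbox 0 (grid_point m (step_up i k))"
      using order_trans by (fastforce simp: mem_box_cart)
    then show "AE w in M. \<mu> (slab m i k) w = increment (\<lambda>x. \<mu> (cbox 0 x) w) m i k"
      using value_Diff[OF slab_sets(1,2)[OF k]] unfolding slab_def increment_def by simp
  qed
  ultimately show ?thesis
  proof eventually_elim
    case (elim w)
    define E where "E m = (\<Sum>k\<in>edges m i. (increment (\<lambda>x. \<mu> (cbox 0 x) w) m i k)\<^sup>2)" for m
    have "(\<Sum>k\<in>edges m i. (\<mu> (slab m i k) w)\<^sup>2) = E m" for m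
      unfolding E_def using elim(2) by (intro sum.cong) auto
    then have "summable (\<lambda>m. q (m + m0) * E (m + m0))"
      using elim(1) q by (simp add: less_imp_le)
    then have "summable (\<lambda>m. q m * E m)" by (simp only: summable_iff_shift[of "\<lambda>m. q m * E m"])
    then have "Bseq (\<lambda>m. q m * E m)"
      by (intro convergent_imp_Bseq) (auto simp: convergent_def dest: summable_LIMSEQ_zero)
    then obtain C where C: "\<And>m. \<bar>q m * E m\<bar> \<le> C" by (auto simp: Bseq_def)
    have "E m \<le> C * (2 ^ m) ^ CARD('n) * (1 / 2 ^ m) powr (2 * \<beta>)" for m
    proof -
      have "E m \<le> C / q m" using C[of m] q[of m] by (simp add: pos_le_divide_eq mult.commute abs_le_iff)
      also have "C / q m = C * (2 ^ m) ^ CARD('n) * (1 / 2 ^ m) powr (2 * \<beta>)"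
        unfolding q_def by (simp add: powr_divide)
      finally show ?thesis .
    qed
    then show ?case unfolding E_def by blast
  qed
qed

text \<open>For \<open>p \<ge> 2\<close> the increments are bounded by \<open>2 * B\<close>, so \<open>p\<close>-th powers are at most multiples of squares. For
\<open>p < 2\<close> the increments below the threshold \<open>t = (1 / 2 ^ m) powr \<beta>\<close> contribute at most \<open>t powr p\<close> each, and the
others at most \<open>t powr (p - 2)\<close> times their squares.\<close>

lemma edge_energy_le_of_square_sum:
  fixes f :: "real^'n::finite \<Rightarrow> real"
  assumes p: "1 \<le> p" and \<beta>: "0 < \<beta>" and B: "0 < B" "\<And>x. x \<in> unit_cube \<Longrightarrow> \<bar>f x\<bar> \<le> B" and C: "0 \<le> C"
    and sq: "\<And>m. (\<Sum>i\<in>UNIV. \<Sum>k\<in>edges m i. (increment f m i k)\<^sup>2) \<le>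
      C * (2 ^ m) ^ CARD('n) * (1 / 2 ^ m) powr (2 * \<beta>)"
  shows "\<exists>C'\<ge>0. \<forall>m. edge_energy f p m \<le>
    C' * (2 ^ m) ^ CARD('n) * (1 / 2 ^ m) powr (min \<beta> (2 * \<beta> / p) * p)"
proof (cases "2 \<le> p")
  case True
  have mn: "min \<beta> (2 * \<beta> / p) * p = 2 * \<beta>"
  proof -
    have "2 * \<beta> / p \<le> \<beta>" using True \<beta> by (simp add: divide_le_eq mult.commute)
    then show ?thesis using True by (simp add: min_absorb2)
  qed
  have "edge_energy f p m \<le> ((2 * B) powr (p - 2) * C) * (2 ^ m) ^ CARD('n) * (1 / 2 ^ m) powr (2 * \<beta>)" for m
  proof -
    have "edge_energy f p m \<le> (\<Sum>i\<in>UNIV. \<Sum>k\<in>edges m i. (2 * B) powr (p - 2) * (increment f m i k)\<^sup>2)"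
      unfolding edge_energy_def
    proof (intro sum_mono)
      fix i :: 'n and k assume k: "k \<in> edges m i"
      define d where "d = increment f m i k"
      have "grid_point m (step_up i k) \<in> unit_cube" "grid_point m k \<in> unit_cube"
        using k by (auto intro!: grid_point_in_cube step_up_in_grid simp: edges_def)
      from B(2)[OF this(1)] B(2)[OF this(2)] have "\<bar>d\<bar> \<le> 2 * B"
        unfolding d_def increment_def by linarith
      have "\<bar>d\<bar> powr p = \<bar>d\<bar> powr (p - 2) * \<bar>d\<bar> powr 2"
        unfolding powr_add[symmetric] by simp
      also have "\<bar>d\<bar> powr 2 = d\<^sup>2" by (cases "d = 0") (simp_all add: powr_numeral)
      also have "\<bar>d\<bar> powr (p - 2) * d\<^sup>2 \<le> (2 * B) powr (p - 2) * d\<^sup>2"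
        using \<open>\<bar>d\<bar> \<le> 2 * B\<close> True by (intro mult_right_mono powr_mono2) auto
      finally show "\<bar>increment f m i k\<bar> powr p \<le> (2 * B) powr (p - 2) * (increment f m i k)\<^sup>2"
        unfolding d_def .
    qed
    also have "\<dots> = (2 * B) powr (p - 2) * (\<Sum>i\<in>UNIV. \<Sum>k\<in>edges m i. (increment f m i k)\<^sup>2)"
      by (simp only: sum_distrib_left)
    also have "\<dots> \<le> (2 * B) powr (p - 2) * (C * (2 ^ m) ^ CARD('n) * (1 / 2 ^ m) powr (2 * \<beta>))"
      by (intro mult_left_mono sq) simp
    finally show ?thesis by (simp only: mult.assoc)
  qed
  then show ?thesis unfolding mn using C by (intro exI[of _ "(2 * B) powr (p - 2) * C"]) simp
next
  case False
  have mn: "min \<beta> (2 * \<beta> / p) = \<beta>"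
  proof -
    have "\<beta> \<le> 2 * \<beta> / p" using False p \<beta> by (simp add: pos_le_divide_eq mult.commute)
    then show ?thesis by (rule min_absorb1)
  qed
  define C' where "C' = real (CARD('n)) * 2 ^ CARD('n) + C"
  have "edge_energy f p m \<le> C' * (2 ^ m) ^ CARD('n) * (1 / 2 ^ m) powr (\<beta> * p)" for m
  proof -
    define t where "t = (1 / 2 ^ m :: real) powr \<beta>"
    have t: "0 < t" unfolding t_def by simp
    have tp: "t powr p = (1 / 2 ^ m) powr (\<beta> * p)" unfolding t_def by (simp add: powr_powr)
    have t2: "(1 / 2 ^ m) powr (2 * \<beta>) = t powr 2" unfolding t_def by (simp add: powr_powr mult.commute)
    have one: "\<bar>d\<bar> powr p \<le> t powr p + t powr (p - 2) * d\<^sup>2" for d :: real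
    proof (cases "\<bar>d\<bar> \<le> t")
      case True
      then have "\<bar>d\<bar> powr p \<le> t powr p" using p by (intro powr_mono2) auto
      then show ?thesis by (simp add: add_increasing2)
    next
      case F: False
      then have d: "0 < \<bar>d\<bar>" using t by linarith
      have "\<bar>d\<bar> powr p = \<bar>d\<bar> powr (p - 2) * \<bar>d\<bar> powr 2" unfolding powr_add[symmetric] by simp
      also have "\<bar>d\<bar> powr 2 = d\<^sup>2" using d by (simp add: powr_numeral)
      also have "\<bar>d\<bar> powr (p - 2) * d\<^sup>2 \<le> t powr (p - 2) * d\<^sup>2"
        using F False t by (intro mult_right_mono powr_mono2') auto
      finally show ?thesis by (simp add: add_increasing)
    qed
    have cardE: "real (card (edges m i)) \<le> 2 ^ CARD('n) * (2 ^ m) ^ CARD('n)" for i :: 'n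
    proof -
      have "card (edges m i) \<le> card (grid m :: ('n \<Rightarrow> nat) set)"
        by (intro card_mono finite_grid) (auto simp: edges_def)
      then have "real (card (edges m i)) \<le> real ((2 ^ m + 1) ^ CARD('n))"
        unfolding card_grid by (simp only: of_nat_le_iff)
      also have "\<dots> = (2 ^ m + 1) ^ CARD('n)" by (simp add: add.commute)
      also have "\<dots> \<le> (2 * 2 ^ m) ^ CARD('n)" by (intro power_mono) auto
      finally show ?thesis by (simp only: power_mult_distrib)
    qed
    have "edge_energy f p m \<le>
        (\<Sum>i\<in>(UNIV :: 'n set). \<Sum>k\<in>edges m i. t powr p + t powr (p - 2) * (increment f m i k)\<^sup>2)"
      unfolding edge_energy_def by (intro sum_mono one)
    also have "\<dots> = (\<Sum>i\<in>(UNIV :: 'n set). real (card (edges m i)) * t powr p) +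
        t powr (p - 2) * (\<Sum>i\<in>UNIV. \<Sum>k\<in>edges m i. (increment f m i k)\<^sup>2)"
      by (simp add: sum.distrib sum_distrib_left)
    also have "\<dots> \<le> (\<Sum>i\<in>(UNIV :: 'n set). 2 ^ CARD('n) * (2 ^ m) ^ CARD('n) * t powr p) +
        t powr (p - 2) * (C * (2 ^ m) ^ CARD('n) * (1 / 2 ^ m) powr (2 * \<beta>))"
      by (intro add_mono sum_mono mult_right_mono mult_left_mono cardE sq) auto
    also have "\<dots> = C' * (2 ^ m) ^ CARD('n) * t powr p"
    proof -
      have "t powr (p - 2) * t powr 2 = t powr p" unfolding powr_add[symmetric] by simp
      then have "t powr (p - 2) * (X * t powr 2) = X * t powr p" for X
        by (metis mult.left_commute)
      then have "t powr (p - 2) * (C * (2 ^ m) ^ CARD('n) * t powr 2) = C * (2 ^ m) ^ CARD('n) * t powr p" .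
      then show ?thesis unfolding t2 C'_def by (simp only: sum_constant distrib_right mult.assoc)
    qed
    finally show ?thesis unfolding tp .
  qed
  then show ?thesis unfolding mn using C by (intro exI[of _ C']) (simp add: C'_def)
qed

text \<open>The exponent \<open>\<beta> < 1 / 2\<close> of the square sums is chosen such that both \<open>\<beta> > \<alpha>\<close> and \<open>2 * \<beta> / p > \<alpha>\<close>; the
first is what is needed for \<open>p < 2\<close>, the second for \<open>p \<ge> 2\<close>.\<close>

theorem theorem1:
  fixes M :: "'w measure"
    and \<mu> :: "(real^'n) set \<Rightarrow> 'w \<Rightarrow> real"
    and p \<alpha> :: real
  assumes "prob_space M" and "complete_measure M"
    and "stochastic_measure M (restrict_space borel unit_cube) \<mu>"
    and "\<exists>m :: (real^'n) measure.
           finite_measure m \<and> sets m = sets (restrict_space borel unit_cube) \<and>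
           (\<forall>g \<in> borel_measurable (restrict_space borel unit_cube).
              (\<forall>l>0::real. (\<integral>\<^sup>+x. ennreal (2 powr (l * \<bar>g x\<bar>)) \<partial>m) < \<infinity>) \<longrightarrow>
              sm_integrable M (restrict_space borel unit_cube) \<mu> g)"
    and "AE w in M. continuous_on unit_cube (\<lambda>x. \<mu> (cbox 0 x) w)"
    and "1 \<le> p" and "0 < \<alpha>" and "\<alpha> < min (1 / p) (1 / 2)"
  shows "AE w in M. (\<lambda>x. \<mu> (cbox 0 x) w) \<in> besov_space \<alpha> p p"
proof -
  have L0: "L0_measure M (restrict_space borel unit_cube) \<mu>"
    using assms(1,3) by (rule stochastic_measure_imp_L0_measure)
  have p: "1 \<le> p" by fact
  define b where "b = max \<alpha> (\<alpha> * p / 2)"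
  have b: "\<alpha> \<le> b" "\<alpha> * p / 2 \<le> b" "b < 1 / 2"
  proof -
    have "\<alpha> * p < 1" using assms(8) p by (simp add: pos_less_divide_eq)
    then show "b < 1 / 2" using assms(8) unfolding b_def by (simp only: max_less_iff_conj) simp
  qed (simp_all add: b_def)
  define \<beta> where "\<beta> = (b + 1 / 2) / 2"
  have \<beta>: "b < \<beta>" "\<beta> < 1 / 2" unfolding \<beta>_def using b(3) by simp_all
  have \<beta>0: "0 < \<beta>" using \<beta>(1) b(1) assms(7) by linarith
  define \<gamma> where "\<gamma> = min \<beta> (2 * \<beta> / p)"
  have \<gamma>: "\<alpha> < \<gamma>"
  proof -
    have "\<alpha> * p < 2 * \<beta>" using b(2) \<beta>(1) by linarith
    then have "\<alpha> < 2 * \<beta> / p" using p by (simp add: pos_less_divide_eq)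
    then show ?thesis using b(1) \<beta>(1) unfolding \<gamma>_def by simp
  qed
  have "AE w in M. \<forall>i\<in>UNIV. \<exists>C. \<forall>m. (\<Sum>k\<in>edges m i. (increment (\<lambda>x. \<mu> (cbox 0 x) w) m i k)\<^sup>2) \<le>
      C * (2 ^ m) ^ CARD('n) * (1 / 2 ^ m) powr (2 * \<beta>)"
    by (intro AE_finite_allI AE_square_increments_decay[OF L0 \<beta>0 \<beta>(2)]) simp
  with assms(5) show ?thesis
  proof eventually_elim
    case (elim w)
    define f where "f x = \<mu> (cbox 0 x) w" for x
    have f: "continuous_on unit_cube f" using elim(1) unfolding f_def .
    have "\<forall>i. \<exists>C. \<forall>m. (\<Sum>k\<in>edges m i. (increment f m i k)\<^sup>2) \<le>
        C * (2 ^ m) ^ CARD('n) * (1 / 2 ^ m) powr (2 * \<beta>)"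
      using elim(2) unfolding f_def by simp
    then obtain C where "\<forall>i m. (\<Sum>k\<in>edges m i. (increment f m i k)\<^sup>2) \<le>
        C i * (2 ^ m) ^ CARD('n) * (1 / 2 ^ m) powr (2 * \<beta>)"
      by (rule choice[THEN exE])
    then have C: "(\<Sum>k\<in>edges m i. (increment f m i k)\<^sup>2) \<le>
        C i * (2 ^ m) ^ CARD('n) * (1 / 2 ^ m) powr (2 * \<beta>)" for i m
      by (elim allE)
    define C0 where "C0 = (\<Sum>i\<in>UNIV. \<bar>C i\<bar>)"
    have sq: "(\<Sum>i\<in>UNIV. \<Sum>k\<in>edges m i. (increment f m i k)\<^sup>2) \<le>
        C0 * (2 ^ m) ^ CARD('n) * (1 / 2 ^ m) powr (2 * \<beta>)" for m
    proof -
      have "(\<Sum>i\<in>UNIV. \<Sum>k\<in>edges m i. (increment f m i k)\<^sup>2) \<le>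
          (\<Sum>i\<in>UNIV. \<bar>C i\<bar> * (2 ^ m) ^ CARD('n) * (1 / 2 ^ m) powr (2 * \<beta>))"
        by (intro sum_mono order_trans[OF C] mult_right_mono) auto
      then show ?thesis unfolding C0_def by (simp only: sum_distrib_right)
    qed
    have "bounded (f ` unit_cube)"
      using compact_continuous_image[OF f compact_cbox] by (rule compact_imp_bounded)
    then obtain B where B: "0 < B" "\<And>x. x \<in> unit_cube \<Longrightarrow> \<bar>f x\<bar> \<le> B"
      unfolding bounded_pos by auto
    obtain C' where C': "0 \<le> C'" "\<And>m. edge_energy f p m \<le> C' * (2 ^ m) ^ CARD('n) * (1 / 2 ^ m) powr (\<gamma> * p)"
      using edge_energy_le_of_square_sum[OF p \<beta>0 B _ sq] unfolding \<gamma>_def C0_def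
      by (auto simp: sum_nonneg)
    have "f \<in> besov_space \<alpha> p p"
      using assms(7) \<gamma> by (intro in_besov_space_if_edge_energy_decays[OF p f \<gamma> _ C']) simp
    then show ?case unfolding f_def .
  qed
qed

end
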